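(* Let $\varepsilon>0$ and let $\{A_\mu(t,x)\}_{\mu=0,1,2,3}$ be a real potential on $\mathbb R^{1+3}$, with $\mathbf A=(A^1,A^2,A^3)$ satisfying the Coulomb condition $\operatorname{div}\mathbf A=0$. Let $\mathbf E=\nabla A_0-\varepsilon\partial_t\mathbf A$ and $\mathbf B=\nabla\times\mathbf A$. For a 4-spinor field $\psi(t,x)\in\mathbb C^4$ (not required to solve any equation) the following identities hold: $$2\mathbf A\cdot\nabla\psi=-Q_{jk}(|\nabla|^{-1}a^{jk},\psi)$$ and $$\big\{i(E_j-\partial_jA_0)\alpha^j-B_jS^j\big\}\psi=Q_{jk}(|\nabla|^{-1}\varepsilon\partial_ta^{jk},U)-Q_{jk}(|\nabla|^{-1}\partial_la^{jk},\alpha^lU)+Q_0(A_j,\alpha^jU)+Q_{0j}(A_k,\alpha^j\alpha^kU)-\frac i2Q_{jk}(A_m,\epsilon^{jkl}S_l\alpha^mU),$$ where $$a_{jk}=R_jA_k-R_kA_j,\qquad R_j=|\nabla|^{-1}\partial_j,$$ and $U=U(\psi)$ is the 4-spinor defined by $$(\varepsilon^2\partial_t^2-\Delta)U=-i(\varepsilon\partial_t+\alpha^j\partial_j)\psi,\qquad U|_{t=0}=0,\qquad i\varepsilon\partial_tU|_{t=0}=\psi_0,$$ with $\psi_0=\psi|_{t=0}$.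
   Context: Repeated roman indices are summed over $1,2,3$; spatial indices are raised and lowered trivially; $\epsilon^{jkl}$ is the Levi-Civita symbol. $|\nabla|^{s}=(-\Delta)^{s/2}$. The bilinear null forms are, with $\partial_0=\varepsilon\partial_t$, $$Q_0(u,v)=\partial_0u\,\partial_0v-\nabla u\cdot\nabla v,\qquad Q_{\alpha\beta}(u,v)=\partial_\alpha u\,\partial_\beta v-\partial_\beta u\,\partial_\alpha v,\quad 0\le\alpha,\beta\le3.$$ In $2\times2$ blocks, $\alpha^j=\begin{pmatrix}0&\sigma^j\\\sigma^j&0\end{pmatrix}$ and $S^m=\begin{pmatrix}\sigma^m&0\\0&\sigma^m\end{pmatrix}$, with Pauli matrices $\sigma^1=\begin{pmatrix}0&1\\1&0\end{pmatrix}$, $\sigma^2=\begin{pmatrix}0&-i\\i&0\end{pmatrix}$, $\sigma^3=\begin{pmatrix}1&0\\0&-1\end{pmatrix}$. Functions are assumed regular and decaying enough that all expressions make sense. *)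

theory Defs
  imports "HOL-Analysis.Analysis"
begin

text \<open>
  Fields are functions \<open>f t x\<close> of \<open>t :: real\<close> and \<open>x :: real^3\<close>.  Spacetime indices are natural
  numbers in \<open>{0..3}\<close>, spatial ones in \<open>{1..3}\<close>; \<open>of_nat j :: 3\<close> is the \<open>j\<close>-th coordinate
  of \<open>real^3\<close> (in the index type \<open>3\<close> the numeral \<open>3\<close> equals \<open>0\<close>).  Spatial indices are
  raised and lowered trivially.
\<close>

type_synonym 'v field = "real \<Rightarrow> real^3 \<Rightarrow> 'v"
type_synonym spinor = "complex^4"

definition line :: "nat \<Rightarrow> 'v field \<Rightarrow> real \<Rightarrow> real^3 \<Rightarrow> real \<Rightarrow> 'v" where
  "line \<mu> f t x h =
     (if \<mu> = 0 then f (t + h) x else f t (x + h *\<^sub>R axis (of_nat \<mu>) 1))"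

definition pd :: "nat \<Rightarrow> 'v::real_normed_vector field \<Rightarrow> 'v field" where
  "pd \<mu> f t x = vector_derivative (line \<mu> f t x) (at 0)"

definition dd :: "real \<Rightarrow> nat \<Rightarrow> 'v::real_normed_vector field \<Rightarrow> 'v field" where
  "dd \<epsilon> \<mu> f t x = (if \<mu> = 0 then \<epsilon> *\<^sub>R pd 0 f t x else pd \<mu> f t x)"

definition Q0 :: "real \<Rightarrow> complex field \<Rightarrow> spinor field \<Rightarrow> spinor field" where
  "Q0 \<epsilon> u v t x =
     dd \<epsilon> 0 u t x *s dd \<epsilon> 0 v t x - (\<Sum>j=1..3. pd j u t x *s pd j v t x)"

definition Q :: "real \<Rightarrow> nat \<Rightarrow> nat \<Rightarrow> complex field \<Rightarrow> spinor field \<Rightarrow> spinor field" where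
  "Q \<epsilon> \<mu> \<nu> u v t x =
     dd \<epsilon> \<mu> u t x *s dd \<epsilon> \<nu> v t x - dd \<epsilon> \<nu> u t x *s dd \<epsilon> \<mu> v t x"

primrec Ck :: "nat \<Rightarrow> 'v::real_normed_vector field \<Rightarrow> bool" where
  "Ck 0 f \<longleftrightarrow> continuous_on UNIV (\<lambda>(t, x). f t x)"
| "Ck (Suc n) f \<longleftrightarrow> continuous_on UNIV (\<lambda>(t, x). f t x) \<and>
     (\<forall>\<mu>\<in>{0..3}. (\<forall>t x. line \<mu> f t x differentiable at 0) \<and> Ck n (pd \<mu> f))"

text \<open>All derivatives up to order \<open>n\<close> are \<open>O((1 + |x|)^(-N))\<close>, locally uniformly in time.\<close>

primrec decays :: "nat \<Rightarrow> nat \<Rightarrow> 'v::real_normed_vector field \<Rightarrow> bool" where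
  "decays N 0 f \<longleftrightarrow>
     (\<forall>T. \<exists>C. \<forall>t x. \<bar>t\<bar> \<le> T \<longrightarrow> norm (f t x) \<le> C / (1 + norm x) ^ N)"
| "decays N (Suc n) f \<longleftrightarrow>
     (\<forall>T. \<exists>C. \<forall>t x. \<bar>t\<bar> \<le> T \<longrightarrow> norm (f t x) \<le> C / (1 + norm x) ^ N) \<and>
     (\<forall>\<mu>\<in>{0..3}. decays N n (pd \<mu> f))"

definition inv_fourier :: "(real^3 \<Rightarrow> complex) \<Rightarrow> real^3 \<Rightarrow> complex" where
  "inv_fourier g x =
     complex_of_real (1 / (2 * pi) ^ 3) * (LINT \<xi>|lborel. cis (\<xi> \<bullet> x) * g \<xi>)"

text \<open>
  The Fourier transform is taken on the space of functions whose (distributional) Fourier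
  transform is integrable: it is the integrable \<open>g\<close>, unique up to a null set, with
  \<open>f = inv_fourier g\<close>.  Unlike the Fourier integral of \<open>f\<close>, this does not need \<open>f\<close> itself to be
  integrable, which is useful because Riesz transforms do not preserve integrability.
\<close>

definition fourier :: "(real^3 \<Rightarrow> complex) \<Rightarrow> real^3 \<Rightarrow> complex" where
  "fourier f = (SOME g. integrable lborel g \<and> (\<forall>x. f x = inv_fourier g x))"

text \<open>\<open>(-\<Delta>)^(s/2)\<close> in the space variable, i.e. the multiplier with symbol \<open>|\<xi>|^s\<close>.\<close>

definition nabla_pow :: "real \<Rightarrow> complex field \<Rightarrow> complex field" where
  "nabla_pow s f t x =
     inv_fourier (\<lambda>\<xi>. complex_of_real (norm \<xi> powr s) * fourier (f t) \<xi>) x"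

definition Riesz :: "nat \<Rightarrow> complex field \<Rightarrow> complex field" where
  "Riesz j f = nabla_pow (-1) (pd j f)"

definition levi_civita :: "nat \<Rightarrow> nat \<Rightarrow> nat \<Rightarrow> 'a::ring_1" where
  "levi_civita j k l =
     (if (j, k, l) \<in> {(1, 2, 3), (2, 3, 1), (3, 1, 2)} then 1
      else if (j, k, l) \<in> {(3, 2, 1), (2, 1, 3), (1, 3, 2)} then -1
      else 0)"

definition pauli :: "nat \<Rightarrow> complex^2^2" where
  "pauli j =
     (if j = 1 then vector [vector [0, 1], vector [1, 0]]
      else if j = 2 then vector [vector [0, -\<i>], vector [\<i>, 0]]
      else vector [vector [1, 0], vector [0, -1]])"

definition block :: "complex^2^2 \<Rightarrow> complex^2^2 \<Rightarrow> complex^2^2 \<Rightarrow> complex^2^2 \<Rightarrow> complex^4^4" where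
  "block K L M N = vector
     [vector [K$1$1, K$1$2, L$1$1, L$1$2],
      vector [K$2$1, K$2$2, L$2$1, L$2$2],
      vector [M$1$1, M$1$2, N$1$1, N$1$2],
      vector [M$2$1, M$2$2, N$2$1, N$2$2]]"

definition alpha :: "nat \<Rightarrow> complex^4^4" where
  "alpha j = block 0 (pauli j) (pauli j) 0"

definition spin :: "nat \<Rightarrow> complex^4^4" where
  "spin j = block (pauli j) 0 0 (pauli j)"

definition cfield :: "real field \<Rightarrow> complex field" where
  "cfield f t x = complex_of_real (f t x)"

definition coulomb :: "(nat \<Rightarrow> real field) \<Rightarrow> bool" where
  "coulomb A \<longleftrightarrow> (\<forall>t x. (\<Sum>j=1..3. pd j (A j) t x) = 0)"

definition Efield :: "real \<Rightarrow> (nat \<Rightarrow> real field) \<Rightarrow> nat \<Rightarrow> real field" where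
  "Efield \<epsilon> A j t x = pd j (A 0) t x - \<epsilon> * pd 0 (A j) t x"

definition Bfield :: "(nat \<Rightarrow> real field) \<Rightarrow> nat \<Rightarrow> real field" where
  "Bfield A j t x = (\<Sum>k=1..3. \<Sum>l=1..3. levi_civita j k l * pd k (A l) t x)"

definition apot :: "(nat \<Rightarrow> real field) \<Rightarrow> nat \<Rightarrow> nat \<Rightarrow> complex field" where
  "apot A j k t x = Riesz j (cfield (A k)) t x - Riesz k (cfield (A j)) t x"

definition aux_spinor :: "real \<Rightarrow> spinor field \<Rightarrow> spinor field \<Rightarrow> bool" where
  "aux_spinor \<epsilon> \<psi> U \<longleftrightarrow>
     (\<forall>t x. \<epsilon>\<^sup>2 *\<^sub>R pd 0 (pd 0 U) t x - (\<Sum>j=1..3. pd j (pd j U) t x) =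
        (-\<i>) *s (\<epsilon> *\<^sub>R pd 0 \<psi> t x + (\<Sum>j=1..3. alpha j *v pd j \<psi> t x))) \<and>
     (\<forall>x. U 0 x = 0) \<and>
     (\<forall>x. \<i> *s (\<epsilon> *\<^sub>R pd 0 U 0 x) = \<psi> 0 x)"

end

theory Submission
  imports Defs "HOL-Probability.Probability"
begin

text \<open>
  Since \<open>div A = 0\<close>, the potential is recovered from \<open>a\<^sub>j\<^sub>k\<close> by \<open>\<partial>\<^sub>j |\<nabla>|\<^sup>-\<^sup>1 a\<^sub>j\<^sub>k = - A\<^sub>k\<close>, and \<open>a\<^sub>j\<^sub>k\<close> is
  antisymmetric; so every null form \<open>Q\<^sub>j\<^sub>k (|\<nabla>|\<^sup>-\<^sup>1 a\<^sub>j\<^sub>k, v)\<close> collapses to \<open>- 2 A\<^sub>k \<partial>\<^sub>k v\<close>, likewise with a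
  derivative on \<open>a\<close>. Because \<open>fourier\<close> is a choice among integrable functions, this rests on Fourier
  inversion (to have a representative) and on injectivity of the Fourier transform on \<open>L\<^sup>1\<close> (to know
  it almost everywhere).

  For the second identity, \<open>w = \<psi> - i (\<epsilon> \<partial>\<^sub>t - \<alpha>\<^sup>j \<partial>\<^sub>j) U\<close> solves the homogeneous Dirac equation with zero
  data, as \<open>(\<epsilon> \<partial>\<^sub>t + \<alpha>\<^sup>j \<partial>\<^sub>j) (\<epsilon> \<partial>\<^sub>t - \<alpha>\<^sup>j \<partial>\<^sub>j) = \<epsilon>\<^sup>2 \<partial>\<^sub>t\<^sup>2 - \<Delta>\<close>. A localised energy estimate gives \<open>w = 0\<close> without
  any decay assumption on \<open>\<psi>\<close> or \<open>U\<close>. Inserting \<open>\<psi> = i (\<epsilon> \<partial>\<^sub>t - \<alpha>\<^sup>j \<partial>\<^sub>j) U\<close> leaves an identity in the algebra of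
  the matrices \<open>\<alpha>\<^sup>j\<close>, \<open>S\<^sup>m\<close>.
\<close>

subsection \<open>Fourier inversion and injectivity\<close>

text \<open>The obstacle is the singularity of \<open>|nabla|^(-1)\<close> at low frequencies: the
  symbol of \<open>|nabla|^(-1) a\<close> behaves like \<open>1 / |\<xi>|\<close>, locally
  integrable in three dimensions but unbounded, and \<open>a\<close> itself arises from Riesz
  transforms, so no integrability in \<open>x\<close> is available for it. All estimates on
  \<open>a\<close> are therefore made on the frequency side, starting from the decay of the Fourier
  integral of \<open>A\<close>; only derivatives of \<open>|nabla|^(-1) a\<close> enter the null
  forms, and there the singularity cancels. Inversion and injectivity both come from one
  computation: weighting a Fourier integral with a wide Gaussian turns it into a Gaussian average of
  the original function at a small scale. The exponent 4 in the decay conditions, in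
  \<open>x\<close> and in frequency, is the least integer above the dimension 3, that is, the least
  one for which \<open>(1 + |x|)^(-N)\<close> is integrable. In the energy estimate the cutoff
  supplies compact support in \<open>x\<close>, so that the same integration lemmas, stated for
  decay of order 4, apply to fields on which nothing is assumed at infinity.\<close>

lemma lborel_prod_Basis:
  fixes f :: "'a::euclidean_space \<Rightarrow> real \<Rightarrow> 'b::{real_normed_field,banach,second_countable_topology}"
  assumes f: "\<And>b. b \<in> Basis \<Longrightarrow> integrable lborel (f b)"
  shows integrable_lborel_prod_Basis: "integrable lborel (\<lambda>x::'a. \<Prod>b\<in>Basis. f b (x \<bullet> b))"
    and integral_lborel_prod_Basis:
      "(LINT x|lborel. (\<Prod>b\<in>Basis. f b (x \<bullet> b))) = (\<Prod>b\<in>Basis. LINT s|lborel. f b s)"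
proof -
  interpret product_sigma_finite "\<lambda>_::'a. lborel::real measure" ..
  have [measurable]: "f b \<in> borel_measurable borel" if "b \<in> Basis" for b
    using borel_measurable_integrable[OF f[OF that]] by simp
  let ?T = "\<lambda>h. \<Sum>b\<in>Basis. h b *\<^sub>R b :: 'a"
  have m: "(\<lambda>x::'a. \<Prod>b\<in>Basis. f b (x \<bullet> b)) \<in> borel_measurable borel"
    by measurable
  have eq: "(\<lambda>h. \<Prod>b\<in>Basis. f b (?T h \<bullet> b)) = (\<lambda>h. \<Prod>b\<in>Basis. f b (h b))"
    by (auto intro!: ext prod.cong)
  have "integrable (Pi\<^sub>M Basis (\<lambda>_::'a. lborel)) (\<lambda>h. \<Prod>b\<in>Basis. f b (h b))"
    by (rule product_integrable_prod) (auto intro: f)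
  then show "integrable lborel (\<lambda>x::'a. \<Prod>b\<in>Basis. f b (x \<bullet> b))"
    by (subst lborel_eq, subst integrable_distr_eq) (use m in \<open>auto simp: eq\<close>)
  have "(LINT x|lborel. (\<Prod>b\<in>Basis. f b (x \<bullet> b))) =
      integral\<^sup>L (Pi\<^sub>M Basis (\<lambda>_::'a. lborel)) (\<lambda>h. \<Prod>b\<in>Basis. f b (h b))"
    by (subst lborel_eq, subst integral_distr) (use m in \<open>auto simp: eq\<close>)
  also have "\<dots> = (\<Prod>b\<in>Basis. LINT s|lborel. f b s)"
    by (rule product_integral_prod) (auto intro: f)
  finally show "(LINT x|lborel. (\<Prod>b\<in>Basis. f b (x \<bullet> b))) = (\<Prod>b\<in>Basis. LINT s|lborel. f b s)" .
qed

lemma lborel_integral_affine: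
  fixes f :: "'a::euclidean_space \<Rightarrow> 'b::{banach,second_countable_topology}"
  assumes f: "f \<in> borel_measurable borel" and c: "c \<noteq> 0"
  shows "(LINT x|lborel. f x) = \<bar>c\<bar> ^ DIM('a) *\<^sub>R (LINT x|lborel. f (t + c *\<^sub>R x))"
  by (subst lborel_affine[OF c, of t])
     (use f in \<open>simp add: integral_density integral_distr\<close>)

lemma lborel_integrable_affine:
  fixes f :: "'a::euclidean_space \<Rightarrow> 'b::{banach,second_countable_topology}"
  assumes f: "integrable lborel f" and c: "c \<noteq> 0"
  shows "integrable lborel (\<lambda>x. f (t + c *\<^sub>R x))"
proof -
  have m: "f \<in> borel_measurable borel" using borel_measurable_integrable[OF f] by simp
  have "integrable (density (distr lborel borel (\<lambda>x. t + c *\<^sub>R x)) (\<lambda>_. \<bar>c\<bar>^DIM('a))) f"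
    using f lborel_affine[OF c, of t] by simp
  then have "integrable lborel (\<lambda>x. \<bar>c\<bar>^DIM('a) *\<^sub>R f (t + c *\<^sub>R x))" using m c
    by (simp add: integrable_density integrable_distr_eq)
  then have "integrable lborel (\<lambda>x. inverse (\<bar>c\<bar>^DIM('a)) *\<^sub>R \<bar>c\<bar>^DIM('a) *\<^sub>R f (t + c *\<^sub>R x))"
    by (rule integrable_scaleR_right)
  then show ?thesis using c by simp
qed

section \<open>Gaussian regularisation of Fourier integrals\<close>

definition gauss :: "'a::euclidean_space \<Rightarrow> real" where
  "gauss x = (\<Prod>b\<in>Basis. std_normal_density (x \<bullet> b))"

lemma norm_squared_Basis: "(norm (x::'a::euclidean_space))\<^sup>2 = (\<Sum>b\<in>Basis. (x \<bullet> b)\<^sup>2)"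
  unfolding power2_norm_eq_inner euclidean_inner[of x x] by (simp add: power2_eq_square)

lemma gauss_eq: "gauss (x::'a::euclidean_space) = exp (- (norm x)\<^sup>2 / 2) / sqrt (2 * pi) ^ DIM('a)"
  by (simp add: gauss_def std_normal_density_def prod.distrib prod_dividef exp_sum[symmetric]
      norm_squared_Basis sum_divide_distrib sum_negf)

lemma gauss_nonneg [simp]: "0 \<le> gauss x"
  by (simp add: gauss_eq)

lemma continuous_on_gauss [continuous_intros]:
  "continuous_on S f \<Longrightarrow> continuous_on S (\<lambda>x. gauss (f x))"
  unfolding gauss_eq by (intro continuous_intros) auto

lemma gauss_measurable [measurable]: "gauss \<in> borel_measurable borel"
  by (intro borel_measurable_continuous_onI continuous_intros)

lemma integrable_std_normal_density: "integrable lborel std_normal_density"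
  using integrable_std_normal_moment[of 0] by simp

lemma integrable_gauss: "integrable lborel (gauss :: 'a::euclidean_space \<Rightarrow> real)"
  unfolding gauss_def by (intro integrable_lborel_prod_Basis integrable_std_normal_density)

lemma integral_gauss: "(LINT x|lborel. gauss (x::'a::euclidean_space)) = 1"
  unfolding gauss_def
  by (subst integral_lborel_prod_Basis) (auto intro: integrable_std_normal_density)

text \<open>Both the Gaussian and the exponential are products over the coordinates, so only the
  one-dimensional case is left; that is the characteristic function of the standard normal
  distribution.\<close>

lemma fourier_gauss:
  "(LINT z|lborel. cis (v \<bullet> z) * complex_of_real (gauss z)) =
     complex_of_real (sqrt (2 * pi) ^ DIM('a) * gauss (v::'a::euclidean_space))"
proof -
  have i: "integrable lborel (\<lambda>s. cis (a * s) * complex_of_real (std_normal_density s))" for a :: real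
    by (rule Bochner_Integration.integrable_bound[OF integrable_std_normal_density])
       (auto simp: norm_mult cis_conv_exp)
  have 1: "(LINT s|lborel. cis (a * s) * complex_of_real (std_normal_density s)) = complex_of_real (exp (- a\<^sup>2 / 2))" for a :: real
  proof -
    have "char std_normal_distribution a = complex_of_real (exp (- a\<^sup>2 / 2))"
      by (simp add: char_std_normal_distribution)
    moreover have "char std_normal_distribution a = (LINT s|lborel. cis (a * s) * complex_of_real (std_normal_density s))"
      unfolding char_def
      by (subst integral_density) (auto simp: cis_conv_exp scaleR_conv_of_real mult_ac)
    ultimately show ?thesis by simp
  qed
  have "(LINT z|lborel. cis (v \<bullet> z) * complex_of_real (gauss z)) =
      (LINT z|lborel. (\<Prod>b\<in>Basis. cis ((v \<bullet> b) * (z \<bullet> b)) * complex_of_real (std_normal_density (z \<bullet> b))))"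
  proof (intro Bochner_Integration.integral_cong refl)
    fix z :: 'a
    have "cis (v \<bullet> z) = cis (\<Sum>b\<in>Basis. (v \<bullet> b) * (z \<bullet> b))"
      by (subst euclidean_inner) (rule refl)
    also have "\<dots> = (\<Prod>b\<in>Basis. cis ((v \<bullet> b) * (z \<bullet> b)))"
      by (simp add: cis_conv_exp exp_sum sum_distrib_left)
    finally show "cis (v \<bullet> z) * complex_of_real (gauss z) =
        (\<Prod>b\<in>Basis. cis ((v \<bullet> b) * (z \<bullet> b)) * complex_of_real (std_normal_density (z \<bullet> b)))"
      by (simp add: gauss_def prod.distrib)
  qed
  also have "\<dots> = (\<Prod>b\<in>Basis. complex_of_real (exp (- (v \<bullet> b)\<^sup>2 / 2)))"
    by (subst integral_lborel_prod_Basis[OF i]) (simp add: 1)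
  also have "\<dots> = complex_of_real (exp (- (norm v)\<^sup>2 / 2))"
    by (simp only: of_real_prod[symmetric])
       (simp add: exp_sum[symmetric] norm_squared_Basis sum_divide_distrib sum_negf)
  finally show ?thesis by (simp add: gauss_eq)
qed

lemma fourier_gauss_scaled:
  fixes v :: "'a::euclidean_space"
  assumes d: "d > 0"
  shows "(LINT x|lborel. cis (x \<bullet> v) * complex_of_real (gauss (d *\<^sub>R x))) =
    complex_of_real (sqrt (2 * pi) ^ DIM('a) * gauss (v /\<^sub>R d) / d ^ DIM('a))"
proof -
  let ?J = "LINT x|lborel. cis (x \<bullet> v) * complex_of_real (gauss (d *\<^sub>R x))"
  have arg: "(v /\<^sub>R d) \<bullet> (0 + d *\<^sub>R x) = x \<bullet> v" for x
    using d by (simp add: inner_commute[of v])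
  have "(LINT z|lborel. cis ((v /\<^sub>R d) \<bullet> z) * complex_of_real (gauss z)) =
     \<bar>d\<bar> ^ DIM('a) *\<^sub>R (LINT x|lborel. cis ((v /\<^sub>R d) \<bullet> (0 + d *\<^sub>R x)) * complex_of_real (gauss (0 + d *\<^sub>R x)))"
    by (rule lborel_integral_affine[where f = "\<lambda>z. cis ((v /\<^sub>R d) \<bullet> z) * complex_of_real (gauss z)"])
       (use d in \<open>auto simp: cis_conv_exp\<close>)
  also have "\<dots> = complex_of_real (d ^ DIM('a)) * ?J"
    unfolding arg using d by (simp add: scaleR_conv_of_real)
  finally have J: "complex_of_real (sqrt (2 * pi) ^ DIM('a) * gauss (v /\<^sub>R d)) = complex_of_real (d ^ DIM('a)) * ?J"
    unfolding fourier_gauss .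
  have "complex_of_real (d ^ DIM('a)) * ?J / complex_of_real (d ^ DIM('a)) = ?J"
    using d by simp
  then show ?thesis
    unfolding J[symmetric] by (simp only: of_real_divide)
qed

lemma integrable_cis_mult:
  fixes g :: "'a::euclidean_space \<Rightarrow> complex"
  assumes "integrable lborel g" "h \<in> borel_measurable borel"
  shows "integrable lborel (\<lambda>x. cis (h x) * g x)"
  by (rule Bochner_Integration.integrable_bound[OF assms(1)])
     (use assms borel_measurable_integrable[OF assms(1)] in \<open>auto simp: norm_mult cis_conv_exp\<close>)

text \<open>By Fubini the \<open>x\<close> integral can be done first and is the transform of a
  scaled Gaussian, concentrated near \<open>\<xi> = \<eta>\<close>. What is left is an average of
  \<open>g\<close> around \<open>\<eta>\<close> at scale \<open>d\<close>. The Gaussian factor makes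
  the double integral absolutely convergent, since the inner Fourier integral is merely
  bounded.\<close>

lemma fourier_regularized:
  fixes g :: "'a::euclidean_space \<Rightarrow> complex"
  assumes g: "integrable lborel g" and d: "d > 0"
  shows "(LINT x|lborel. cis (- (x \<bullet> \<eta>)) * complex_of_real (gauss (d *\<^sub>R x)) * (LINT \<xi>|lborel. cis (\<xi> \<bullet> x) * g \<xi>)) =
    complex_of_real (sqrt (2 * pi) ^ DIM('a)) * (LINT z|lborel. g (\<eta> + d *\<^sub>R z) * complex_of_real (gauss z))"
proof -
  have [measurable]: "g \<in> borel_measurable borel" using borel_measurable_integrable[OF g] by simp
  let ?G = "\<lambda>x. complex_of_real (gauss (d *\<^sub>R x :: 'a))"
  let ?F = "\<lambda>x \<xi>. cis (x \<bullet> (\<xi> - \<eta>)) * (?G x * g \<xi>)"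
  have iG: "integrable lborel ?G"
    using lborel_integrable_affine[OF integrable_gauss, of d 0] d
    by (simp add: complex_of_real_integrable_eq)
  have meas: "(\<lambda>(x, \<xi>). ?F x \<xi>) \<in> borel_measurable (lborel \<Otimes>\<^sub>M lborel)"
    unfolding cis_conv_exp by measurable
  have int: "integrable (lborel \<Otimes>\<^sub>M lborel) (\<lambda>(x, \<xi>). ?F x \<xi>)"
  proof (rule lborel_pair.Fubini_integrable[OF meas])
    have "integrable lborel (\<lambda>x. ?G x * complex_of_real (LINT \<xi>|lborel. norm (g \<xi>)))"
      using iG by simp
    then have "integrable lborel (\<lambda>x::'a. gauss (d *\<^sub>R x) * (LINT \<xi>|lborel. norm (g \<xi>)))"
      by (simp flip: of_real_mult add: complex_of_real_integrable_eq)
    then show "integrable lborel (\<lambda>x. LINT \<xi>|lborel. norm (case (x, \<xi>) of (x, \<xi>) \<Rightarrow> ?F x \<xi>))"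
      by (simp add: norm_mult)
    show "AE x in lborel. integrable lborel (\<lambda>\<xi>. case (x, \<xi>) of (x, \<xi>) \<Rightarrow> ?F x \<xi>)"
      using g by (auto intro!: integrable_cis_mult)
  qed
  have "(LINT x|lborel. cis (- (x \<bullet> \<eta>)) * ?G x * (LINT \<xi>|lborel. cis (\<xi> \<bullet> x) * g \<xi>)) =
     (LINT x|lborel. LINT \<xi>|lborel. ?F x \<xi>)"
  proof (intro Bochner_Integration.integral_cong refl)
    fix x :: 'a
    have split: "cis (x \<bullet> (\<xi> - \<eta>)) = cis (- (x \<bullet> \<eta>)) * cis (\<xi> \<bullet> x)" for \<xi>
      by (simp add: cis_mult inner_diff_right inner_commute)
    have "?F x \<xi> = cis (- (x \<bullet> \<eta>)) * ?G x * (cis (\<xi> \<bullet> x) * g \<xi>)" for \<xi>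
      unfolding split by (simp only: mult_ac)
    then show "cis (- (x \<bullet> \<eta>)) * ?G x * (LINT \<xi>|lborel. cis (\<xi> \<bullet> x) * g \<xi>) = (LINT \<xi>|lborel. ?F x \<xi>)"
      by (simp only: integral_mult_right_zero)
  qed
  also have "\<dots> = (LINT \<xi>|lborel. LINT x|lborel. ?F x \<xi>)"
    using lborel_pair.Fubini_integral[OF int] by simp
  also have "\<dots> = (LINT \<xi>|lborel. g \<xi> * (LINT x|lborel. cis (x \<bullet> (\<xi> - \<eta>)) * ?G x))"
  proof (intro Bochner_Integration.integral_cong refl)
    fix \<xi> :: 'a
    have "?F x \<xi> = g \<xi> * (cis (x \<bullet> (\<xi> - \<eta>)) * ?G x)" for x
      by (simp add: mult_ac)
    then show "(LINT x|lborel. ?F x \<xi>) = g \<xi> * (LINT x|lborel. cis (x \<bullet> (\<xi> - \<eta>)) * ?G x)"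
      by (simp only: integral_mult_right_zero)
  qed
  also have "\<dots> = (LINT \<xi>|lborel. g \<xi> * complex_of_real (sqrt (2 * pi) ^ DIM('a) * gauss ((\<xi> - \<eta>) /\<^sub>R d) / d ^ DIM('a)))"
    by (subst fourier_gauss_scaled[OF d]) simp
  \<comment> \<open>Substitution \<open>\<xi> = \<eta> + d z\<close>; the Jacobian cancels the power
    of \<open>d\<close> from \<open>fourier_gauss_scaled\<close>.\<close>
  also have "\<dots> = \<bar>d\<bar> ^ DIM('a) *\<^sub>R (LINT z|lborel. g (\<eta> + d *\<^sub>R z) *
      complex_of_real (sqrt (2 * pi) ^ DIM('a) * gauss (((\<eta> + d *\<^sub>R z) - \<eta>) /\<^sub>R d) / d ^ DIM('a)))"
    by (rule lborel_integral_affine) (use d in auto)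
  also have "\<dots> = complex_of_real (sqrt (2 * pi) ^ DIM('a)) * (LINT z|lborel. g (\<eta> + d *\<^sub>R z) * complex_of_real (gauss z))"
  proof -
    have "g (\<eta> + d *\<^sub>R z) * complex_of_real (sqrt (2 * pi) ^ DIM('a) * gauss (((\<eta> + d *\<^sub>R z) - \<eta>) /\<^sub>R d) / d ^ DIM('a)) =
        complex_of_real (sqrt (2 * pi) ^ DIM('a) / d ^ DIM('a)) * (g (\<eta> + d *\<^sub>R z) * complex_of_real (gauss z))" for z
      using d by simp
    then show ?thesis
      using d by (simp only: integral_mult_right_zero) (simp add: scaleR_conv_of_real)
  qed
  finally show ?thesis .
qed

text \<open>Dominated convergence with majorant \<open>B * gauss z\<close>, the Gaussian having
  total mass 1. Continuity is asked at the single point \<open>\<eta>\<close>, which is the form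
  that \<open>fourier_injective\<close> can supply.\<close>

lemma tendsto_gauss_regularization:
  fixes g :: "'a::euclidean_space \<Rightarrow> complex"
  assumes g: "g \<in> borel_measurable borel" and B: "\<And>x. norm (g x) \<le> B" and c: "isCont g \<eta>"
  shows "(\<lambda>n. LINT z|lborel. g (\<eta> + inverse (real (Suc n)) *\<^sub>R z) * complex_of_real (gauss z)) \<longlonglongrightarrow> g \<eta>"
proof -
  have lim: "(\<lambda>n. g (\<eta> + inverse (real (Suc n)) *\<^sub>R z) * complex_of_real (gauss z)) \<longlonglongrightarrow> g \<eta> * complex_of_real (gauss z)" for z
  proof (intro tendsto_intros isCont_tendsto_compose[OF c])
    show "(\<lambda>n. \<eta> + inverse (real (Suc n)) *\<^sub>R z) \<longlonglongrightarrow> \<eta>"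
      using tendsto_add[OF tendsto_const tendsto_scaleR[OF LIMSEQ_inverse_real_of_nat tendsto_const], of \<eta> z] by simp
  qed
  have "(\<lambda>n. LINT z|lborel. g (\<eta> + inverse (real (Suc n)) *\<^sub>R z) * complex_of_real (gauss z)) \<longlonglongrightarrow>
     (LINT z|lborel. g \<eta> * complex_of_real (gauss (z::'a)))"
  proof (rule integral_dominated_convergence[where w = "\<lambda>z. B * gauss z"])
    show "integrable lborel (\<lambda>z::'a. B * gauss z)" by (simp add: integrable_gauss)
    show "AE z in lborel. norm (g (\<eta> + inverse (real (Suc n)) *\<^sub>R z) * complex_of_real (gauss z)) \<le> B * gauss z" for n
      by (auto simp: norm_mult intro!: mult_right_mono B AE_I2)
  qed (use g lim in auto)
  also have "(LINT z|lborel. g \<eta> * complex_of_real (gauss (z::'a))) = g \<eta>"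
    by (simp add: integral_gauss)
  finally show ?thesis .
qed

text \<open>The regularised integral of \<open>u\<close> has two limits as the Gaussian widens: by
  \<open>fourier_regularized\<close> a multiple of \<open>f \<eta>\<close>, by dominated convergence
  \<open>gauss 0\<close> times the unregularised integral. Since \<open>gauss 0\<close> is the
  inverse of \<open>sqrt (2 * pi) ^ DIM('a)\<close>, comparing them gives the constant.\<close>

lemma fourier_inversion:
  fixes f :: "'a::euclidean_space \<Rightarrow> complex"
  defines "u \<equiv> \<lambda>\<xi>. LINT x|lborel. cis (- (x \<bullet> \<xi>)) * f x"
  assumes f: "integrable lborel f" and cont: "continuous_on UNIV f" and B: "\<And>x. norm (f x) \<le> B"
    and u: "integrable lborel u"
  shows "complex_of_real ((2 * pi) ^ DIM('a)) * f \<eta> = (LINT \<xi>|lborel. cis (\<xi> \<bullet> \<eta>) * u \<xi>)"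
proof -
  have [measurable]: "u \<in> borel_measurable borel" using borel_measurable_integrable[OF u] by simp
  have [measurable]: "f \<in> borel_measurable borel" using borel_measurable_integrable[OF f] by simp
  let ?d = "\<lambda>n. inverse (real (Suc n))"
  have c: "isCont f x" for x
    using cont by (simp add: continuous_on_eq_continuous_at)
  have reg: "(LINT x|lborel. cis (x \<bullet> \<eta>) * complex_of_real (gauss (?d n *\<^sub>R x)) * u x) =
      complex_of_real (sqrt (2 * pi) ^ DIM('a)) * (LINT z|lborel. f (\<eta> + ?d n *\<^sub>R z) * complex_of_real (gauss z))" for n
  proof -
    \<comment> \<open>\<open>fourier_regularized\<close> has the kernel with the positive sign.
      Reflecting \<open>f\<close> brings \<open>u\<close> into that form, and the evaluation point
      becomes \<open>- \<eta>\<close>.\<close>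
    have "integrable lborel (\<lambda>x. f (0 + (-1) *\<^sub>R x))"
      by (rule lborel_integrable_affine[OF f]) simp
    then have fm: "integrable lborel (\<lambda>x. f (- x))" by simp
    have sub: "(LINT x|lborel. h (- x)) = (LINT x|lborel. h x)" if "h \<in> borel_measurable borel" for h :: "'a \<Rightarrow> complex"
      using lborel_integral_affine[OF that, of "-1" 0] by simp
    have "(LINT \<xi>|lborel. cis (\<xi> \<bullet> x) * f (- \<xi>)) = u x" for x
      unfolding u_def using sub[of "\<lambda>y. cis (- (y \<bullet> x)) * f y"] by (simp add: cis_conv_exp)
    then have "(LINT x|lborel. cis (x \<bullet> \<eta>) * complex_of_real (gauss (?d n *\<^sub>R x)) * u x) =
       complex_of_real (sqrt (2 * pi) ^ DIM('a)) * (LINT z|lborel. f (- (- \<eta> + ?d n *\<^sub>R z)) * complex_of_real (gauss z))"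
      using fourier_regularized[OF fm, of "?d n" "- \<eta>"] by simp
    also have "(LINT z|lborel. f (- (- \<eta> + ?d n *\<^sub>R z)) * complex_of_real (gauss z)) =
       (LINT z|lborel. f (\<eta> + ?d n *\<^sub>R z) * complex_of_real (gauss z))"
      using sub[of "\<lambda>z. f (\<eta> + ?d n *\<^sub>R z) * complex_of_real (gauss z)"] by (simp add: gauss_eq)
    finally show ?thesis .
  qed
  have lim1: "(\<lambda>n. LINT x|lborel. cis (x \<bullet> \<eta>) * complex_of_real (gauss (?d n *\<^sub>R x)) * u x) \<longlonglongrightarrow>
     complex_of_real (sqrt (2 * pi) ^ DIM('a)) * f \<eta>"
    unfolding reg by (intro tendsto_intros tendsto_gauss_regularization[OF _ B c]) auto
  have gauss_le: "gauss x \<le> gauss (0::'a)" for x :: 'a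
    by (simp add: gauss_eq divide_right_mono)
  have lim2: "(\<lambda>n. LINT x|lborel. cis (x \<bullet> \<eta>) * complex_of_real (gauss (?d n *\<^sub>R x)) * u x) \<longlonglongrightarrow>
     (LINT x|lborel. cis (x \<bullet> \<eta>) * complex_of_real (gauss (0::'a)) * u x)"
  proof (rule integral_dominated_convergence[where w = "\<lambda>x. gauss (0::'a) * norm (u x)"])
    show "integrable lborel (\<lambda>x. gauss (0::'a) * norm (u x))" using u by simp
    show "AE x in lborel. norm (cis (x \<bullet> \<eta>) * complex_of_real (gauss (?d n *\<^sub>R x)) * u x) \<le> gauss (0::'a) * norm (u x)" for n
      using gauss_le by (auto simp: norm_mult intro!: AE_I2 mult_right_mono)
    have "isCont gauss (0::'a)"
      using continuous_on_gauss[OF continuous_on_id, of "UNIV::'a set"] by (simp add: continuous_on_eq_continuous_at)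
    have "(\<lambda>n. gauss (?d n *\<^sub>R x)) \<longlonglongrightarrow> gauss (0::'a)" for x :: 'a
    proof (rule isCont_tendsto_compose[where g = gauss])
      show "isCont gauss (0::'a)" by fact
      show "(\<lambda>n. ?d n *\<^sub>R x) \<longlonglongrightarrow> 0"
        using tendsto_scaleR[OF LIMSEQ_inverse_real_of_nat tendsto_const, of x] by simp
    qed
    then show "AE x in lborel. (\<lambda>n. cis (x \<bullet> \<eta>) * complex_of_real (gauss (?d n *\<^sub>R x)) * u x) \<longlonglongrightarrow>
        cis (x \<bullet> \<eta>) * complex_of_real (gauss (0::'a)) * u x"
      by (intro AE_I2 tendsto_intros)
  qed (auto simp: cis_conv_exp)
  have "complex_of_real (sqrt (2 * pi) ^ DIM('a)) * f \<eta> = (LINT x|lborel. cis (x \<bullet> \<eta>) * complex_of_real (gauss (0::'a)) * u x)"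
    by (rule LIMSEQ_unique[OF lim1 lim2])
  also have "\<dots> = complex_of_real (gauss (0::'a)) * (LINT x|lborel. cis (x \<bullet> \<eta>) * u x)"
  proof -
    have "cis (x \<bullet> \<eta>) * complex_of_real (gauss (0::'a)) * u x = complex_of_real (gauss (0::'a)) * (cis (x \<bullet> \<eta>) * u x)" for x
      by simp
    then show ?thesis by (simp only: integral_mult_right_zero)
  qed
  finally have I: "complex_of_real (sqrt (2 * pi) ^ DIM('a)) * f \<eta> = complex_of_real (gauss (0::'a)) * (LINT x|lborel. cis (x \<bullet> \<eta>) * u x)" .
  have G: "sqrt (2 * pi) ^ DIM('a) * gauss (0::'a) = 1"
    by (simp add: gauss_eq)
  have "(2 * pi) ^ DIM('a) = sqrt (2 * pi) ^ DIM('a) * sqrt (2 * pi) ^ DIM('a)"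
    by (subst power_mult_distrib[symmetric]) simp
  then have "complex_of_real ((2 * pi) ^ DIM('a)) * f \<eta> = complex_of_real (sqrt (2 * pi) ^ DIM('a)) * (complex_of_real (sqrt (2 * pi) ^ DIM('a)) * f \<eta>)"
    by simp
  also have "\<dots> = complex_of_real (sqrt (2 * pi) ^ DIM('a) * gauss (0::'a)) * (LINT x|lborel. cis (x \<bullet> \<eta>) * u x)"
    unfolding I by simp
  finally show ?thesis unfolding G by simp
qed

text \<open>The positive and negative parts of \<open>h\<close> are densities of two measures that
  agree on boxes, hence everywhere, boxes being an intersection-stable generator with an exhausting
  sequence of finite measure. The two densities are then equal almost everywhere, and since at each
  point one of them is zero, both vanish.\<close>

lemma AE_zero_if_box_integrals_zero_real:
  fixes h :: "'a::euclidean_space \<Rightarrow> real"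
  assumes h: "integrable lborel h"
    and zero: "\<And>a b. (LINT x|lborel. indicator (box a b) x * h x) = 0"
  shows "AE x in lborel. h x = 0"
proof -
  have [measurable]: "h \<in> borel_measurable borel" using borel_measurable_integrable[OF h] by simp
  have ip: "integrable lborel (\<lambda>x. max 0 (s * h x))" for s :: real
    using h by (intro integrable_max) auto
  have ib: "integrable lborel (\<lambda>x. indicator (box a b) x * max 0 (s * h x))" for s :: real and a b
    using integrable_mult_indicator[OF _ ip, of "box a b" s] by simp
  have em: "emeasure (density lborel (\<lambda>x. ennreal (max 0 (s * h x)))) (box a b) =
      ennreal (LINT x|lborel. indicator (box a b) x * max 0 (s * h x))" for s a b
    by (subst nn_integral_eq_integral[OF ib, symmetric])
       (auto simp: emeasure_density intro!: nn_integral_cong split: split_indicator)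
  have eq: "(LINT x|lborel. indicator (box a b) x * max 0 (1 * h x)) =
      (LINT x|lborel. indicator (box a b) x * max 0 ((-1) * h x))" for a b
  proof -
    have "(LINT x|lborel. indicator (box a b) x * max 0 (1 * h x)) -
      (LINT x|lborel. indicator (box a b) x * max 0 ((-1) * h x)) =
      (LINT x|lborel. indicator (box a b) x * h x)"
      by (subst Bochner_Integration.integral_diff[OF ib ib, symmetric])
         (auto intro!: Bochner_Integration.integral_cong split: split_indicator)
    then show ?thesis using zero by simp
  qed
  have "density lborel (\<lambda>x. ennreal (max 0 (1 * h x))) = density lborel (\<lambda>x. ennreal (max 0 ((-1) * h x)))"
    (is "?M = ?N")
  proof (rule measure_eqI_generator_eq)
    let ?E = "range (\<lambda>(a, b). box a b::'a set)"
    show "Int_stable ?E"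
      by (auto simp: Int_stable_def box_Int_box)
    show "?E \<subseteq> Pow UNIV" "sets ?M = sigma_sets UNIV ?E" "sets ?N = sigma_sets UNIV ?E"
      by (simp_all add: borel_eq_box)
    let ?A = "\<lambda>n::nat. box (- (real n *\<^sub>R One)) (real n *\<^sub>R One) :: 'a set"
    show "range ?A \<subseteq> ?E" "(\<Union>i. ?A i) = UNIV"
      unfolding UN_box_eq_UNIV by auto
    show "emeasure ?M (?A i) \<noteq> \<infinity>" for i
      unfolding em by simp
    show "emeasure ?M X = emeasure ?N X" if "X \<in> ?E" for X
    proof -
      from that obtain a b where "X = box a b" by auto
      then show ?thesis by (simp only: em eq)
    qed
  qed
  then have "AE x in lborel. ennreal (max 0 (1 * h x)) = ennreal (max 0 ((-1) * h x))"
    by (subst (asm) sigma_finite_measure.density_unique_iff[OF sigma_finite_lborel]) auto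
  then show ?thesis
    by eventually_elim (auto simp: max_def split: if_splits)
qed

lemma AE_zero_if_box_integrals_zero:
  fixes h :: "'a::euclidean_space \<Rightarrow> complex"
  assumes h: "integrable lborel h"
    and zero: "\<And>a b. (LINT x|lborel. indicator (box a b) x * h x) = 0"
  shows "AE x in lborel. h x = 0"
proof -
  have ib: "integrable lborel (\<lambda>x. indicator (box a b) x * h x)" for a b
    using integrable_mult_indicator[OF _ h, of "box a b"] by (simp add: scaleR_conv_of_real of_real_indicator)
  have "(LINT x|lborel. indicator (box a b) x * Re (h x)) = 0" for a b
  proof -
    have "(LINT x|lborel. indicator (box a b) x * Re (h x)) = (LINT x|lborel. Re (indicator (box a b) x * h x))"
      by (intro Bochner_Integration.integral_cong refl) (simp split: split_indicator)
    also have "\<dots> = 0"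
      using integral_Re[OF ib, of a b] zero[of a b] by (simp del: times_complex.sel)
    finally show ?thesis .
  qed
  moreover have "(LINT x|lborel. indicator (box a b) x * Im (h x)) = 0" for a b
  proof -
    have "(LINT x|lborel. indicator (box a b) x * Im (h x)) = (LINT x|lborel. Im (indicator (box a b) x * h x))"
      by (intro Bochner_Integration.integral_cong refl) (simp split: split_indicator)
    also have "\<dots> = 0"
      using integral_Im[OF ib, of a b] zero[of a b] by (simp del: times_complex.sel)
    finally show ?thesis .
  qed
  ultimately have "AE x in lborel. Re (h x) = 0" "AE x in lborel. Im (h x) = 0"
    by (auto intro!: AE_zero_if_box_integrals_zero_real h)
  then show ?thesis
    by eventually_elim (simp add: complex_eq_iff)
qed

text \<open>\<open>g\<close> is only integrable, so its Gaussian averages need not converge at a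
  given point. Integrating over a box first gives \<open>L y\<close>, the integral over the box of
  \<open>g\<close> translated by \<open>y\<close>, which is bounded and continuous at 0; its
  Gaussian averages vanish by Fubini, so \<open>L 0 = 0\<close>.\<close>

lemma fourier_injective:
  fixes g :: "'a::euclidean_space \<Rightarrow> complex"
  assumes g: "integrable lborel g"
    and zero: "\<And>x. (LINT \<xi>|lborel. cis (\<xi> \<bullet> x) * g \<xi>) = 0"
  shows "AE \<xi> in lborel. g \<xi> = 0"
proof (rule AE_zero_if_box_integrals_zero[OF g])
  fix a b :: 'a
  have [measurable]: "g \<in> borel_measurable borel" using borel_measurable_integrable[OF g] by simp
  let ?d = "\<lambda>n. inverse (real (Suc n))"
  let ?I = "\<lambda>x. indicator (box a b) x :: complex"
  have conv0: "(LINT z|lborel. g (\<eta> + ?d n *\<^sub>R z) * complex_of_real (gauss z)) = 0" for n \<eta>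
    using fourier_regularized[OF g, of "?d n" \<eta>] zero by simp
  let ?L = "\<lambda>y. LINT \<eta>|lborel. ?I \<eta> * g (\<eta> + y)"
  have gy: "integrable lborel (\<lambda>\<eta>. g (\<eta> + y))" for y
    using lborel_integrable_affine[OF g, of 1 y] by (simp add: add.commute)
  have gyI: "integrable lborel (\<lambda>\<eta>. ?I \<eta> * g (\<eta> + y))" for y
    by (rule Bochner_Integration.integrable_bound[OF gy[of y]])
       (auto simp: norm_mult split: split_indicator)
  have gyn: "(LINT \<eta>|lborel. norm (g (\<eta> + y))) = (LINT \<eta>|lborel. norm (g \<eta>))" for y
    using lborel_integral_affine[of "\<lambda>\<eta>. norm (g \<eta>)" 1 y] by (simp add: add.commute)
  have gyIn: "(LINT \<eta>|lborel. norm (?I \<eta> * g (\<eta> + y))) \<le> (LINT \<eta>|lborel. norm (g \<eta>))" for y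
    unfolding gyn[of y, symmetric] using gyI[of y] gy[of y]
    by (intro integral_mono integrable_norm) (auto simp: norm_mult split: split_indicator)
  have L_bound: "norm (?L y) \<le> (LINT \<eta>|lborel. norm (g \<eta>))" for y
    by (rule order_trans[OF integral_norm_bound gyIn])
  have L_meas: "?L \<in> borel_measurable borel"
    by measurable
  \<comment> \<open>Moving the translation from \<open>g\<close> to the indicator allows dominated
    convergence for any integrable \<open>g\<close>: the translated indicators converge off the
    frontier of the box, a null set.\<close>
  have L_shift: "?L y = (LINT \<xi>|lborel. ?I (\<xi> - y) * g \<xi>)" for y
    using lborel_integral_affine[of "\<lambda>\<xi>. ?I (\<xi> - y) * g \<xi>" 1 y] by (simp add: add.commute)
  have L_cont: "isCont ?L 0"
    unfolding continuous_at_sequentially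
  proof (intro allI impI)
    fix y :: "nat \<Rightarrow> 'a" assume y: "y \<longlonglongrightarrow> 0"
    have "(\<lambda>n. LINT \<xi>|lborel. ?I (\<xi> - y n) * g \<xi>) \<longlonglongrightarrow> (LINT \<xi>|lborel. ?I \<xi> * g \<xi>)"
    proof (rule integral_dominated_convergence[where w = "\<lambda>\<xi>. norm (g \<xi>)"])
      have "frontier (box a b) \<in> null_sets lborel"
        using negligible_convex_frontier[OF convex_box(2), of a b]
        by (auto simp: negligible_iff_null_sets null_sets_completion_iff)
      then have "AE \<xi> in lborel. \<xi> \<notin> frontier (box a b)"
        by (rule AE_not_in)
      then show "AE \<xi> in lborel. (\<lambda>n. ?I (\<xi> - y n) * g \<xi>) \<longlonglongrightarrow> ?I \<xi> * g \<xi>"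
      proof eventually_elim
        fix \<xi> assume "\<xi> \<notin> frontier (box a b)"
        then have "isCont (indicator (box a b) :: 'a \<Rightarrow> real) \<xi>" by (simp add: isCont_indicator)
        moreover have "(\<lambda>n. \<xi> - y n) \<longlonglongrightarrow> \<xi>"
          using tendsto_diff[OF tendsto_const y, of \<xi>] by simp
        ultimately have "(\<lambda>n. indicator (box a b) (\<xi> - y n) :: real) \<longlonglongrightarrow> indicator (box a b) \<xi>"
          by (rule isCont_tendsto_compose)
        then have "(\<lambda>n. complex_of_real (indicator (box a b) (\<xi> - y n))) \<longlonglongrightarrow> complex_of_real (indicator (box a b) \<xi>)"
          by (rule tendsto_of_real)
        then show "(\<lambda>n. ?I (\<xi> - y n) * g \<xi>) \<longlonglongrightarrow> ?I \<xi> * g \<xi>"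
          by (intro tendsto_intros) (simp add: of_real_indicator)
      qed
    qed (use g in \<open>auto simp: norm_mult split: split_indicator\<close>)
    then show "(?L \<circ> y) \<longlonglongrightarrow> ?L 0"
      by (simp add: o_def L_shift)
  qed
  have "(LINT z|lborel. ?L (0 + ?d n *\<^sub>R z) * complex_of_real (gauss z)) = 0" for n
  proof -
    let ?F = "\<lambda>z \<eta>. ?I \<eta> * g (\<eta> + ?d n *\<^sub>R z) * complex_of_real (gauss z)"
    have meas: "(\<lambda>(z, \<eta>). ?F z \<eta>) \<in> borel_measurable (lborel \<Otimes>\<^sub>M lborel)"
      by measurable
    have int: "integrable (lborel \<Otimes>\<^sub>M lborel) (\<lambda>(z, \<eta>). ?F z \<eta>)"
    proof (rule lborel_pair.Fubini_integrable[OF meas])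
      have "integrable lborel (\<lambda>z::'a. (LINT \<eta>|lborel. norm (?I \<eta> * g (\<eta> + ?d n *\<^sub>R z))) * gauss z)"
      proof (rule Bochner_Integration.integrable_bound)
        show "integrable lborel (\<lambda>z::'a. (LINT \<eta>|lborel. norm (g \<eta>)) * gauss z)"
          by (simp add: integrable_gauss)
        show "AE z in lborel. norm ((LINT \<eta>|lborel. norm (?I \<eta> * g (\<eta> + ?d n *\<^sub>R z))) * gauss z) \<le>
            norm ((LINT \<eta>|lborel. norm (g \<eta>)) * gauss z)"
          using gyIn by (auto simp: abs_mult intro!: mult_right_mono)
      qed measurable
      then show "integrable lborel (\<lambda>z. LINT \<eta>|lborel. norm (case (z, \<eta>) of (z, \<eta>) \<Rightarrow> ?F z \<eta>))"
        by (simp add: norm_mult)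
      show "AE z in lborel. integrable lborel (\<lambda>\<eta>. case (z, \<eta>) of (z, \<eta>) \<Rightarrow> ?F z \<eta>)"
        using gyI by simp
    qed
    have "(LINT z|lborel. ?L (0 + ?d n *\<^sub>R z) * complex_of_real (gauss z)) = (LINT z|lborel. LINT \<eta>|lborel. ?F z \<eta>)"
      by (simp only: integral_mult_left_zero add_0_left)
    also have "\<dots> = (LINT \<eta>|lborel. LINT z|lborel. ?F z \<eta>)"
      using lborel_pair.Fubini_integral[OF int] by simp
    also have "\<dots> = (LINT \<eta>|lborel. ?I \<eta> * (LINT z|lborel. g (\<eta> + ?d n *\<^sub>R z) * complex_of_real (gauss z)))"
      by (simp only: integral_mult_right_zero mult.assoc)
    finally show ?thesis by (simp only: conv0) simp
  qed
  then have "(\<lambda>n::nat. 0) \<longlonglongrightarrow> ?L 0"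
    using tendsto_gauss_regularization[OF L_meas L_bound L_cont] by (simp only:)
  then have "?L 0 = 0"
    using LIMSEQ_unique tendsto_const by blast
  then show "(LINT x|lborel. ?I x * g x) = 0" by simp
qed

subsection \<open>Differentiation under the integral and weights\<close>

lemma has_vector_derivative_iff_quotient:
  fixes f :: "real \<Rightarrow> 'b::real_normed_vector"
  shows "(f has_vector_derivative D) (at t) \<longleftrightarrow> ((\<lambda>s. (f s - f t) /\<^sub>R (s - t)) \<longlongrightarrow> D) (at t)"
proof -
  have eq: "norm ((f s - f t) /\<^sub>R (s - t) - D) = norm (f s - f t - (s - t) *\<^sub>R D) / norm (s - t)" if "s \<noteq> t" for s
  proof -
    have "(f s - f t) /\<^sub>R (s - t) - D = (f s - f t - (s - t) *\<^sub>R D) /\<^sub>R (s - t)"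
      using that by (simp add: scaleR_diff_right)
    then show ?thesis by (simp add: divide_inverse mult.commute abs_inverse)
  qed
  have "(f has_vector_derivative D) (at t) \<longleftrightarrow> ((\<lambda>s. norm (f s - f t - (s - t) *\<^sub>R D) / norm (s - t)) \<longlongrightarrow> 0) (at t)"
    unfolding has_vector_derivative_def has_derivative_iff_norm by (simp add: bounded_linear_scaleR_left)
  also have "\<dots> \<longleftrightarrow> ((\<lambda>s. norm ((f s - f t) /\<^sub>R (s - t) - D)) \<longlongrightarrow> 0) (at t)"
    by (intro filterlim_cong refl) (auto simp: eventually_at_filter eq)
  also have "\<dots> \<longleftrightarrow> ((\<lambda>s. (f s - f t) /\<^sub>R (s - t)) \<longlongrightarrow> D) (at t)"
    by (simp add: tendsto_norm_zero_iff LIM_zero_iff)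
  finally show ?thesis .
qed

lemma norm_increment_le:
  fixes f :: "real \<Rightarrow> 'b::real_normed_vector"
  assumes "\<And>r. r \<in> S \<Longrightarrow> (f has_vector_derivative f' r) (at r)" "\<And>r. r \<in> S \<Longrightarrow> norm (f' r) \<le> B"
    and "convex S" "s \<in> S" "t \<in> S"
  shows "norm (f s - f t) \<le> B * \<bar>s - t\<bar>"
proof -
  have "norm (f s - f t) \<le> B * norm (s - t)"
  proof (rule differentiable_bound[OF \<open>convex S\<close> _ _ \<open>s \<in> S\<close> \<open>t \<in> S\<close>])
    show "(f has_derivative (\<lambda>h. h *\<^sub>R f' r)) (at r within S)" if "r \<in> S" for r
      using assms(1)[OF that] unfolding has_vector_derivative_def by (rule has_derivative_at_withinI)
    show "onorm (\<lambda>h. h *\<^sub>R f' r) \<le> B" if "r \<in> S" for r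
      using assms(2)[OF that] by (intro onorm_le) (simp add: mult.commute[of B] mult_left_mono)
  qed
  then show ?thesis by simp
qed

text \<open>The difference quotients are dominated by \<open>w\<close> through the mean value
  inequality, with an exceptional null set that does not depend on \<open>s\<close>. Measurability
  of \<open>F' t\<close> is inherited from the quotients.\<close>

lemma has_vector_derivative_integral:
  fixes F :: "real \<Rightarrow> 'a \<Rightarrow> 'b::{banach,second_countable_topology}"
  assumes e: "e > 0"
    and int: "\<And>s. \<bar>s - t\<bar> < e \<Longrightarrow> integrable M (F s)"
    and der: "\<And>s x. \<bar>s - t\<bar> < e \<Longrightarrow> ((\<lambda>s. F s x) has_vector_derivative F' s x) (at s)"
    and bound: "AE x in M. \<forall>s. \<bar>s - t\<bar> < e \<longrightarrow> norm (F' s x) \<le> w x"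
    and w: "integrable M w"
  shows "((\<lambda>s. integral\<^sup>L M (F s)) has_vector_derivative integral\<^sup>L M (F' t)) (at t)"
  unfolding has_vector_derivative_iff_quotient tendsto_at_iff_sequentially
proof (intro allI impI)
  fix X :: "nat \<Rightarrow> real" assume X: "\<forall>i. X i \<in> UNIV - {t}" and Xt: "X \<longlonglongrightarrow> t"
  obtain N where N: "\<And>i. i \<ge> N \<Longrightarrow> \<bar>X i - t\<bar> < e"
    using LIMSEQ_D[OF Xt e] by auto
  \<comment> \<open>\<open>X\<close> may leave the interval of radius \<open>e\<close> for small
    indices; its tail stays inside.\<close>
  let ?Y = "\<lambda>i. X (i + N)"
  have Y: "\<bar>?Y i - t\<bar> < e" "?Y i \<noteq> t" for i
    using N[of "i + N"] X by auto
  have Yt: "?Y \<longlonglongrightarrow> t" using Xt by (rule LIMSEQ_ignore_initial_segment)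
  have lim: "(\<lambda>i. (F (?Y i) x - F t x) /\<^sub>R (?Y i - t)) \<longlonglongrightarrow> F' t x" for x
    using der[of t x] e Y(2) Yt
    unfolding has_vector_derivative_iff_quotient tendsto_at_iff_sequentially
    by (auto simp: o_def)
  have m: "(\<lambda>x. (F (?Y i) x - F t x) /\<^sub>R (?Y i - t)) \<in> borel_measurable M" for i
    using int[OF Y(1)[of i]] int[of t] e by simp
  have m': "F' t \<in> borel_measurable M"
    by (rule borel_measurable_LIMSEQ_metric[OF m lim])
  have "(\<lambda>i. LINT x|M. (F (?Y i) x - F t x) /\<^sub>R (?Y i - t)) \<longlonglongrightarrow> integral\<^sup>L M (F' t)"
  proof (rule integral_dominated_convergence[OF m' m w])
    show "AE x in M. (\<lambda>i. (F (?Y i) x - F t x) /\<^sub>R (?Y i - t)) \<longlonglongrightarrow> F' t x"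
      using lim by simp
    show "AE x in M. norm ((F (?Y i) x - F t x) /\<^sub>R (?Y i - t)) \<le> w x" for i
      using bound
    proof eventually_elim
      fix x assume b: "\<forall>s. \<bar>s - t\<bar> < e \<longrightarrow> norm (F' s x) \<le> w x"
      have "norm (F (?Y i) x - F t x) \<le> w x * \<bar>?Y i - t\<bar>"
        by (rule norm_increment_le[where S = "ball t e" and f' = "\<lambda>s. F' s x"])
           (use b der Y(1)[of i] e in \<open>auto simp: dist_real_def abs_minus_commute\<close>)
      then show "norm ((F (?Y i) x - F t x) /\<^sub>R (?Y i - t)) \<le> w x"
        using Y(2)[of i] by (simp add: divide_inverse[symmetric] mult.commute[of "inverse _"] pos_divide_le_eq del: scaleR_diff_right)
    qed
  qed
  moreover have "(LINT x|M. (F (?Y i) x - F t x) /\<^sub>R (?Y i - t)) =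
      (integral\<^sup>L M (F (?Y i)) - integral\<^sup>L M (F t)) /\<^sub>R (?Y i - t)" for i
    using int[OF Y(1)[of i]] int[of t] e by simp
  ultimately have "(\<lambda>i. (integral\<^sup>L M (F (?Y i)) - integral\<^sup>L M (F t)) /\<^sub>R (?Y i - t)) \<longlonglongrightarrow> integral\<^sup>L M (F' t)"
    by (simp only:)
  then show "((\<lambda>s. (integral\<^sup>L M (F s) - integral\<^sup>L M (F t)) /\<^sub>R (s - t)) \<circ> X) \<longlonglongrightarrow> integral\<^sup>L M (F' t)"
    by (subst o_def) (rule LIMSEQ_offset[where k = N])
qed

section \<open>Integrable weights on three-dimensional space\<close>

lemma integrable_weight_real:
  "integrable lborel (\<lambda>s::real. 1 / (\<bar>s\<bar> powr (1/3) * (1 + \<bar>s\<bar>)))"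
proof -
  let ?h = "\<lambda>s::real. 1 / (\<bar>s\<bar> powr (1/3) * (1 + \<bar>s\<bar>))"
  have i1: "set_integrable lborel {0..1} (\<lambda>x::real. x powr (-1/3))"
  proof -
    have "((\<lambda>x::real. x powr (-1/3)) has_integral (1 powr (-1/3 + 1) / (-1/3 + 1))) {0..1}"
      by (rule has_integral_powr_from_0) auto
    then have "(\<lambda>x::real. x powr (-1/3)) absolutely_integrable_on {0..1}"
      by (intro nonnegative_absolutely_integrable_1) (auto simp: integrable_on_def)
    then show ?thesis
      unfolding absolutely_integrable_on_def set_integrable_def
      by (subst (asm) integrable_completion) (auto intro!: borel_measurable_scaleR)
  qed
  have i2: "set_integrable lborel {1..} (\<lambda>x::real. x powr (-4/3))"
  proof -
    have "((\<lambda>x::real. x powr (-4/3)) has_integral (- (1 powr (-4/3 + 1)) / (-4/3 + 1))) {1..}"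
      by (rule has_integral_powr_to_inf) auto
    then have "(\<lambda>x::real. x powr (-4/3)) absolutely_integrable_on {1..}"
      by (intro nonnegative_absolutely_integrable_1) (auto simp: integrable_on_def)
    then show ?thesis
      unfolding absolutely_integrable_on_def set_integrable_def
      by (subst (asm) integrable_completion) (auto intro!: borel_measurable_scaleR)
  qed
  let ?g = "\<lambda>x::real. indicator {0..1} x * x powr (-1/3) + indicator {1..} x * x powr (-4/3)"
  have g: "integrable lborel ?g"
    using i1 i2 unfolding set_integrable_def by simp
  have g': "integrable lborel (\<lambda>x. ?g (- x))"
    using lborel_integrable_affine[OF g, of "-1" 0] by simp
  show ?thesis
  proof (rule Bochner_Integration.integrable_bound[OF Bochner_Integration.integrable_add[OF g g']])
    show "AE s in lborel. norm (?h s) \<le> norm (?g s + ?g (- s))"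
    proof (rule AE_I2)
      fix s :: real
      have pos: "?h s \<le> ?g s" if "s \<ge> 0" for s
      proof (cases "s \<le> 1")
        case True
        have "?h s \<le> s powr (-1/3)"
          using that by (cases "s = 0") (auto simp: powr_minus_divide divide_simps)
        then show ?thesis using True that by (auto split: split_indicator intro: order_trans)
      next
        case False
        have "s powr (4/3) = s powr (1/3) * s"
          using False powr_add[of s "1/3" 1] by simp
        then have "?h s \<le> s powr (-4/3)"
          using False by (simp add: powr_minus_divide divide_simps)
        then show ?thesis using False by auto
      qed
      have nn: "?g s \<ge> 0" for s by simp
      have even: "?h (- s) = ?h s" by simp
      have "?h s \<le> ?g s + ?g (- s)"
      proof (cases "s \<ge> 0")
        case True
        then show ?thesis using pos[of s] nn[of "- s"] by linarith
      next
        case False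
        then show ?thesis using pos[of "- s"] nn[of s] even by linarith
      qed
      then show "norm (?h s) \<le> norm (?g s + ?g (- s))"
        by auto
    qed
  qed measurable
qed

text \<open>Since \<open>\<bar>x \<bullet> b\<bar> \<le> norm x\<close>, a product of
  one-dimensional weights dominates, and polar coordinates are avoided. The exponent
  \<open>1/3\<close> is chosen so that three factors give \<open>norm x\<close>; each factor behaves
  like \<open>\<bar>s\<bar> powr (-1/3)\<close> near 0 and like
  \<open>\<bar>s\<bar> powr (-4/3)\<close> at infinity.\<close>

lemma integrable_weight:
  "integrable lborel (\<lambda>x::real^3. 1 / (norm x * (1 + norm x) ^ 3))"
proof (rule Bochner_Integration.integrable_bound)
  show "integrable lborel (\<lambda>x::real^3. \<Prod>b\<in>Basis. 1 / (\<bar>x \<bullet> b\<bar> powr (1/3) * (1 + \<bar>x \<bullet> b\<bar>)))"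
    by (rule integrable_lborel_prod_Basis) (rule integrable_weight_real)
  \<comment> \<open>On a coordinate hyperplane the majorant takes the value 0, because
    \<open>0 powr (1/3) = 0\<close> and division by 0 yields 0; these planes are null sets.\<close>
  have "AE x in lborel. \<forall>b\<in>Basis. (x::real^3) \<bullet> b \<noteq> 0"
  proof (rule AE_finite_allI)
    fix b :: "real^3" assume "b \<in> Basis"
    then have "{x. x \<bullet> b = 0} \<in> null_sets lborel"
      using negligible_standard_hyperplane[of b 0]
      by (auto simp: negligible_iff_null_sets null_sets_completion_iff)
    then show "AE x in lborel. x \<bullet> b \<noteq> 0"
      by (rule AE_I') auto
  qed simp
  then show "AE x in lborel. norm (1 / (norm x * (1 + norm x) ^ 3)) \<le>
      norm (\<Prod>b\<in>Basis. 1 / (\<bar>(x::real^3) \<bullet> b\<bar> powr (1/3) * (1 + \<bar>x \<bullet> b\<bar>)))"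
  proof eventually_elim
    fix x :: "real^3" assume nz: "\<forall>b\<in>Basis. x \<bullet> b \<noteq> 0"
    then have "x \<noteq> 0" using nonempty_Basis by fastforce
    have pos: "0 < 1 + norm x" by (simp add: add_pos_nonneg)
    have "(\<Prod>b\<in>Basis. \<bar>x \<bullet> b\<bar> powr (1/3) * (1 + \<bar>x \<bullet> b\<bar>)) \<le>
        (\<Prod>b\<in>(Basis::(real^3) set). norm x powr (1/3) * (1 + norm x))"
      by (intro prod_mono conjI mult_mono powr_mono2 add_mono order_refl Basis_le_norm) auto
    also have "\<dots> = norm x * (1 + norm x) ^ 3"
      using \<open>x \<noteq> 0\<close> by (simp add: power_mult_distrib powr_power)
    finally have le: "(\<Prod>b\<in>Basis. \<bar>x \<bullet> b\<bar> powr (1/3) * (1 + \<bar>x \<bullet> b\<bar>)) \<le> norm x * (1 + norm x) ^ 3" .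
    have "0 < (\<Prod>b\<in>Basis. \<bar>x \<bullet> b\<bar> powr (1/3) * (1 + \<bar>x \<bullet> b\<bar>))"
      using nz by (intro prod_pos) (auto intro!: mult_pos_pos)
    then have "1 / (norm x * (1 + norm x) ^ 3) \<le> 1 / (\<Prod>b\<in>Basis. \<bar>x \<bullet> b\<bar> powr (1/3) * (1 + \<bar>x \<bullet> b\<bar>))"
      using le by (intro divide_left_mono mult_pos_pos) (use \<open>x \<noteq> 0\<close> pos in auto)
    then show "norm (1 / (norm x * (1 + norm x) ^ 3)) \<le>
      norm (\<Prod>b\<in>Basis. 1 / (\<bar>x \<bullet> b\<bar> powr (1/3) * (1 + \<bar>x \<bullet> b\<bar>)))"
      by (simp add: prod_dividef prod_nonneg)
  qed
qed measurable

lemma AE_neq: "AE x in lborel. x \<noteq> (c::'a::euclidean_space)"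
  by (rule AE_I'[of "{c}"]) auto

lemma integrable_inverse_power4:
  "integrable lborel (\<lambda>x::real^3. 1 / (1 + norm x) ^ 4)"
proof (rule Bochner_Integration.integrable_bound[OF integrable_weight])
  show "AE x in lborel. norm (1 / (1 + norm x) ^ 4) \<le> norm (1 / (norm (x::real^3) * (1 + norm x) ^ 3))"
    using AE_neq[of "0::real^3"]
  proof eventually_elim
    fix x :: "real^3" assume "x \<noteq> 0"
    have pos: "0 < 1 + norm x" by (simp add: add_pos_nonneg)
    have "norm x * (1 + norm x) ^ 3 \<le> (1 + norm x) ^ 4"
      using pos by (subst power_Suc[of _ 3, simplified]) (auto intro!: mult_right_mono)
    then have "1 / (1 + norm x) ^ 4 \<le> 1 / (norm x * (1 + norm x) ^ 3)"
      using \<open>x \<noteq> 0\<close> pos by (intro divide_left_mono mult_pos_pos zero_less_power) auto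
    then show "norm (1 / (1 + norm x) ^ 4) \<le> norm (1 / (norm x * (1 + norm x) ^ 3))"
      by simp
  qed
qed measurable

subsection \<open>Fourier multipliers\<close>

text \<open>Relational counterpart of \<open>fourier\<close>, which lets an explicit transform be
  carried through sums, derivatives and multipliers. The choice made by \<open>fourier\<close>
  enters only through \<open>has_fourier_fourier\<close>, and uniqueness up to null sets makes it
  harmless.\<close>

definition has_fourier :: "(real^3 \<Rightarrow> complex) \<Rightarrow> (real^3 \<Rightarrow> complex) \<Rightarrow> bool" where
  "has_fourier f g \<longleftrightarrow> integrable lborel g \<and> (\<forall>x. f x = inv_fourier g x)"

lemma inv_fourier_cong_AE:
  assumes "AE \<xi> in lborel. g \<xi> = h \<xi>" "g \<in> borel_measurable borel" "h \<in> borel_measurable borel"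
  shows "inv_fourier g x = inv_fourier h x"
  unfolding inv_fourier_def using assms
  by (intro arg_cong2[where f = "(*)"] refl integral_cong_AE) (auto simp: cis_conv_exp)

lemma has_fourier_unique:
  assumes "has_fourier f g" "has_fourier f h"
  shows "AE \<xi> in lborel. g \<xi> = h \<xi>"
proof -
  have ig: "integrable lborel (\<lambda>\<xi>. cis (\<xi> \<bullet> x) * g \<xi>)" and ih: "integrable lborel (\<lambda>\<xi>. cis (\<xi> \<bullet> x) * h \<xi>)" for x
    using assms by (auto simp: has_fourier_def intro!: integrable_cis_mult)
  have "(LINT \<xi>|lborel. cis (\<xi> \<bullet> x) * g \<xi>) = (LINT \<xi>|lborel. cis (\<xi> \<bullet> x) * h \<xi>)" for x
  proof -
    have "inv_fourier g x = inv_fourier h x"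
      using assms by (simp add: has_fourier_def)
    then show ?thesis by (simp add: inv_fourier_def)
  qed
  then have "(LINT \<xi>|lborel. cis (\<xi> \<bullet> x) * (g \<xi> - h \<xi>)) = 0" for x
    using ig[of x] ih[of x] by (simp add: right_diff_distrib)
  then have "AE \<xi> in lborel. g \<xi> - h \<xi> = 0"
    using assms by (intro fourier_injective) (auto simp: has_fourier_def)
  then show ?thesis by simp
qed

lemma has_fourier_fourier:
  assumes "has_fourier f g"
  shows "has_fourier f (fourier f)"
  using assms unfolding has_fourier_def fourier_def
  by (rule someI[where P = "\<lambda>g. integrable lborel g \<and> (\<forall>x. f x = inv_fourier g x)"])

lemma has_fourier_measurable: "has_fourier f g \<Longrightarrow> g \<in> borel_measurable borel"
  unfolding has_fourier_def by (auto dest: borel_measurable_integrable)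

text \<open>The representative chosen by \<open>fourier\<close> agrees almost everywhere with the
  known \<open>g\<close>, and \<open>inv_fourier\<close> does not see null sets.\<close>

lemma has_fourier_nabla_pow:
  assumes f: "has_fourier (f t) g"
    and i: "integrable lborel (\<lambda>\<xi>. complex_of_real (norm \<xi> powr s) * g \<xi>)"
  shows "has_fourier (nabla_pow s f t) (\<lambda>\<xi>. complex_of_real (norm \<xi> powr s) * g \<xi>)"
proof -
  have "AE \<xi> in lborel. fourier (f t) \<xi> = g \<xi>"
    by (rule has_fourier_unique[OF has_fourier_fourier[OF f] f])
  then have "nabla_pow s f t x = inv_fourier (\<lambda>\<xi>. complex_of_real (norm \<xi> powr s) * g \<xi>) x" for x
    unfolding nabla_pow_def
    using has_fourier_measurable[OF f] has_fourier_measurable[OF has_fourier_fourier[OF f]]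
    by (intro inv_fourier_cong_AE) auto
  then show ?thesis
    using i by (simp add: has_fourier_def)
qed

lemma has_fourier_add:
  assumes "has_fourier f g" "has_fourier f' g'"
  shows "has_fourier (\<lambda>x. f x + f' x) (\<lambda>\<xi>. g \<xi> + g' \<xi>)"
proof -
  have "integrable lborel (\<lambda>\<xi>. cis (\<xi> \<bullet> x) * g \<xi>)" "integrable lborel (\<lambda>\<xi>. cis (\<xi> \<bullet> x) * g' \<xi>)" for x
    using assms by (auto simp: has_fourier_def intro!: integrable_cis_mult)
  then show ?thesis
    using assms by (simp add: has_fourier_def inv_fourier_def distrib_left)
qed

lemma has_fourier_cmult:
  assumes "has_fourier f g"
  shows "has_fourier (\<lambda>x. c * f x) (\<lambda>\<xi>. c * g \<xi>)"
  using assms by (auto simp: has_fourier_def inv_fourier_def mult.left_commute[of _ c])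

lemma has_fourier_diff:
  assumes "has_fourier f g" "has_fourier f' g'"
  shows "has_fourier (\<lambda>x. f x - f' x) (\<lambda>\<xi>. g \<xi> - g' \<xi>)"
  using has_fourier_add[OF assms(1) has_fourier_cmult[OF assms(2), of "-1"]] by simp

text \<open>Differentiation under the integral; the derivative in direction \<open>v\<close> costs a
  factor of size at most \<open>norm \<xi> * norm v\<close>.\<close>

lemma has_fourier_derivative:
  assumes f: "has_fourier f g" and i: "integrable lborel (\<lambda>\<xi>. norm \<xi> * norm (g \<xi>))"
  shows "((\<lambda>h. f (x + h *\<^sub>R v)) has_vector_derivative inv_fourier (\<lambda>\<xi>. \<i> * complex_of_real (\<xi> \<bullet> v) * g \<xi>) x) (at 0)"
    and "integrable lborel (\<lambda>\<xi>. \<i> * complex_of_real (\<xi> \<bullet> v) * g \<xi>)"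
proof -
  note [measurable] = has_fourier_measurable[OF f]
  show "integrable lborel (\<lambda>\<xi>. \<i> * complex_of_real (\<xi> \<bullet> v) * g \<xi>)"
  proof (rule Bochner_Integration.integrable_bound)
    show "integrable lborel (\<lambda>\<xi>. norm v * (norm \<xi> * norm (g \<xi>)))" using i by simp
    show "AE \<xi> in lborel. norm (\<i> * complex_of_real (\<xi> \<bullet> v) * g \<xi>) \<le> norm (norm v * (norm \<xi> * norm (g \<xi>)))"
    proof (rule AE_I2)
      fix \<xi> :: "real^3"
      have "\<bar>\<xi> \<bullet> v\<bar> * norm (g \<xi>) \<le> (norm \<xi> * norm v) * norm (g \<xi>)"
        by (intro mult_right_mono Cauchy_Schwarz_ineq2) simp
      then show "norm (\<i> * complex_of_real (\<xi> \<bullet> v) * g \<xi>) \<le> norm (norm v * (norm \<xi> * norm (g \<xi>)))"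
        by (simp add: norm_mult abs_mult mult_ac)
    qed
  qed measurable
  let ?F = "\<lambda>h \<xi>. cis (\<xi> \<bullet> (x + h *\<^sub>R v)) * g \<xi>"
  let ?F' = "\<lambda>h \<xi>. \<i> * complex_of_real (\<xi> \<bullet> v) * cis (\<xi> \<bullet> (x + h *\<^sub>R v)) * g \<xi>"
  have phase: "\<xi> \<bullet> (x + h *\<^sub>R v) = \<xi> \<bullet> x + h * (\<xi> \<bullet> v)" for \<xi> h
    by (simp add: inner_add_right)
  have "((\<lambda>h. LINT \<xi>|lborel. ?F h \<xi>) has_vector_derivative (LINT \<xi>|lborel. ?F' 0 \<xi>)) (at 0)"
  proof (rule has_vector_derivative_integral[where e = 1 and w = "\<lambda>\<xi>. norm v * (norm \<xi> * norm (g \<xi>))"])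
    show "integrable lborel (?F h)" for h
      using f by (auto simp: has_fourier_def intro!: integrable_cis_mult)
    show "((\<lambda>h. ?F h \<xi>) has_vector_derivative ?F' s \<xi>) (at s)" for s \<xi>
    proof -
      have "((\<lambda>h. cis (\<xi> \<bullet> x + h * (\<xi> \<bullet> v))) has_vector_derivative (\<xi> \<bullet> v) *\<^sub>R (\<i> * cis (\<xi> \<bullet> x + s * (\<xi> \<bullet> v)))) (at s)"
        unfolding cis_conv_exp
        by (auto intro!: derivative_eq_intros has_vector_derivative_real_field simp: scaleR_conv_of_real)
      from has_vector_derivative_mult_left[OF this, of "g \<xi>"] show ?thesis
        unfolding phase by (simp add: scaleR_conv_of_real mult_ac)
    qed
    show "integrable lborel (\<lambda>\<xi>. norm v * (norm \<xi> * norm (g \<xi>)))" using i by simp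
    have "\<bar>\<xi> \<bullet> v\<bar> * norm (g \<xi>) \<le> (norm \<xi> * norm v) * norm (g \<xi>)" for \<xi>
      by (intro mult_right_mono Cauchy_Schwarz_ineq2) simp
    then show "AE \<xi> in lborel. \<forall>s. \<bar>s - 0\<bar> < 1 \<longrightarrow> norm (?F' s \<xi>) \<le> norm v * (norm \<xi> * norm (g \<xi>))"
      by (auto simp: norm_mult mult_ac)
  qed simp
  from has_vector_derivative_mult_right[OF this, of "complex_of_real (1 / (2 * pi) ^ 3)"]
  have "((\<lambda>h. inv_fourier g (x + h *\<^sub>R v)) has_vector_derivative inv_fourier (\<lambda>\<xi>. \<i> * complex_of_real (\<xi> \<bullet> v) * g \<xi>) x) (at 0)"
    by (simp add: inv_fourier_def mult_ac)
  then show "((\<lambda>h. f (x + h *\<^sub>R v)) has_vector_derivative inv_fourier (\<lambda>\<xi>. \<i> * complex_of_real (\<xi> \<bullet> v) * g \<xi>) x) (at 0)"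
    using f by (simp add: has_fourier_def)
qed

abbreviation coord :: "nat \<Rightarrow> real^3 \<Rightarrow> real" where
  "coord j \<xi> \<equiv> \<xi> $ of_nat j"

lemma has_fourier_pd:
  assumes f: "has_fourier (f t) g" and i: "integrable lborel (\<lambda>\<xi>. norm \<xi> * norm (g \<xi>))" and j: "j \<in> {1..3}"
  shows "has_fourier (pd j f t) (\<lambda>\<xi>. \<i> * complex_of_real (coord j \<xi>) * g \<xi>)"
proof -
  have "pd j f t x = inv_fourier (\<lambda>\<xi>. \<i> * complex_of_real (\<xi> \<bullet> axis (of_nat j) 1) * g \<xi>) x" for x
  proof -
    have "line j f t x = (\<lambda>h. f t (x + h *\<^sub>R axis (of_nat j) 1))"
      using j by (auto simp: line_def)
    then show ?thesis
      using vector_derivative_at[OF has_fourier_derivative(1)[OF f i, of x "axis (of_nat j) 1"]]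
      by (simp add: pd_def)
  qed
  moreover have "integrable lborel (\<lambda>\<xi>. \<i> * complex_of_real (\<xi> \<bullet> axis (of_nat j) 1) * g \<xi>)"
    by (rule has_fourier_derivative(2)[OF f i])
  ultimately show ?thesis
    by (simp add: has_fourier_def inner_axis)
qed

subsection \<open>Fourier transforms of regular decaying fields\<close>

lemma has_vector_derivative_shift_iff:
  fixes f :: "real \<Rightarrow> 'b::real_normed_vector"
  shows "((\<lambda>h. f (a + h)) has_vector_derivative D) (at 0) \<longleftrightarrow> (f has_vector_derivative D) (at a)"
proof
  assume "((\<lambda>h. f (a + h)) has_vector_derivative D) (at 0)"
  moreover have "((\<lambda>s. s - a) has_vector_derivative 1) (at a)"
    by (auto intro!: derivative_eq_intros)
  ultimately show "(f has_vector_derivative D) (at a)"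
    using vector_diff_chain_at[of "\<lambda>s. s - a" 1 a "\<lambda>h. f (a + h)" D] by (simp add: o_def)
next
  assume "(f has_vector_derivative D) (at a)"
  moreover have "((\<lambda>s. a + s) has_vector_derivative 1) (at 0)"
    by (auto intro!: derivative_eq_intros)
  ultimately show "((\<lambda>h. f (a + h)) has_vector_derivative D) (at 0)"
    using vector_diff_chain_at[of "\<lambda>s. a + s" 1 0 f D] by (simp add: o_def)
qed

lemma line_0: "line 0 f t x = (\<lambda>h. f (t + h) x)"
  by (simp add: line_def fun_eq_iff)

lemma line_space: "j \<in> {1..3} \<Longrightarrow> line j f t x = (\<lambda>h. f t (x + h *\<^sub>R axis (of_nat j) 1))"
  by (simp add: line_def fun_eq_iff)

lemma Ck_continuous: "Ck n f \<Longrightarrow> continuous_on UNIV (\<lambda>(t, x). f t x)"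
  by (cases n) auto

lemma Ck_SucD: "Ck (Suc n) f \<Longrightarrow> Ck n f"
proof (induction n arbitrary: f)
  case (Suc n)
  then show ?case by (subst Ck.simps) (auto simp del: Ck.simps simp: Ck.simps(2)[of "Suc n"])
qed simp

lemma Ck_mono: "Ck n f \<Longrightarrow> m \<le> n \<Longrightarrow> Ck m f"
  by (induction n) (auto simp: le_Suc_eq dest: Ck_SucD simp del: Ck.simps)

lemma Ck_pd: "Ck (Suc n) f \<Longrightarrow> \<mu> \<in> {0..3} \<Longrightarrow> Ck n (pd \<mu> f)"
  by simp

lemma Ck_line_derivative:
  "Ck (Suc n) f \<Longrightarrow> \<mu> \<in> {0..3} \<Longrightarrow> (line \<mu> f t x has_vector_derivative pd \<mu> f t x) (at 0)"
  by (simp add: pd_def vector_derivative_works)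

lemma Ck_continuous_slice: "Ck n f \<Longrightarrow> continuous_on UNIV (f t)"
  using continuous_on_compose2[OF Ck_continuous[of n f], of UNIV "\<lambda>x. (t, x)"]
  by (simp add: continuous_on_Pair)

lemma Ck_measurable:
  fixes f :: "'v::real_normed_vector field"
  shows "Ck n f \<Longrightarrow> f t \<in> borel_measurable borel"
  by (rule borel_measurable_continuous_onI[OF Ck_continuous_slice])

lemma Ck_time_derivative:
  "Ck (Suc n) f \<Longrightarrow> ((\<lambda>s. f s x) has_vector_derivative pd 0 f t x) (at t)"
  using Ck_line_derivative[of n f 0 t x] has_vector_derivative_shift_iff[of "\<lambda>s. f s x" t]
  by (simp add: line_0)

lemma Ck_space_derivative:
  "Ck (Suc n) f \<Longrightarrow> j \<in> {1..3} \<Longrightarrow>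
    ((\<lambda>h. f t (x + h *\<^sub>R axis (of_nat j) 1)) has_vector_derivative pd j f t x) (at 0)"
  using Ck_line_derivative[of n f j t x] by (simp add: line_space)

lemma decays_bound:
  assumes "decays N n f"
  obtains C where "C \<ge> 0" "\<And>t x. \<bar>t\<bar> \<le> T \<Longrightarrow> norm (f t x) \<le> C / (1 + norm x) ^ N"
proof -
  obtain C where C: "\<And>t x. \<bar>t\<bar> \<le> T \<Longrightarrow> norm (f t x) \<le> C / (1 + norm x) ^ N"
    using assms by (cases n) (auto, blast+)
  have "norm (f t x) \<le> \<bar>C\<bar> / (1 + norm x) ^ N" if "\<bar>t\<bar> \<le> T" for t x
    using C[OF that, of x] by (rule order_trans) (simp add: divide_right_mono)
  then show ?thesis using that[of "\<bar>C\<bar>"] by simp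
qed

lemma decays_SucD: "decays N (Suc n) f \<Longrightarrow> decays N n f"
proof (induction n arbitrary: f)
  case (Suc n)
  then show ?case by (subst decays.simps) (auto simp del: decays.simps simp: decays.simps(2)[of _ "Suc n"])
qed simp

lemma decays_mono: "decays N n f \<Longrightarrow> m \<le> n \<Longrightarrow> decays N m f"
  by (induction n) (auto simp: le_Suc_eq dest: decays_SucD simp del: decays.simps)

lemma integrable_decay:
  fixes h :: "real^3 \<Rightarrow> 'b::{banach,second_countable_topology}"
  assumes "h \<in> borel_measurable borel" "\<And>x. norm (h x) \<le> C / (1 + norm x) ^ 4"
  shows "integrable lborel h"
proof (rule Bochner_Integration.integrable_bound)
  show "integrable lborel (\<lambda>x::real^3. C * (1 / (1 + norm x) ^ 4))"
    by (intro integrable_mult_right integrable_inverse_power4)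
  have "norm (h x) \<le> norm (C * (1 / (1 + norm x) ^ 4))" for x
    by (rule order_trans[OF assms(2)[of x]]) (simp add: divide_right_mono)
  then show "AE x in lborel. norm (h x) \<le> norm (C * (1 / (1 + norm x) ^ 4))"
    by simp
qed (use assms(1) in simp)

text \<open>By translation invariance the integral of \<open>h (x + s v)\<close> is constant in
  \<open>s\<close>, while its derivative at 0 is the integral of \<open>h'\<close>. The factor 16 in
  the majorant is \<open>2 ^ 4\<close>, from
  \<open>1 + norm x \<le> 2 * (1 + norm (x + s v))\<close> for \<open>norm (s v) \<le> 1\<close>.
  This replaces integration by parts, both for the transform of a derivative and for the flux terms
  of the energy estimate.\<close>

lemma integral_directional_derivative_zero:
  fixes h h' :: "real^3 \<Rightarrow> 'b::{banach,second_countable_topology}"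
  assumes der: "\<And>x. ((\<lambda>s. h (x + s *\<^sub>R v)) has_vector_derivative h' x) (at 0)"
    and m: "h \<in> borel_measurable borel"
    and h: "\<And>x. norm (h x) \<le> C / (1 + norm x) ^ 4"
    and h': "\<And>x. norm (h' x) \<le> C' / (1 + norm x) ^ 4"
    and v: "norm v \<le> 1"
  shows "(LINT x|lborel. h' x) = 0"
proof -
  have ih: "integrable lborel h" by (rule integrable_decay[OF m h])
  have "0 \<le> C' / (1 + norm (0::real^3)) ^ 4"
    using h'[of 0] norm_ge_zero order_trans by blast
  then have C': "C' \<ge> 0" by simp
  have "((\<lambda>s. LINT x|lborel. h (x + s *\<^sub>R v)) has_vector_derivative (LINT x|lborel. h' (x + 0 *\<^sub>R v))) (at 0)"
  proof (rule has_vector_derivative_integral[where e = 1 and w = "\<lambda>x. 16 * C' * (1 / (1 + norm x) ^ 4)"])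
    show "integrable lborel (\<lambda>x. h (x + s *\<^sub>R v))" for s
      using lborel_integrable_affine[OF ih, of 1 "s *\<^sub>R v"] by (simp add: add.commute)
    show "((\<lambda>s. h (x + s *\<^sub>R v)) has_vector_derivative h' (x + s *\<^sub>R v)) (at s)" for s x
      using der[of "x + s *\<^sub>R v"] has_vector_derivative_shift_iff[of "\<lambda>s. h (x + s *\<^sub>R v)" s]
      by (simp add: scaleR_left_distrib add.assoc)
    show "integrable lborel (\<lambda>x::real^3. 16 * C' * (1 / (1 + norm x) ^ 4))"
      by (intro integrable_mult_right integrable_inverse_power4)
    show "AE x in lborel. \<forall>s. \<bar>s - 0\<bar> < 1 \<longrightarrow> norm (h' (x + s *\<^sub>R v)) \<le> 16 * C' * (1 / (1 + norm x) ^ 4)"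
    proof (intro AE_I2 allI impI)
      fix x s assume "\<bar>s - 0\<bar> < (1::real)"
      then have "norm (s *\<^sub>R v) \<le> 1"
        using v by (simp add: mult_le_one)
      moreover have "norm x \<le> norm (x + s *\<^sub>R v) + norm (s *\<^sub>R v)"
        using norm_triangle_ineq4[of "x + s *\<^sub>R v" "s *\<^sub>R v"] by simp
      ultimately have "1 + norm x \<le> 2 * (1 + norm (x + s *\<^sub>R v))"
        by (simp add: algebra_simps) (use norm_ge_zero[of "x + s *\<^sub>R v"] in linarith)
      then have "(1 + norm x) ^ 4 \<le> (2 * (1 + norm (x + s *\<^sub>R v))) ^ 4"
        by (intro power_mono) auto
      also have "\<dots> = 16 * (1 + norm (x + s *\<^sub>R v)) ^ 4"
        by (subst power_mult_distrib) simp
      finally have le: "(1 + norm x) ^ 4 / 16 \<le> (1 + norm (x + s *\<^sub>R v)) ^ 4"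
        by linarith
      have pos: "0 < 1 + norm y" for y :: "real^3" by (simp add: add_pos_nonneg)
      have "norm (h' (x + s *\<^sub>R v)) \<le> C' / (1 + norm (x + s *\<^sub>R v)) ^ 4" by (rule h')
      also have "\<dots> \<le> C' / ((1 + norm x) ^ 4 / 16)"
        using le C' pos by (intro divide_left_mono mult_pos_pos zero_less_power divide_pos_pos) auto
      finally show "norm (h' (x + s *\<^sub>R v)) \<le> 16 * C' * (1 / (1 + norm x) ^ 4)"
        by (simp add: mult.commute)
    qed
  qed simp
  moreover have "(LINT x|lborel. h (x + s *\<^sub>R v)) = (LINT x|lborel. h x)" for s
    using lborel_integral_affine[OF m, of 1 "s *\<^sub>R v"] by (simp add: add.commute)
  ultimately have "((\<lambda>s::real. LINT x|lborel. h x) has_vector_derivative (LINT x|lborel. h' x)) (at 0)"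
    by simp
  then show ?thesis
    using vector_derivative_unique_at[OF _ has_vector_derivative_const] by blast
qed

text \<open>The classical integral, with the sign opposite to \<open>inv_fourier\<close> and no
  constant. Unlike the representative chosen by \<open>fourier\<close> it can be estimated at every
  point.\<close>

definition ft :: "(real^3 \<Rightarrow> complex) \<Rightarrow> real^3 \<Rightarrow> complex" where
  "ft f \<xi> = (LINT x|lborel. cis (- (x \<bullet> \<xi>)) * f x)"

text \<open>Decay of order 4 gives integrability in \<open>x\<close>; \<open>n\<close> counts
  derivatives, each of which buys one power of frequency decay in \<open>ft_decay\<close>.\<close>

definition admissible :: "nat \<Rightarrow> 'v::real_normed_vector field \<Rightarrow> bool" where
  "admissible n f \<longleftrightarrow> Ck n f \<and> decays 4 n f"

lemma admissible_mono: "admissible n f \<Longrightarrow> m \<le> n \<Longrightarrow> admissible m f"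
  by (auto simp: admissible_def intro: Ck_mono decays_mono)

lemma admissible_pd: "admissible (Suc n) f \<Longrightarrow> \<mu> \<in> {0..3} \<Longrightarrow> admissible n (pd \<mu> f)"
  by (auto simp: admissible_def)

lemma admissible_integrable:
  fixes f :: "complex field"
  assumes "admissible n f"
  shows "integrable lborel (f t)"
proof -
  obtain C where "\<And>s x. \<bar>s\<bar> \<le> \<bar>t\<bar> \<Longrightarrow> norm (f s x) \<le> C / (1 + norm x) ^ 4"
    using decays_bound[of 4 n f "\<bar>t\<bar>"] assms unfolding admissible_def by metis
  then show ?thesis
    using assms Ck_measurable by (intro integrable_decay[of _ C]) (auto simp: admissible_def)
qed

lemma ft_integrand_integrable:
  assumes "admissible n f"
  shows "integrable lborel (\<lambda>x. cis (- (x \<bullet> \<xi>)) * f t x)"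
  by (rule integrable_cis_mult[OF admissible_integrable[OF assms]]) measurable

lemma ft_measurable [measurable]:
  assumes "f \<in> borel_measurable borel"
  shows "ft f \<in> borel_measurable borel"
  using assms unfolding ft_def cis_conv_exp by measurable

lemma ft_bounded:
  assumes "admissible n f"
  obtains C where "C \<ge> 0" "\<And>t \<xi>. \<bar>t\<bar> \<le> T \<Longrightarrow> norm (ft (f t) \<xi>) \<le> C"
proof -
  obtain C where C: "C \<ge> 0" "\<And>t x. \<bar>t\<bar> \<le> T \<Longrightarrow> norm (f t x) \<le> C / (1 + norm x) ^ 4"
    using decays_bound assms unfolding admissible_def by metis
  let ?K = "LINT x::real^3|lborel. C * (1 / (1 + norm x) ^ 4)"
  have "norm (ft (f t) \<xi>) \<le> ?K" if "\<bar>t\<bar> \<le> T" for t \<xi>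
  proof -
    have "norm (ft (f t) \<xi>) \<le> (LINT x|lborel. norm (cis (- (x \<bullet> \<xi>)) * f t x))"
      unfolding ft_def by (rule integral_norm_bound)
    also have "\<dots> \<le> ?K"
      using C(2)[OF that] ft_integrand_integrable[OF assms]
      by (intro integral_mono integrable_norm integrable_mult_right integrable_inverse_power4)
         (auto simp: norm_mult)
    finally show ?thesis .
  qed
  moreover have "?K \<ge> 0" using C(1) by (intro Bochner_Integration.integral_nonneg) auto
  ultimately show ?thesis using that by blast
qed

lemma ft_pd:
  assumes f: "admissible (Suc n) f" and j: "j \<in> {1..3}"
  shows "ft (pd j f t) \<xi> = \<i> * complex_of_real (coord j \<xi>) * ft (f t) \<xi>"
proof -
  let ?e = "axis (of_nat j) 1 :: real^3"
  have adm: "admissible n (pd j f)" by (rule admissible_pd[OF f]) (use j in auto)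
  obtain C where C: "C \<ge> 0" "\<And>s x. \<bar>s\<bar> \<le> \<bar>t\<bar> \<Longrightarrow> norm (f s x) \<le> C / (1 + norm x) ^ 4"
    using decays_bound[of 4 "Suc n" f "\<bar>t\<bar>"] f unfolding admissible_def by metis
  obtain C' where C': "C' \<ge> 0" "\<And>s x. \<bar>s\<bar> \<le> \<bar>t\<bar> \<Longrightarrow> norm (pd j f s x) \<le> C' / (1 + norm x) ^ 4"
    using decays_bound[of 4 n "pd j f" "\<bar>t\<bar>"] adm unfolding admissible_def by metis
  \<comment> \<open>The integrand is the derivative of
    \<open>cis (- (x \<bullet> \<xi>)) * f t x\<close> in direction \<open>j\<close>, with the
    product rule written out.\<close>
  have "(LINT x|lborel. cis (- (x \<bullet> \<xi>)) * pd j f t x - \<i> * complex_of_real (coord j \<xi>) * (cis (- (x \<bullet> \<xi>)) * f t x)) = 0"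
  proof (rule integral_directional_derivative_zero)
    show "((\<lambda>s. cis (- ((x + s *\<^sub>R ?e) \<bullet> \<xi>)) * f t (x + s *\<^sub>R ?e)) has_vector_derivative
       cis (- (x \<bullet> \<xi>)) * pd j f t x - \<i> * complex_of_real (coord j \<xi>) * (cis (- (x \<bullet> \<xi>)) * f t x)) (at 0)" for x
    proof -
      have phase: "(x + s *\<^sub>R ?e) \<bullet> \<xi> = x \<bullet> \<xi> + s * coord j \<xi>" for s
        by (simp add: inner_add_left inner_axis')
      have "((\<lambda>s. cis (- (x \<bullet> \<xi> + s * coord j \<xi>))) has_vector_derivative
          (- coord j \<xi>) *\<^sub>R (\<i> * cis (- (x \<bullet> \<xi>)))) (at 0)"
        unfolding cis_conv_exp
        by (auto intro!: derivative_eq_intros has_vector_derivative_real_field simp: scaleR_conv_of_real)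
      from has_vector_derivative_mult[OF this Ck_space_derivative[of n f j t x]]
      show ?thesis unfolding phase
        using f j by (simp add: admissible_def scaleR_conv_of_real mult_ac)
    qed
    show "(\<lambda>x. cis (- (x \<bullet> \<xi>)) * f t x) \<in> borel_measurable borel"
      using ft_integrand_integrable[OF f, of \<xi> t] by (auto dest: borel_measurable_integrable)
    show "norm (cis (- (x \<bullet> \<xi>)) * f t x) \<le> C / (1 + norm x) ^ 4" for x
      using C(2)[of t x] by (simp add: norm_mult)
    show "norm (cis (- (x \<bullet> \<xi>)) * pd j f t x - \<i> * complex_of_real (coord j \<xi>) * (cis (- (x \<bullet> \<xi>)) * f t x))
        \<le> (C' + \<bar>coord j \<xi>\<bar> * C) / (1 + norm x) ^ 4" for x
    proof -
      have "norm (cis (- (x \<bullet> \<xi>)) * pd j f t x - \<i> * complex_of_real (coord j \<xi>) * (cis (- (x \<bullet> \<xi>)) * f t x))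
        \<le> norm (pd j f t x) + \<bar>coord j \<xi>\<bar> * norm (f t x)"
        by (rule order_trans[OF norm_triangle_ineq4]) (simp add: norm_mult)
      also have "\<dots> \<le> C' / (1 + norm x) ^ 4 + \<bar>coord j \<xi>\<bar> * (C / (1 + norm x) ^ 4)"
        using C(2)[of t x] C'(2)[of t x] by (intro add_mono mult_left_mono) auto
      finally show ?thesis by (simp add: add_divide_distrib)
    qed
  qed (simp add: norm_axis_1)
  then show ?thesis
    using ft_integrand_integrable[OF f, of \<xi> t] ft_integrand_integrable[OF adm, of \<xi> t]
    by (simp add: ft_def)
qed

text \<open>Each derivative of \<open>f\<close> in direction \<open>j\<close> multiplies the
  transform by \<open>\<i> * coord j \<xi>\<close>, and derivatives of admissible fields still have
  bounded transforms.\<close>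

lemma ft_coord_power_bounded:
  assumes "admissible n f" "j \<in> {1..3}"
  shows "\<exists>C\<ge>0. \<forall>t \<xi>. \<bar>t\<bar> \<le> T \<longrightarrow> \<bar>coord j \<xi>\<bar> ^ n * norm (ft (f t) \<xi>) \<le> C"
  using assms
proof (induction n arbitrary: f)
  case 0
  then obtain C where "C \<ge> 0" "\<And>t \<xi>. \<bar>t\<bar> \<le> T \<Longrightarrow> norm (ft (f t) \<xi>) \<le> C"
    using ft_bounded by metis
  then show ?case by auto
next
  case (Suc n)
  have "admissible n (pd j f)" using Suc.prems by (intro admissible_pd) auto
  from Suc.IH[OF this Suc.prems(2)] show ?case
    by (simp add: ft_pd[OF Suc.prems] norm_mult mult_ac)
qed

lemma norm_vec3_le: "norm (\<xi>::real^3) \<le> \<bar>coord 1 \<xi>\<bar> + \<bar>coord 2 \<xi>\<bar> + \<bar>coord 3 \<xi>\<bar>"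
  using norm_le_l1_cart[of \<xi>] by (simp add: sum_3)

text \<open>With \<open>m\<close> the largest of 1 and the three coordinate sizes,
  \<open>1 + norm \<xi> \<le> 4 * m\<close>, whence the factor \<open>4 ^ n\<close>; and
  \<open>m ^ n\<close> is one of four quantities whose product with the transform is already
  bounded.\<close>

lemma ft_decay:
  assumes f: "admissible n f"
  obtains C where "C \<ge> 0" "\<And>t \<xi>. \<bar>t\<bar> \<le> T \<Longrightarrow> norm (ft (f t) \<xi>) \<le> C / (1 + norm \<xi>) ^ n"
proof -
  obtain C0 where C0: "C0 \<ge> 0" "\<And>t \<xi>. \<bar>t\<bar> \<le> T \<Longrightarrow> norm (ft (f t) \<xi>) \<le> C0"
    using ft_bounded[OF f] by metis
  obtain C1 where C1: "C1 \<ge> 0" "\<And>t \<xi>. \<bar>t\<bar> \<le> T \<Longrightarrow> \<bar>coord 1 \<xi>\<bar> ^ n * norm (ft (f t) \<xi>) \<le> C1"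
    using ft_coord_power_bounded[OF f, of 1 T] by auto
  obtain C2 where C2: "C2 \<ge> 0" "\<And>t \<xi>. \<bar>t\<bar> \<le> T \<Longrightarrow> \<bar>coord 2 \<xi>\<bar> ^ n * norm (ft (f t) \<xi>) \<le> C2"
    using ft_coord_power_bounded[OF f, of 2 T] by auto
  obtain C3 where C3: "C3 \<ge> 0" "\<And>t \<xi>. \<bar>t\<bar> \<le> T \<Longrightarrow> \<bar>coord 3 \<xi>\<bar> ^ n * norm (ft (f t) \<xi>) \<le> C3"
    using ft_coord_power_bounded[OF f, of 3 T] by auto
  have "norm (ft (f t) \<xi>) \<le> (4 ^ n * (C0 + C1 + C2 + C3)) / (1 + norm \<xi>) ^ n" if t: "\<bar>t\<bar> \<le> T" for t \<xi>
  proof -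
    define m where "m = max 1 (max \<bar>coord 1 \<xi>\<bar> (max \<bar>coord 2 \<xi>\<bar> \<bar>coord 3 \<xi>\<bar>))"
    have "1 + norm \<xi> \<le> 4 * m"
      using norm_vec3_le[of \<xi>] by (auto simp: m_def)
    then have "(1 + norm \<xi>) ^ n \<le> (4 * m) ^ n"
      by (intro power_mono) auto
    also have "\<dots> = 4 ^ n * m ^ n"
      by (rule power_mult_distrib)
    finally have "(1 + norm \<xi>) ^ n * norm (ft (f t) \<xi>) \<le> 4 ^ n * m ^ n * norm (ft (f t) \<xi>)"
      by (rule mult_right_mono) simp
    also have "\<dots> = 4 ^ n * (m ^ n * norm (ft (f t) \<xi>))"
      by (rule mult.assoc)
    also have "m ^ n * norm (ft (f t) \<xi>) \<le> C0 + C1 + C2 + C3"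
      using C0(2)[OF t, of \<xi>] C1(2)[OF t, of \<xi>] C2(2)[OF t, of \<xi>] C3(2)[OF t, of \<xi>] C0(1) C1(1) C2(1) C3(1)
      unfolding m_def max_def by (simp split: if_splits)
    finally have "(1 + norm \<xi>) ^ n * norm (ft (f t) \<xi>) \<le> 4 ^ n * (C0 + C1 + C2 + C3)"
      by simp
    moreover have "0 < (1 + norm \<xi>) ^ n" by (simp add: add_pos_nonneg)
    ultimately show ?thesis by (simp add: pos_le_divide_eq mult.commute)
  qed
  then show ?thesis using that[of "4 ^ n * (C0 + C1 + C2 + C3)"] C0(1) C1(1) C2(1) C3(1) by simp
qed

lemma ft_time_derivative:
  assumes f: "admissible (Suc n) f"
  shows "((\<lambda>t. ft (f t) \<xi>) has_vector_derivative ft (pd 0 f t) \<xi>) (at t)"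
proof -
  have adm: "admissible n (pd 0 f)" by (rule admissible_pd[OF f]) simp
  obtain C where C: "C \<ge> 0" "\<And>s x. \<bar>s\<bar> \<le> \<bar>t\<bar> + 1 \<Longrightarrow> norm (pd 0 f s x) \<le> C / (1 + norm x) ^ 4"
    using decays_bound[of 4 n "pd 0 f" "\<bar>t\<bar> + 1"] adm unfolding admissible_def by metis
  show ?thesis unfolding ft_def
  proof (rule has_vector_derivative_integral[where e = 1 and w = "\<lambda>x. C * (1 / (1 + norm x) ^ 4)"])
    show "integrable lborel (\<lambda>x. cis (- (x \<bullet> \<xi>)) * f s x)" for s
      by (rule ft_integrand_integrable[OF f])
    show "((\<lambda>s. cis (- (x \<bullet> \<xi>)) * f s x) has_vector_derivative cis (- (x \<bullet> \<xi>)) * pd 0 f s x) (at s)" for s x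
      using f by (intro has_vector_derivative_mult_right Ck_time_derivative) (auto simp: admissible_def)
    show "AE x in lborel. \<forall>s. \<bar>s - t\<bar> < 1 \<longrightarrow> norm (cis (- (x \<bullet> \<xi>)) * pd 0 f s x) \<le> C * (1 / (1 + norm x) ^ 4)"
      using C(2) by (auto simp: norm_mult intro!: AE_I2)
    show "integrable lborel (\<lambda>x::real^3. C * (1 / (1 + norm x) ^ 4))"
      by (intro integrable_mult_right integrable_inverse_power4)
  qed simp
qed

text \<open>Four derivatives make the transform decay to order 4, hence integrable, as
  \<open>fourier_inversion\<close> demands of \<open>u\<close>.\<close>

lemma has_fourier_ft:
  assumes f: "admissible 4 f"
  shows "has_fourier (f t) (ft (f t))"
proof -
  obtain C where C: "\<And>s \<xi>. \<bar>s\<bar> \<le> \<bar>t\<bar> \<Longrightarrow> norm (ft (f s) \<xi>) \<le> C / (1 + norm \<xi>) ^ 4"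
    using ft_decay[OF f] by metis
  obtain B where B: "B \<ge> 0" "\<And>s x. \<bar>s\<bar> \<le> \<bar>t\<bar> \<Longrightarrow> norm (f s x) \<le> B / (1 + norm x) ^ 4"
    using decays_bound[of 4 4 f "\<bar>t\<bar>"] f unfolding admissible_def by metis
  have fb: "norm (f t x) \<le> B" for x
  proof -
    have "norm (f t x) \<le> B / (1 + norm x) ^ 4" using B(2) by simp
    also have "\<dots> \<le> B / 1"
      using B(1) by (intro divide_left_mono one_le_power mult_pos_pos zero_less_power add_pos_nonneg) auto
    finally show ?thesis by simp
  qed
  have ck: "Ck 4 f" using f by (simp add: admissible_def)
  have i: "integrable lborel (ft (f t))"
  proof (rule integrable_decay)
    show "ft (f t) \<in> borel_measurable borel"
      using Ck_measurable[OF ck] by (rule ft_measurable)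
    show "norm (ft (f t) \<xi>) \<le> C / (1 + norm \<xi>) ^ 4" for \<xi>
      using C by simp
  qed
  have "f t x = inv_fourier (ft (f t)) x" for x
    using fourier_inversion[OF admissible_integrable[OF f] Ck_continuous_slice[OF ck] fb i[unfolded ft_def[abs_def]], of x]
    by (simp add: inv_fourier_def ft_def[abs_def] power3_eq_cube field_simps)
  then show ?thesis using i by (simp add: has_fourier_def)
qed

subsection \<open>The potential of a divergence-free field\<close>

lemma sum_1_3: "(\<Sum>j=1..3. f j) = f 1 + f 2 + f (3::nat)"
  for f :: "nat \<Rightarrow> 'b::comm_monoid_add"
  by (simp add: numeral_3_eq_3 numeral_2_eq_2)

lemmas sum_1_3_simps = sum_1_3 sum_1_3[unfolded One_nat_def]

lemma coord_le_norm: "\<bar>coord j \<xi>\<bar> \<le> norm (\<xi>::real^3)"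
  by (rule component_le_norm_cart)

lemma norm_squared_coord: "(norm (\<xi>::real^3))\<^sup>2 = (\<Sum>j=1..3. (coord j \<xi>)\<^sup>2)"
  by (simp add: norm_vec_def L2_set_def sum_3 sum_1_3_simps real_sqrt_pow2)

text \<open>The symbol of \<open>R\<^sub>j A\<^sub>k - R\<^sub>k A\<^sub>j\<close>, where \<open>H k\<close> is the Fourier transform of \<open>A\<^sub>k\<close>.\<close>

definition curl_symbol :: "(nat \<Rightarrow> real^3 \<Rightarrow> complex) \<Rightarrow> nat \<Rightarrow> nat \<Rightarrow> real^3 \<Rightarrow> complex" where
  "curl_symbol H j k \<xi> = complex_of_real (norm \<xi> powr (-1)) *
     (\<i> * (complex_of_real (coord j \<xi>) * H k \<xi> - complex_of_real (coord k \<xi>) * H j \<xi>))"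

lemma curl_symbol_measurable:
  assumes "H j \<in> borel_measurable borel" "H k \<in> borel_measurable borel"
  shows "curl_symbol H j k \<in> borel_measurable borel"
  using assms unfolding curl_symbol_def by measurable

lemma norm_powr_minus1: "norm (\<xi>::real^3) powr (-1) = 1 / norm \<xi>"
  by (simp add: powr_minus_divide)

text \<open>The prefactor \<open>1 / norm \<xi>\<close> cancels the coordinate factor, so the symbol
  is as small as \<open>H\<close>: Riesz transforms have order 0. At \<open>\<xi> = 0\<close> it is
  0 because \<open>0 powr (-1) = 0\<close>.\<close>

lemma curl_symbol_bound:
  assumes "norm (H j \<xi>) \<le> b" "norm (H k \<xi>) \<le> b"
  shows "norm (curl_symbol H j k \<xi>) \<le> 2 * b"
proof (cases "\<xi> = 0")
  case True
  then show ?thesis using assms order_trans[OF norm_ge_zero assms(1)] by (simp add: curl_symbol_def)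
next
  case False
  have "norm (complex_of_real (coord j \<xi>) * H k \<xi> - complex_of_real (coord k \<xi>) * H j \<xi>)
      \<le> \<bar>coord j \<xi>\<bar> * norm (H k \<xi>) + \<bar>coord k \<xi>\<bar> * norm (H j \<xi>)"
    by (rule order_trans[OF norm_triangle_ineq4]) (simp add: norm_mult)
  also have "\<dots> \<le> norm \<xi> * b + norm \<xi> * b"
    using assms by (intro add_mono mult_mono coord_le_norm) auto
  finally have le: "norm (complex_of_real (coord j \<xi>) * H k \<xi> - complex_of_real (coord k \<xi>) * H j \<xi>) \<le> 2 * b * norm \<xi>"
    by (simp add: mult_ac)
  have "norm (curl_symbol H j k \<xi>) =
      norm (complex_of_real (coord j \<xi>) * H k \<xi> - complex_of_real (coord k \<xi>) * H j \<xi>) / norm \<xi>"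
    by (simp add: curl_symbol_def norm_mult norm_divide norm_powr_minus1)
  then show ?thesis
    using le False by (simp add: pos_divide_le_eq)
qed

section \<open>Null forms of \<open>|nabla|^(-1) b\<close> when \<open>b\<close> has the symbol
  \<open>curl_symbol H\<close>\<close>

context
  fixes b :: "nat \<Rightarrow> nat \<Rightarrow> complex field" and H :: "nat \<Rightarrow> real^3 \<Rightarrow> complex" and C t :: real
  assumes b: "\<And>j k. j \<in> {1..3} \<Longrightarrow> k \<in> {1..3} \<Longrightarrow> has_fourier (b j k t) (curl_symbol H j k)"
    and H_meas: "\<And>k. k \<in> {1..3} \<Longrightarrow> H k \<in> borel_measurable borel"
    and H_bound: "\<And>k \<xi>. k \<in> {1..3} \<Longrightarrow> norm (H k \<xi>) \<le> C / (1 + norm \<xi>) ^ 4"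
    and H_div: "\<And>\<xi>. (\<Sum>j=1..3. complex_of_real (coord j \<xi>) * H j \<xi>) = 0"
begin

lemma curl_symbol_bound': "j \<in> {1..3} \<Longrightarrow> k \<in> {1..3} \<Longrightarrow> norm (curl_symbol H j k \<xi>) \<le> 2 * C / (1 + norm \<xi>) ^ 4"
  using curl_symbol_bound[of H j \<xi> "C / (1 + norm \<xi>) ^ 4" k] H_bound by simp

text \<open>Here the bound on the symbol has the singularity \<open>1 / norm \<xi>\<close> at the
  origin. The weight \<open>1 / (norm \<xi> * (1 + norm \<xi>) ^ 3)\<close> is made for this bound,
  one of the four powers of decay being given up.\<close>

lemma has_fourier_potential:
  assumes jk: "j \<in> {1..3}" "k \<in> {1..3}"
  shows "has_fourier (nabla_pow (-1) (b j k) t) (\<lambda>\<xi>. complex_of_real (norm \<xi> powr (-1)) * curl_symbol H j k \<xi>)"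
proof (rule has_fourier_nabla_pow[where f = "b j k", OF b[OF jk]])
  have C: "C \<ge> 0" using order_trans[OF norm_ge_zero H_bound[OF jk(1), of 0]] by simp
  show "integrable lborel (\<lambda>\<xi>. complex_of_real (norm \<xi> powr - 1) * curl_symbol H j k \<xi>)"
  proof (rule Bochner_Integration.integrable_bound)
    show "integrable lborel (\<lambda>\<xi>::real^3. 2 * C * (1 / (norm \<xi> * (1 + norm \<xi>) ^ 3)))"
      by (intro integrable_mult_right integrable_weight)
    show "(\<lambda>\<xi>. complex_of_real (norm \<xi> powr - 1) * curl_symbol H j k \<xi>) \<in> borel_measurable lborel"
      using curl_symbol_measurable[OF H_meas[OF jk(1)] H_meas[OF jk(2)]] by simp
    show "AE \<xi> in lborel. norm (complex_of_real (norm \<xi> powr - 1) * curl_symbol H j k \<xi>)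
        \<le> norm (2 * C * (1 / (norm \<xi> * (1 + norm \<xi>) ^ 3)))"
    proof (rule AE_I2)
      fix \<xi> :: "real^3"
      have pos: "0 < 1 + norm \<xi>" by (simp add: add_pos_nonneg)
      have "norm (curl_symbol H j k \<xi>) \<le> 2 * C / (1 + norm \<xi>) ^ 4"
        by (rule curl_symbol_bound'[OF jk])
      also have "\<dots> \<le> 2 * C / (1 + norm \<xi>) ^ 3"
        using C pos by (intro divide_left_mono mult_pos_pos zero_less_power power_increasing) auto
      finally have "(1 / norm \<xi>) * norm (curl_symbol H j k \<xi>) \<le> (1 / norm \<xi>) * (2 * C / (1 + norm \<xi>) ^ 3)"
        by (rule mult_left_mono) simp
      then show "norm (complex_of_real (norm \<xi> powr - 1) * curl_symbol H j k \<xi>)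
          \<le> norm (2 * C * (1 / (norm \<xi> * (1 + norm \<xi>) ^ 3)))"
        using C pos by (simp add: norm_mult norm_divide norm_powr_minus1 abs_mult)
    qed
  qed
qed

text \<open>The derivative restores a factor of size \<open>norm \<xi>\<close>, so the singularity
  at the origin is gone and decay of order 4 gives integrability.\<close>

lemma has_fourier_pd_potential:
  assumes jk: "j \<in> {1..3}" "k \<in> {1..3}" and m: "m \<in> {1..3}"
  shows "has_fourier (pd m (nabla_pow (-1) (b j k)) t)
    (\<lambda>\<xi>. \<i> * complex_of_real (coord m \<xi>) * (complex_of_real (norm \<xi> powr (-1)) * curl_symbol H j k \<xi>))"
proof (rule has_fourier_pd[where f = "nabla_pow (-1) (b j k)", OF has_fourier_potential[OF jk] _ m])
  have C: "C \<ge> 0" using order_trans[OF norm_ge_zero H_bound[OF jk(1), of 0]] by simp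
  note [measurable] = curl_symbol_measurable[OF H_meas[OF jk(1)] H_meas[OF jk(2)]]
  show "integrable lborel (\<lambda>\<xi>. norm \<xi> * norm (complex_of_real (norm \<xi> powr - 1) * curl_symbol H j k \<xi>))"
  proof (rule integrable_decay)
    show "norm (norm \<xi> * norm (complex_of_real (norm \<xi> powr - 1) * curl_symbol H j k \<xi>)) \<le> 2 * C / (1 + norm \<xi>) ^ 4" for \<xi>
      using curl_symbol_bound'[OF jk, of \<xi>] C
      by (cases "\<xi> = 0") (auto simp: norm_mult norm_divide norm_powr_minus1 abs_mult)
  qed measurable
qed

lemma pd_potential_antisym:
  assumes "j \<in> {1..3}" "k \<in> {1..3}" "m \<in> {1..3}"
  shows "pd m (nabla_pow (-1) (b k j)) t x = - pd m (nabla_pow (-1) (b j k)) t x"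
proof -
  have anti: "curl_symbol H k j \<xi> = - curl_symbol H j k \<xi>" for \<xi>
    by (simp add: curl_symbol_def algebra_simps)
  show ?thesis
    using has_fourier_pd_potential[OF assms] has_fourier_pd_potential[OF assms(2,1,3)]
    by (simp add: has_fourier_def inv_fourier_def anti)
qed

text \<open>On symbols, summing \<open>\<xi>_j (\<xi>_j H_k - \<xi>_k H_j) / |\<xi>|\<^sup>2\<close>
  over \<open>j\<close> gives \<open>H_k\<close>, because the sum of \<open>\<xi>_j H_j\<close>
  vanishes; the sign comes from \<open>\<i> * \<i>\<close>.\<close>

lemma div_potential:
  assumes k: "k \<in> {1..3}"
  shows "(\<Sum>j=1..3. pd j (nabla_pow (-1) (b j k)) t x) = - inv_fourier (H k) x"
proof -
  define S where "S j \<xi> = \<i> * complex_of_real (coord j \<xi>) * (complex_of_real (norm \<xi> powr (-1)) * curl_symbol H j k \<xi>)" for j \<xi>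
  have S: "has_fourier (pd j (nabla_pow (-1) (b j k)) t) (S j)" if "j \<in> {1..3}" for j
    using has_fourier_pd_potential[OF that k that] by (simp add: S_def[abs_def])
  have "has_fourier (\<lambda>x. pd 1 (nabla_pow (-1) (b 1 k)) t x + pd 2 (nabla_pow (-1) (b 2 k)) t x + pd 3 (nabla_pow (-1) (b 3 k)) t x)
     (\<lambda>\<xi>. S 1 \<xi> + S 2 \<xi> + S 3 \<xi>)"
    by (intro has_fourier_add S) auto
  then have *: "has_fourier (\<lambda>x. \<Sum>j=1..3. pd j (nabla_pow (-1) (b j k)) t x) (\<lambda>\<xi>. \<Sum>j=1..3. S j \<xi>)"
    by (simp only: sum_1_3)
  have "AE \<xi> in lborel. (\<Sum>j=1..3. S j \<xi>) = - H k \<xi>"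
    \<comment> \<open>At the origin the left side is 0 whatever the value of \<open>H k\<close>; the
      formula holds off this null set.\<close>
    using AE_neq[of "0::real^3"]
  proof eventually_elim
    fix \<xi> :: "real^3" assume nz: "\<xi> \<noteq> 0"
    let ?c = "\<lambda>j. complex_of_real (coord j \<xi>)" and ?n = "complex_of_real (norm \<xi>)"
    have "S j \<xi> = - (?c j * ?c j * H k \<xi> - ?c k * (?c j * H j \<xi>)) / ?n\<^sup>2" for j
      using nz by (simp add: S_def curl_symbol_def norm_powr_minus1 power2_eq_square field_simps)
    then have "(\<Sum>j=1..3. S j \<xi>) = - ((\<Sum>j=1..3. ?c j * ?c j) * H k \<xi> - ?c k * (\<Sum>j=1..3. ?c j * H j \<xi>)) / ?n\<^sup>2"
      by (simp only: sum_1_3) (simp add: field_simps add_divide_distrib diff_divide_distrib)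
    also have "(\<Sum>j=1..3. ?c j * ?c j) = ?n\<^sup>2"
      using norm_squared_coord[of \<xi>] by (simp flip: of_real_power of_real_mult of_real_add add: sum_1_3_simps power2_eq_square)
    finally show "(\<Sum>j=1..3. S j \<xi>) = - H k \<xi>"
      using nz H_div by simp
  qed
  then have "inv_fourier (\<lambda>\<xi>. \<Sum>j=1..3. S j \<xi>) x = inv_fourier (\<lambda>\<xi>. - H k \<xi>) x"
    using has_fourier_measurable[OF *] H_meas[OF k] by (intro inv_fourier_cong_AE) auto
  also have "\<dots> = - inv_fourier (H k) x"
    by (simp add: inv_fourier_def)
  finally show ?thesis
    using * by (simp add: has_fourier_def)
qed

text \<open>Antisymmetry of \<open>b\<close> makes the two halves of \<open>Q\<close> contribute
  equally after exchanging \<open>j\<close> and \<open>k\<close>; both contract to the divergence in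
  \<open>div_potential\<close>, whence the factor \<open>- 2\<close>. As \<open>V\<close> is
  arbitrary, this serves for \<open>\<psi>\<close>, \<open>U\<close> and \<open>alpha l *v U\<close>
  alike.\<close>

lemma sum_null_forms_potential:
  "(\<Sum>j=1..3. \<Sum>k=1..3. Q \<epsilon> j k (nabla_pow (-1) (b j k)) V t x) =
     - 2 *s (\<Sum>k=1..3. inv_fourier (H k) x *s pd k V t x)"
proof -
  define P where "P m j k = pd m (nabla_pow (-1) (b j k)) t x" for m j k
  have anti: "P m k j = - P m j k" if "j \<in> {1..3}" "k \<in> {1..3}" "m \<in> {1..3}" for m j k
    unfolding P_def using that by (rule pd_potential_antisym)
  have div: "(\<Sum>j=1..3. P j j k) = - inv_fourier (H k) x" if "k \<in> {1..3}" for k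
    unfolding P_def by (rule div_potential[OF that])
  have "(\<Sum>j=1..3. \<Sum>k=1..3. Q \<epsilon> j k (nabla_pow (-1) (b j k)) V t x) =
      (\<Sum>j=1..3. \<Sum>k=1..3. P j j k *s pd k V t x) + (\<Sum>j=1..3. \<Sum>k=1..3. P k k j *s pd j V t x)"
    unfolding sum.distrib[symmetric]
  proof (intro sum.cong refl)
    fix j k :: nat assume "j \<in> {1..3}" "k \<in> {1..3}"
    then show "Q \<epsilon> j k (nabla_pow (-1) (b j k)) V t x = P j j k *s pd k V t x + P k k j *s pd j V t x"
      using anti[of k j k] by (auto simp: Q_def dd_def P_def[symmetric] vec_eq_iff)
  qed
  also have "(\<Sum>j=1..3. \<Sum>k=1..3. P j j k *s pd k V t x) = (\<Sum>k=1..3. (\<Sum>j=1..3. P j j k) *s pd k V t x)"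
    by (subst sum.swap) (simp add: vec_eq_iff sum_distrib_right)
  also have "(\<Sum>j=1..3. \<Sum>k=1..3. P k k j *s pd j V t x) = (\<Sum>k=1..3. (\<Sum>j=1..3. P j j k) *s pd k V t x)"
    by (simp add: vec_eq_iff sum_distrib_right)
  also have "(\<Sum>k=1..3. (\<Sum>j=1..3. P j j k) *s pd k V t x) = (\<Sum>k=1..3. (- inv_fourier (H k) x) *s pd k V t x)"
    by (intro sum.cong refl) (simp only: div)
  finally show ?thesis
    by (simp add: vec_eq_iff sum_negf)
qed

end

text \<open>\<open>Riesz\<close> and \<open>nabla_pow\<close> act on complex fields, so derivatives,
  regularity and decay of the real potential have to be transferred.\<close>

lemma cfield_pd:
  assumes "Ck (Suc n) f" "\<mu> \<in> {0..3}"
  shows "pd \<mu> (cfield f) = cfield (pd \<mu> f)"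
    and "(line \<mu> (cfield f) t x has_vector_derivative cfield (pd \<mu> f) t x) (at 0)"
proof -
  have line: "line \<mu> (cfield f) t x = (\<lambda>h. complex_of_real (line \<mu> f t x h))" for t x
    by (auto simp: line_def cfield_def)
  have d: "(line \<mu> (cfield f) t x has_vector_derivative cfield (pd \<mu> f) t x) (at 0)" for t x
    unfolding line cfield_def
    by (rule has_vector_derivative_of_real[OF Ck_line_derivative[OF assms, folded has_real_derivative_iff_has_vector_derivative]])
  show "(line \<mu> (cfield f) t x has_vector_derivative cfield (pd \<mu> f) t x) (at 0)" by (rule d)
  show "pd \<mu> (cfield f) = cfield (pd \<mu> f)"
    by (intro ext) (simp add: pd_def[of _ "cfield f"] vector_derivative_at[OF d])
qed

lemma Ck_cfield: "Ck n f \<Longrightarrow> Ck n (cfield f)"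
proof (induction n arbitrary: f)
  case 0
  then show ?case by (auto simp: cfield_def case_prod_unfold intro: continuous_on_of_real)
next
  case (Suc n)
  have "continuous_on UNIV (\<lambda>(t, x). cfield f t x)"
    using Ck_continuous[OF Suc.prems] by (auto simp: cfield_def case_prod_unfold intro: continuous_on_of_real)
  moreover have "line \<mu> (cfield f) t x differentiable at 0" if "\<mu> \<in> {0..3}" for \<mu> t x
    using cfield_pd(2)[OF Suc.prems that] by (rule differentiableI_vector)
  moreover have "Ck n (pd \<mu> (cfield f))" if "\<mu> \<in> {0..3}" for \<mu>
    using Suc.IH[of "pd \<mu> f"] Suc.prems that by (simp add: cfield_pd(1)[OF Suc.prems that])
  ultimately show ?case by simp
qed

lemma decays_cfield: "Ck n f \<Longrightarrow> decays N n f \<Longrightarrow> decays N n (cfield f)"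
proof (induction n arbitrary: f)
  case 0
  then show ?case by (simp add: cfield_def)
next
  case (Suc n)
  have "decays N n (pd \<mu> (cfield f))" if "\<mu> \<in> {0..3}" for \<mu>
    using Suc.IH[of "pd \<mu> f"] Suc.prems that by (simp add: cfield_pd(1)[OF Suc.prems(1) that])
  moreover have "\<forall>T. \<exists>C. \<forall>t x. \<bar>t\<bar> \<le> T \<longrightarrow> norm (cfield f t x) \<le> C / (1 + norm x) ^ N"
    using Suc.prems(2) by (simp add: cfield_def)
  ultimately show ?case by simp
qed

section \<open>Null forms of the potential \<open>a\<close> and of its derivatives\<close>

context
  fixes A :: "nat \<Rightarrow> real field"
  assumes A: "\<And>j. j \<in> {1..3} \<Longrightarrow> Ck 6 (A j) \<and> decays 4 6 (A j)"
    and div_free: "coulomb A"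
begin

lemma A_Ck: "j \<in> {1..3} \<Longrightarrow> Ck (Suc 5) (A j)"
  using A[of j] by (simp add: numeral_eq_Suc)

lemma A_admissible: "j \<in> {1..3} \<Longrightarrow> admissible (Suc 5) (cfield (A j))"
  using A[of j] by (simp add: admissible_def Ck_cfield decays_cfield del: Ck.simps decays.simps)

lemma pd_A_admissible: "j \<in> {1..3} \<Longrightarrow> \<mu> \<in> {0..3} \<Longrightarrow> admissible 5 (pd \<mu> (cfield (A j)))"
  by (rule admissible_pd[OF A_admissible])

lemma ft_A_measurable: "j \<in> {1..3} \<Longrightarrow> ft (cfield (A j) t) \<in> borel_measurable borel"
  using A_admissible[of j] by (intro ft_measurable Ck_measurable[of "Suc 5"]) (auto simp: admissible_def simp del: Ck.simps)

lemma ft_pd_A_measurable: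
  "j \<in> {1..3} \<Longrightarrow> \<mu> \<in> {0..3} \<Longrightarrow> ft (pd \<mu> (cfield (A j)) t) \<in> borel_measurable borel"
  using pd_A_admissible[of j \<mu>] by (intro ft_measurable Ck_measurable[of 5]) (auto simp: admissible_def simp del: Ck.simps)

lemma uniform_bound:
  assumes "\<And>j. j \<in> {1..3} \<Longrightarrow> \<exists>C\<ge>0. \<forall>t \<xi>. \<bar>t\<bar> \<le> T \<longrightarrow> norm (g j t \<xi>) \<le> C / (1 + norm \<xi>) ^ n"
  obtains C where "C \<ge> 0"
    "\<And>j t \<xi>. j \<in> {1..3::nat} \<Longrightarrow> \<bar>t\<bar> \<le> T \<Longrightarrow> norm (g j t \<xi>) \<le> C / (1 + norm \<xi>) ^ n"
proof -
  obtain c where c: "\<And>j. j \<in> {1..3} \<Longrightarrow> c j \<ge> 0 \<and> (\<forall>t \<xi>. \<bar>t\<bar> \<le> T \<longrightarrow> norm (g j t \<xi>) \<le> c j / (1 + norm \<xi>) ^ n)"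
    using assms by metis
  have "norm (g j t \<xi>) \<le> (\<Sum>i=1..3. c i) / (1 + norm \<xi>) ^ n" if "j \<in> {1..3}" "\<bar>t\<bar> \<le> T" for j t \<xi>
  proof -
    have "c j \<le> (\<Sum>i=1..3. c i)"
      using c that by (intro member_le_sum) auto
    then have "c j / (1 + norm \<xi>) ^ n \<le> (\<Sum>i=1..3. c i) / (1 + norm \<xi>) ^ n"
      by (intro divide_right_mono) auto
    then show ?thesis using c[OF that(1)] that(2) by (meson order_trans)
  qed
  moreover have "(\<Sum>i=1..3. c i) \<ge> 0" using c by (intro sum_nonneg) auto
  ultimately show ?thesis using that by blast
qed

text \<open>Order 5, one above what integrability takes, leaves room for the spatial derivative of
  \<open>a\<close> in \<open>pd_apot_null_forms\<close>.\<close>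

lemma ft_A_bound:
  obtains C where "C \<ge> 0"
    "\<And>j t \<xi>. j \<in> {1..3} \<Longrightarrow> \<bar>t\<bar> \<le> T \<Longrightarrow> norm (ft (cfield (A j) t) \<xi>) \<le> C / (1 + norm \<xi>) ^ 5"
proof (rule uniform_bound)
  fix j :: nat assume j: "j \<in> {1..3}"
  have "admissible 5 (cfield (A j))" using admissible_mono[OF A_admissible[OF j]] by simp
  from ft_decay[OF this, of T]
  show "\<exists>C\<ge>0. \<forall>t \<xi>. \<bar>t\<bar> \<le> T \<longrightarrow> norm (ft (cfield (A j) t) \<xi>) \<le> C / (1 + norm \<xi>) ^ 5"
    by metis
qed (use that in blast)

lemma ft_pd_A_bound:
  assumes "\<mu> \<in> {0..3}"
  obtains C where "C \<ge> 0"
    "\<And>j t \<xi>. j \<in> {1..3} \<Longrightarrow> \<bar>t\<bar> \<le> T \<Longrightarrow> norm (ft (pd \<mu> (cfield (A j)) t) \<xi>) \<le> C / (1 + norm \<xi>) ^ 4"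
proof (rule uniform_bound)
  fix j :: nat assume j: "j \<in> {1..3}"
  have "admissible 4 (pd \<mu> (cfield (A j)))" using admissible_mono[OF pd_A_admissible[OF j assms]] by simp
  from ft_decay[OF this, of T]
  show "\<exists>C\<ge>0. \<forall>t \<xi>. \<bar>t\<bar> \<le> T \<longrightarrow> norm (ft (pd \<mu> (cfield (A j)) t) \<xi>) \<le> C / (1 + norm \<xi>) ^ 4"
    by metis
qed (use that in blast)

lemma power5_le_power4:
  assumes "C \<ge> 0" shows "C / (1 + norm (\<xi>::real^3)) ^ 5 \<le> C / (1 + norm \<xi>) ^ 4"
  using assms by (intro divide_left_mono mult_pos_pos zero_less_power add_pos_nonneg power_increasing) auto

lemma ft_A_div_free: "(\<Sum>j=1..3. complex_of_real (coord j \<xi>) * ft (cfield (A j) t) \<xi>) = 0"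
proof -
  have i: "integrable lborel (\<lambda>x. cis (- (x \<bullet> \<xi>)) * pd j (cfield (A j)) t x)" if "j \<in> {1..3}" for j
    using that by (intro ft_integrand_integrable[OF pd_A_admissible]) auto
  have "(\<Sum>j=1..3. pd j (cfield (A j)) t x) = 0" for x
  proof -
    have "(\<Sum>j=1..3. pd j (cfield (A j)) t x) = (\<Sum>j=1..3. complex_of_real (pd j (A j) t x))"
      using cfield_pd(1)[OF A_Ck] by (intro sum.cong refl) (auto simp: cfield_def)
    also have "\<dots> = complex_of_real (\<Sum>j=1..3. pd j (A j) t x)" by simp
    also have "\<dots> = 0" using div_free by (simp add: coulomb_def)
    finally show ?thesis .
  qed
  then have "0 = (LINT x|lborel. cis (- (x \<bullet> \<xi>)) * (\<Sum>j=1..3. pd j (cfield (A j)) t x))"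
    by simp
  also have "\<dots> = (\<Sum>j=1..3. ft (pd j (cfield (A j)) t) \<xi>)"
    unfolding sum_distrib_left ft_def using i by (subst Bochner_Integration.integral_sum) auto
  also have "\<dots> = \<i> * (\<Sum>j=1..3. complex_of_real (coord j \<xi>) * ft (cfield (A j) t) \<xi>)"
    unfolding sum_distrib_left
    by (intro sum.cong refl) (simp add: ft_pd[OF A_admissible])
  finally show ?thesis by simp
qed

text \<open>The identity for the transform of \<open>A\<close> holds at all times and is
  differentiated in \<open>t\<close>, so that \<open>pd 0\<close> and \<open>pd j\<close> never have
  to be interchanged.\<close>

lemma ft_pd0_A_div_free: "(\<Sum>j=1..3. complex_of_real (coord j \<xi>) * ft (pd 0 (cfield (A j)) t) \<xi>) = 0"
proof -
  have "((\<lambda>t. \<Sum>j=1..3. complex_of_real (coord j \<xi>) * ft (cfield (A j) t) \<xi>) has_vector_derivative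
     (\<Sum>j=1..3. complex_of_real (coord j \<xi>) * ft (pd 0 (cfield (A j)) t) \<xi>)) (at t)"
    by (intro has_vector_derivative_sum has_vector_derivative_mult_right ft_time_derivative[OF A_admissible]) auto
  then have "((\<lambda>t. 0) has_vector_derivative
     (\<Sum>j=1..3. complex_of_real (coord j \<xi>) * ft (pd 0 (cfield (A j)) t) \<xi>)) (at t)"
    by (simp only: ft_A_div_free)
  then show ?thesis
    using vector_derivative_unique_at[OF _ has_vector_derivative_const] by blast
qed

lemma has_fourier_Riesz:
  assumes j: "j \<in> {1..3}" and k: "k \<in> {1..3}"
  shows "has_fourier (Riesz j (cfield (A k)) t)
    (\<lambda>\<xi>. complex_of_real (norm \<xi> powr (-1)) * (\<i> * complex_of_real (coord j \<xi>) * ft (cfield (A k) t) \<xi>))"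
proof -
  have "has_fourier (pd j (cfield (A k)) t) (ft (pd j (cfield (A k)) t))"
    using admissible_mono[OF pd_A_admissible[OF k]] j by (intro has_fourier_ft) auto
  then have 1: "has_fourier (pd j (cfield (A k)) t) (\<lambda>\<xi>. \<i> * complex_of_real (coord j \<xi>) * ft (cfield (A k) t) \<xi>)"
    by (simp add: ft_pd[OF A_admissible[OF k] j, abs_def])
  obtain C where C: "C \<ge> 0" "\<And>j s \<xi>. j \<in> {1..3} \<Longrightarrow> \<bar>s\<bar> \<le> \<bar>t\<bar> \<Longrightarrow> norm (ft (cfield (A j) s) \<xi>) \<le> C / (1 + norm \<xi>) ^ 5"
    using ft_A_bound by metis
  note [measurable] = ft_A_measurable[OF k]
  show ?thesis unfolding Riesz_def
  proof (rule has_fourier_nabla_pow[where f = "pd j (cfield (A k))", OF 1], rule integrable_decay)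
    show "norm (complex_of_real (norm \<xi> powr - 1) * (\<i> * complex_of_real (coord j \<xi>) * ft (cfield (A k) t) \<xi>)) \<le> C / (1 + norm \<xi>) ^ 4" for \<xi>
    proof -
      have "\<bar>coord j \<xi>\<bar> / norm \<xi> \<le> 1"
        using coord_le_norm[of \<xi> j] by (cases "\<xi> = 0") auto
      then have "norm (complex_of_real (norm \<xi> powr - 1) * (\<i> * complex_of_real (coord j \<xi>) * ft (cfield (A k) t) \<xi>))
          \<le> 1 * norm (ft (cfield (A k) t) \<xi>)"
        unfolding norm_mult mult.assoc[symmetric] by (intro mult_right_mono) (auto simp: norm_powr_minus1 norm_divide)
      also have "\<dots> \<le> C / (1 + norm \<xi>) ^ 5" using C(2)[OF k, of t] by simp
      also have "\<dots> \<le> C / (1 + norm \<xi>) ^ 4" by (rule power5_le_power4[OF C(1)])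
      finally show ?thesis .
    qed
  qed measurable
qed

lemma has_fourier_apot:
  assumes "j \<in> {1..3}" "k \<in> {1..3}"
  shows "has_fourier (apot A j k t) (curl_symbol (\<lambda>k. ft (cfield (A k) t)) j k)"
  using has_fourier_diff[OF has_fourier_Riesz[OF assms] has_fourier_Riesz[OF assms(2,1)], of t t]
  by (simp add: apot_def[abs_def] curl_symbol_def[abs_def] algebra_simps)

text \<open>The general formula with \<open>H k\<close> the transform of \<open>A k\<close>;
  inversion turns \<open>inv_fourier (H k)\<close> back into \<open>A k\<close>.\<close>

lemma apot_null_forms:
  "(\<Sum>j=1..3. \<Sum>k=1..3. Q \<epsilon> j k (nabla_pow (-1) (apot A j k)) V t x) =
     - 2 *s (\<Sum>k=1..3. cfield (A k) t x *s pd k V t x)"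
proof -
  obtain C where C: "C \<ge> 0" "\<And>j s \<xi>. j \<in> {1..3} \<Longrightarrow> \<bar>s\<bar> \<le> \<bar>t\<bar> \<Longrightarrow> norm (ft (cfield (A j) s) \<xi>) \<le> C / (1 + norm \<xi>) ^ 5"
    using ft_A_bound by metis
  have "(\<Sum>j=1..3. \<Sum>k=1..3. Q \<epsilon> j k (nabla_pow (-1) (apot A j k)) V t x) =
     - 2 *s (\<Sum>k=1..3. inv_fourier (ft (cfield (A k) t)) x *s pd k V t x)"
  proof (rule sum_null_forms_potential)
    show "norm (ft (cfield (A k) t) \<xi>) \<le> C / (1 + norm \<xi>) ^ 4" if "k \<in> {1..3}" for k \<xi>
      using order_trans[OF C(2)[OF that, of t] power5_le_power4[OF C(1)]] by simp
  qed (use has_fourier_apot ft_A_measurable ft_A_div_free in auto)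
  also have "(\<Sum>k=1..3. inv_fourier (ft (cfield (A k) t)) x *s pd k V t x) = (\<Sum>k=1..3. cfield (A k) t x *s pd k V t x)"
  proof (intro sum.cong refl)
    fix k :: nat assume "k \<in> {1..3}"
    then have "has_fourier (cfield (A k) t) (ft (cfield (A k) t))"
      using admissible_mono[OF A_admissible] by (intro has_fourier_ft) auto
    then show "inv_fourier (ft (cfield (A k) t)) x *s pd k V t x = cfield (A k) t x *s pd k V t x"
      by (simp add: has_fourier_def)
  qed
  finally show ?thesis .
qed

text \<open>The derivative multiplies the symbol of \<open>a\<close> by
  \<open>\<i> * coord l \<xi>\<close>, a factor that can be absorbed into \<open>H\<close>: the
  result is again a curl symbol, that of \<open>pd l A\<close>, and still divergence free.\<close>

lemma pd_apot_null_forms: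
  assumes l: "l \<in> {1..3}"
  shows "(\<Sum>j=1..3. \<Sum>k=1..3. Q \<epsilon> j k (nabla_pow (-1) (pd l (apot A j k))) V t x) =
     - 2 *s (\<Sum>k=1..3. cfield (pd l (A k)) t x *s pd k V t x)"
proof -
  obtain C where C: "C \<ge> 0" "\<And>j s \<xi>. j \<in> {1..3} \<Longrightarrow> \<bar>s\<bar> \<le> \<bar>t\<bar> \<Longrightarrow> norm (ft (cfield (A j) s) \<xi>) \<le> C / (1 + norm \<xi>) ^ 5"
    using ft_A_bound by metis
  obtain C' where C': "C' \<ge> 0" "\<And>j s \<xi>. j \<in> {1..3} \<Longrightarrow> \<bar>s\<bar> \<le> \<bar>t\<bar> \<Longrightarrow> norm (ft (pd l (cfield (A j)) s) \<xi>) \<le> C' / (1 + norm \<xi>) ^ 4"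
    using ft_pd_A_bound[of l "\<bar>t\<bar>"] l by auto
  have ft_l: "ft (pd l (cfield (A k)) t) \<xi> = \<i> * complex_of_real (coord l \<xi>) * ft (cfield (A k) t) \<xi>" if "k \<in> {1..3}" for k \<xi>
    by (rule ft_pd[OF A_admissible[OF that] l])
  have "(\<Sum>j=1..3. \<Sum>k=1..3. Q \<epsilon> j k (nabla_pow (-1) (pd l (apot A j k))) V t x) =
     - 2 *s (\<Sum>k=1..3. inv_fourier (ft (pd l (cfield (A k)) t)) x *s pd k V t x)"
  proof (rule sum_null_forms_potential)
    show "norm (ft (pd l (cfield (A k)) t) \<xi>) \<le> C' / (1 + norm \<xi>) ^ 4" if "k \<in> {1..3}" for k \<xi>
      using C'(2)[OF that, of t] by simp
    show "has_fourier (pd l (apot A j k) t) (curl_symbol (\<lambda>k. ft (pd l (cfield (A k)) t)) j k)"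
      if jk: "j \<in> {1..3}" "k \<in> {1..3}" for j k
    proof -
      note m [measurable] = curl_symbol_measurable[of "\<lambda>k. ft (cfield (A k) t)", OF ft_A_measurable[OF jk(1)] ft_A_measurable[OF jk(2)]]
      have "integrable lborel (\<lambda>\<xi>. norm \<xi> * norm (curl_symbol (\<lambda>k. ft (cfield (A k) t)) j k \<xi>))"
      proof (rule integrable_decay)
        fix \<xi> :: "real^3"
        have pos: "0 < 1 + norm \<xi>" by (simp add: add_pos_nonneg)
        have "norm (curl_symbol (\<lambda>k. ft (cfield (A k) t)) j k \<xi>) \<le> 2 * (C / (1 + norm \<xi>) ^ 5)"
          using C(2)[OF jk(1), of t \<xi>] C(2)[OF jk(2), of t \<xi>] by (intro curl_symbol_bound) auto
        then have "norm \<xi> * norm (curl_symbol (\<lambda>k. ft (cfield (A k) t)) j k \<xi>)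
            \<le> (1 + norm \<xi>) * (2 * (C / (1 + norm \<xi>) ^ 5))"
          by (intro mult_mono) auto
        also have "\<dots> = 2 * C / (1 + norm \<xi>) ^ 4"
          using pos by (simp add: power_Suc[of _ 4, simplified])
        finally show "norm (norm \<xi> * norm (curl_symbol (\<lambda>k. ft (cfield (A k) t)) j k \<xi>)) \<le> 2 * C / (1 + norm \<xi>) ^ 4"
          by simp
      qed measurable
      from has_fourier_pd[where f = "apot A j k", OF has_fourier_apot[OF jk] this l] show ?thesis
        by (simp add: curl_symbol_def[abs_def] ft_l[OF jk(1)] ft_l[OF jk(2)] algebra_simps)
    qed
    show "(\<Sum>j=1..3. complex_of_real (coord j \<xi>) * ft (pd l (cfield (A j)) t) \<xi>) = 0" for \<xi>
    proof -
      have "(\<Sum>j=1..3. complex_of_real (coord j \<xi>) * ft (pd l (cfield (A j)) t) \<xi>) =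
        \<i> * complex_of_real (coord l \<xi>) * (\<Sum>j=1..3. complex_of_real (coord j \<xi>) * ft (cfield (A j) t) \<xi>)"
        unfolding sum_distrib_left by (intro sum.cong refl) (simp add: ft_l)
      then show ?thesis unfolding ft_A_div_free by simp
    qed
  qed (use ft_pd_A_measurable l in auto)
  also have "(\<Sum>k=1..3. inv_fourier (ft (pd l (cfield (A k)) t)) x *s pd k V t x) = (\<Sum>k=1..3. cfield (pd l (A k)) t x *s pd k V t x)"
  proof (intro sum.cong refl)
    fix k :: nat assume k: "k \<in> {1..3}"
    then have "has_fourier (pd l (cfield (A k)) t) (ft (pd l (cfield (A k)) t))"
      using admissible_mono[OF pd_A_admissible] l by (intro has_fourier_ft) auto
    then show "inv_fourier (ft (pd l (cfield (A k)) t)) x *s pd k V t x = cfield (pd l (A k)) t x *s pd k V t x"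
      using cfield_pd(1)[OF A_Ck[OF k], of l] l by (simp add: has_fourier_def)
  qed
  finally show ?thesis .
qed

text \<open>\<open>apot\<close> is nonlocal in \<open>x\<close>, so its time derivative is found on
  the frequency side: the symbol is differentiated in time under the inverse Fourier integral, with
  a bound uniform over times within 1 of \<open>t\<close>.\<close>

lemma has_fourier_pd0_apot:
  assumes jk: "j \<in> {1..3}" "k \<in> {1..3}"
  shows "has_fourier (pd 0 (apot A j k) t) (curl_symbol (\<lambda>k. ft (pd 0 (cfield (A k)) t)) j k)"
proof -
  obtain C where C: "C \<ge> 0" "\<And>j s \<xi>. j \<in> {1..3} \<Longrightarrow> \<bar>s\<bar> \<le> \<bar>t\<bar> + 1 \<Longrightarrow> norm (ft (pd 0 (cfield (A j)) s) \<xi>) \<le> C / (1 + norm \<xi>) ^ 4"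
    using ft_pd_A_bound[of 0 "\<bar>t\<bar> + 1"] by auto
  let ?S = "\<lambda>s. curl_symbol (\<lambda>k. ft (cfield (A k) s)) j k"
  let ?S' = "\<lambda>s. curl_symbol (\<lambda>k. ft (pd 0 (cfield (A k)) s)) j k"
  have S'_meas: "?S' s \<in> borel_measurable borel" for s
    using jk by (intro curl_symbol_measurable ft_pd_A_measurable) auto
  have S'_bound: "norm (?S' s \<xi>) \<le> 2 * C / (1 + norm \<xi>) ^ 4" if "\<bar>s\<bar> \<le> \<bar>t\<bar> + 1" for s \<xi>
    using curl_symbol_bound[where H = "\<lambda>k. ft (pd 0 (cfield (A k)) s)", OF C(2)[OF jk(1) that] C(2)[OF jk(2) that]] by simp
  have S'_int: "integrable lborel (?S' t)"
    by (rule integrable_decay[OF S'_meas]) (rule S'_bound, simp)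
  have S_der: "((\<lambda>s. ?S s \<xi>) has_vector_derivative ?S' s \<xi>) (at s)" for s \<xi>
    unfolding curl_symbol_def using jk
    by (intro has_vector_derivative_mult_right has_vector_derivative_diff ft_time_derivative[OF A_admissible]) auto
  have "((\<lambda>s. apot A j k s x) has_vector_derivative inv_fourier (?S' t) x) (at t)" for x
  proof -
    have "((\<lambda>s. LINT \<xi>|lborel. cis (\<xi> \<bullet> x) * ?S s \<xi>) has_vector_derivative (LINT \<xi>|lborel. cis (\<xi> \<bullet> x) * ?S' t \<xi>)) (at t)"
    proof (rule has_vector_derivative_integral[where e = 1 and w = "\<lambda>\<xi>. 2 * C * (1 / (1 + norm \<xi>) ^ 4)"])
      show "integrable lborel (\<lambda>\<xi>. cis (\<xi> \<bullet> x) * ?S s \<xi>)" for s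
        using has_fourier_apot[OF jk, of s] by (intro integrable_cis_mult) (auto simp: has_fourier_def)
      show "((\<lambda>s. cis (\<xi> \<bullet> x) * ?S s \<xi>) has_vector_derivative cis (\<xi> \<bullet> x) * ?S' s \<xi>) (at s)" for s \<xi>
        by (intro has_vector_derivative_mult_right S_der)
      show "AE \<xi> in lborel. \<forall>s. \<bar>s - t\<bar> < 1 \<longrightarrow> norm (cis (\<xi> \<bullet> x) * ?S' s \<xi>) \<le> 2 * C * (1 / (1 + norm \<xi>) ^ 4)"
        using S'_bound by (auto simp: norm_mult intro!: AE_I2)
      show "integrable lborel (\<lambda>\<xi>::real^3. 2 * C * (1 / (1 + norm \<xi>) ^ 4))"
        by (intro integrable_mult_right integrable_inverse_power4)
    qed simp
    from has_vector_derivative_mult_right[OF this, of "complex_of_real (1 / (2 * pi) ^ 3)"]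
    have "((\<lambda>s. inv_fourier (?S s) x) has_vector_derivative inv_fourier (?S' t) x) (at t)"
      by (simp add: inv_fourier_def)
    then show ?thesis
      using has_fourier_apot[OF jk] by (simp add: has_fourier_def)
  qed
  then have "pd 0 (apot A j k) t x = inv_fourier (?S' t) x" for x
    unfolding pd_def[of 0 "apot A j k"] line_0
    by (intro vector_derivative_at has_vector_derivative_shift_iff[of "\<lambda>s. apot A j k s x" t, THEN iffD2])
  then show ?thesis using S'_int by (simp add: has_fourier_def)
qed

lemma dd0_apot_null_forms:
  "(\<Sum>j=1..3. \<Sum>k=1..3. Q \<epsilon> j k (nabla_pow (-1) (dd \<epsilon> 0 (apot A j k))) V t x) =
     - 2 *s (\<Sum>k=1..3. (complex_of_real \<epsilon> * cfield (pd 0 (A k)) t x) *s pd k V t x)"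
proof -
  let ?H = "\<lambda>k \<xi>. complex_of_real \<epsilon> * ft (pd 0 (cfield (A k)) t) \<xi>"
  obtain C where C: "C \<ge> 0" "\<And>j s \<xi>. j \<in> {1..3} \<Longrightarrow> \<bar>s\<bar> \<le> \<bar>t\<bar> \<Longrightarrow> norm (ft (pd 0 (cfield (A j)) s) \<xi>) \<le> C / (1 + norm \<xi>) ^ 4"
    using ft_pd_A_bound[of 0 "\<bar>t\<bar>"] by auto
  have "(\<Sum>j=1..3. \<Sum>k=1..3. Q \<epsilon> j k (nabla_pow (-1) (dd \<epsilon> 0 (apot A j k))) V t x) =
     - 2 *s (\<Sum>k=1..3. inv_fourier (?H k) x *s pd k V t x)"
  proof (rule sum_null_forms_potential)
    show "norm (?H k \<xi>) \<le> (\<bar>\<epsilon>\<bar> * C) / (1 + norm \<xi>) ^ 4" if "k \<in> {1..3}" for k \<xi>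
    proof -
      have "\<bar>\<epsilon>\<bar> * norm (ft (pd 0 (cfield (A k)) t) \<xi>) \<le> \<bar>\<epsilon>\<bar> * (C / (1 + norm \<xi>) ^ 4)"
        using C(2)[OF that, of t \<xi>] by (intro mult_left_mono) auto
      then show ?thesis by (simp add: norm_mult)
    qed
    show "has_fourier (dd \<epsilon> 0 (apot A j k) t) (curl_symbol ?H j k)" if jk: "j \<in> {1..3}" "k \<in> {1..3}" for j k
      using has_fourier_cmult[OF has_fourier_pd0_apot[OF jk, of t], of "complex_of_real \<epsilon>"]
      by (simp add: curl_symbol_def[abs_def] dd_def[abs_def] scaleR_conv_of_real algebra_simps)
    show "(\<Sum>j=1..3. complex_of_real (coord j \<xi>) * ?H j \<xi>) = 0" for \<xi>
    proof -
      have "(\<Sum>j=1..3. complex_of_real (coord j \<xi>) * ?H j \<xi>) =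
        complex_of_real \<epsilon> * (\<Sum>j=1..3. complex_of_real (coord j \<xi>) * ft (pd 0 (cfield (A j)) t) \<xi>)"
        unfolding sum_distrib_left by (intro sum.cong refl) simp
      then show ?thesis unfolding ft_pd0_A_div_free by simp
    qed
    show "?H k \<in> borel_measurable borel" if "k \<in> {1..3}" for k
      using ft_pd_A_measurable[OF that, of 0 t] by simp
  qed
  also have "(\<Sum>k=1..3. inv_fourier (?H k) x *s pd k V t x) = (\<Sum>k=1..3. (complex_of_real \<epsilon> * cfield (pd 0 (A k)) t x) *s pd k V t x)"
  proof (intro sum.cong refl)
    fix k :: nat assume k: "k \<in> {1..3}"
    then have "has_fourier (pd 0 (cfield (A k)) t) (ft (pd 0 (cfield (A k)) t))"
      using admissible_mono[OF pd_A_admissible] by (intro has_fourier_ft) auto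
    from has_fourier_cmult[OF this, of "complex_of_real \<epsilon>"]
    show "inv_fourier (?H k) x *s pd k V t x = (complex_of_real \<epsilon> * cfield (pd 0 (A k)) t x) *s pd k V t x"
      using cfield_pd(1)[OF A_Ck[OF k], of 0] by (simp add: has_fourier_def)
  qed
  finally show ?thesis .
qed

end

subsection \<open>Symmetry of mixed derivatives\<close>

text \<open>The second difference of \<open>g\<close> over a square of side \<open>h\<close> is
  evaluated by the mean value theorem in both orders. This gives \<open>h\<^sup>2\<close> times
  \<open>g12\<close> and \<open>h\<^sup>2\<close> times \<open>g21\<close> at two points of the
  square, and continuity at the origin concludes.\<close>

lemma mixed_derivatives_real:
  fixes g :: "real \<Rightarrow> real \<Rightarrow> real"
  assumes g1: "\<And>a b. ((\<lambda>a. g a b) has_real_derivative g1 a b) (at a)"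
    and g2: "\<And>a b. ((\<lambda>b. g a b) has_real_derivative g2 a b) (at b)"
    and g12: "\<And>a b. ((\<lambda>b. g1 a b) has_real_derivative g12 a b) (at b)"
    and g21: "\<And>a b. ((\<lambda>a. g2 a b) has_real_derivative g21 a b) (at a)"
    and c12: "continuous_on UNIV (\<lambda>(a, b). g12 a b)"
    and c21: "continuous_on UNIV (\<lambda>(a, b). g21 a b)"
  shows "g12 0 0 = g21 0 0"
proof -
  have *: "\<exists>p q. p \<in> {0<..<h} \<times> {0<..<h} \<and> q \<in> {0<..<h} \<times> {0<..<h} \<and>
      (\<lambda>(a, b). g12 a b) p = (\<lambda>(a, b). g21 a b) q" if h: "h > 0" for h :: real
  proof -
    have "\<exists>z. 0 < z \<and> z < h \<and> (g h h - g h 0) - (g 0 h - g 0 0) = (h - 0) * (g1 z h - g1 z 0)"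
      by (rule MVT2[OF h]) (intro DERIV_diff g1)
    then obtain a where a: "0 < a" "a < h" "g h h - g h 0 - (g 0 h - g 0 0) = h * (g1 a h - g1 a 0)" by auto
    obtain b where b: "0 < b" "b < h" "g1 a h - g1 a 0 = (h - 0) * g12 a b"
      using MVT2[OF h, of "\<lambda>b. g1 a b" "\<lambda>b. g12 a b"] g12 by auto
    have "\<exists>z. 0 < z \<and> z < h \<and> (g h h - g 0 h) - (g h 0 - g 0 0) = (h - 0) * (g2 h z - g2 0 z)"
      by (rule MVT2[OF h]) (intro DERIV_diff g2)
    then obtain b' where b': "0 < b'" "b' < h" "g h h - g 0 h - (g h 0 - g 0 0) = h * (g2 h b' - g2 0 b')" by auto
    obtain a' where a': "0 < a'" "a' < h" "g2 h b' - g2 0 b' = (h - 0) * g21 a' b'"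
      using MVT2[OF h, of "\<lambda>a. g2 a b'" "\<lambda>a. g21 a b'"] g21 by auto
    have "h * (h * g12 a b) = g h h - g h 0 - (g 0 h - g 0 0)"
      using a(3) b(3) by simp
    also have "\<dots> = g h h - g 0 h - (g h 0 - g 0 0)" by simp
    also have "\<dots> = h * (h * g21 a' b')"
      using b'(3) a'(3) by simp
    finally have "h * (h * g12 a b) = h * (h * g21 a' b')" .
    then have "g12 a b = g21 a' b'" using h by simp
    then show ?thesis using a b a' b' by (intro exI[of _ "(a, b)"] exI[of _ "(a', b')"]) auto
  qed
  let ?d = "\<lambda>n. inverse (real (Suc n))"
  have "\<forall>n. \<exists>p q. p \<in> {0<..<?d n} \<times> {0<..<?d n} \<and> q \<in> {0<..<?d n} \<times> {0<..<?d n} \<and>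
      (\<lambda>(a, b). g12 a b) p = (\<lambda>(a, b). g21 a b) q"
    using * by simp
  then obtain p q where pq: "\<And>n. p n \<in> {0<..<?d n} \<times> {0<..<?d n}" "\<And>n. q n \<in> {0<..<?d n} \<times> {0<..<?d n}"
      "\<And>n. (\<lambda>(a, b). g12 a b) (p n) = (\<lambda>(a, b). g21 a b) (q n)"
    by metis
  have lim: "r \<longlonglongrightarrow> (0, 0)" if r: "\<And>n. r n \<in> {0<..<?d n} \<times> {0<..<?d n}" for r
  proof -
    have fs: "0 \<le> fst (r n)" "fst (r n) \<le> ?d n" "0 \<le> snd (r n)" "snd (r n) \<le> ?d n" for n
      using r[of n] by (auto simp: mem_Times_iff)
    have "(\<lambda>n. fst (r n)) \<longlonglongrightarrow> 0" "(\<lambda>n. snd (r n)) \<longlonglongrightarrow> 0"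
      by (rule tendsto_sandwich[OF _ _ tendsto_const LIMSEQ_inverse_real_of_nat]; simp add: fs del: of_nat_Suc)+
    then have "(\<lambda>n. (fst (r n), snd (r n))) \<longlonglongrightarrow> (0, 0)" by (rule tendsto_Pair)
    then show ?thesis by simp
  qed
  have "(\<lambda>n. (\<lambda>(a, b). g12 a b) (p n)) \<longlonglongrightarrow> (\<lambda>(a, b). g12 a b) (0, 0)"
    using c12 lim[OF pq(1)] by (intro isCont_tendsto_compose[where g = "\<lambda>(a, b). g12 a b"])
      (auto simp: continuous_on_eq_continuous_at)
  moreover have "(\<lambda>n. (\<lambda>(a, b). g21 a b) (q n)) \<longlonglongrightarrow> (\<lambda>(a, b). g21 a b) (0, 0)"
    using c21 lim[OF pq(2)] by (intro isCont_tendsto_compose[where g = "\<lambda>(a, b). g21 a b"])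
      (auto simp: continuous_on_eq_continuous_at)
  ultimately show ?thesis
    unfolding pq(3) using LIMSEQ_unique by fastforce
qed

text \<open>Splitting a coordinate direction into a time part and a space part makes
  \<open>line\<close> a single formula, so that two directions can be varied together without
  distinguishing time from space.\<close>

definition time_dir :: "nat \<Rightarrow> real" where "time_dir \<mu> = (if \<mu> = 0 then 1 else 0)"
definition space_dir :: "nat \<Rightarrow> real^3" where "space_dir \<mu> = (if \<mu> = 0 then 0 else axis (of_nat \<mu>) 1)"

lemma line_dir: "line \<mu> f t x = (\<lambda>h. f (t + h * time_dir \<mu>) (x + h *\<^sub>R space_dir \<mu>))"
  by (auto simp: line_def time_dir_def space_dir_def)

lemma Ck_dir_derivative:
  assumes "Ck (Suc n) f" "\<mu> \<in> {0..3}"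
  shows "((\<lambda>s. f (t + s * time_dir \<mu>) (x + s *\<^sub>R space_dir \<mu>)) has_vector_derivative
     pd \<mu> f (t + s * time_dir \<mu>) (x + s *\<^sub>R space_dir \<mu>)) (at s)"
  using Ck_line_derivative[OF assms, of "t + s * time_dir \<mu>" "x + s *\<^sub>R space_dir \<mu>"]
    has_vector_derivative_shift_iff[of "\<lambda>s. f (t + s * time_dir \<mu>) (x + s *\<^sub>R space_dir \<mu>)" s]
  by (simp add: line_dir algebra_simps)

text \<open>\<open>pd\<close> is a derivative along a line only, so the field is restricted to the
  two-parameter family of points reached from \<open>(t, x)\<close> along both directions; inner
  products with basis vectors make it real valued, as the mean value theorem requires.\<close>

lemma pd_commute:
  fixes U :: "'v::euclidean_space field"
  assumes U: "Ck 2 U" and \<mu>: "\<mu> \<in> {0..3}" and \<nu>: "\<nu> \<in> {0..3}"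
  shows "pd \<nu> (pd \<mu> U) t x = pd \<mu> (pd \<nu> U) t x"
proof (rule euclidean_eqI)
  fix e :: 'v assume "e \<in> Basis"
  have U2: "Ck (Suc 1) U" using U by (simp add: numeral_2_eq_2)
  have U\<mu>: "Ck (Suc 0) (pd \<mu> U)" and U\<nu>: "Ck (Suc 0) (pd \<nu> U)"
    using Ck_pd[OF U2 \<mu>] Ck_pd[OF U2 \<nu>] by simp_all
  let ?t = "\<lambda>a b. t + a * time_dir \<mu> + b * time_dir \<nu>"
  let ?x = "\<lambda>a b. x + a *\<^sub>R space_dir \<mu> + b *\<^sub>R space_dir \<nu>"
  have D\<nu>: "((\<lambda>b. f (?t a b) (?x a b) \<bullet> e) has_real_derivative pd \<nu> f (?t a b) (?x a b) \<bullet> e) (at b)"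
    if "Ck (Suc n) f" for f :: "'v field" and n a b
    unfolding has_real_derivative_iff_has_vector_derivative
    using bounded_linear.has_vector_derivative[OF bounded_linear_inner_left Ck_dir_derivative[OF that \<nu>, of "t + a * time_dir \<mu>" "x + a *\<^sub>R space_dir \<mu>" b], of e]
    by simp
  have D\<mu>: "((\<lambda>a. f (?t a b) (?x a b) \<bullet> e) has_real_derivative pd \<mu> f (?t a b) (?x a b) \<bullet> e) (at a)"
    if "Ck (Suc n) f" for f :: "'v field" and n a b
    unfolding has_real_derivative_iff_has_vector_derivative
    using bounded_linear.has_vector_derivative[OF bounded_linear_inner_left Ck_dir_derivative[OF that \<mu>, of "t + b * time_dir \<nu>" "x + b *\<^sub>R space_dir \<nu>" a], of e]
    by (simp add: ac_simps)
  have cont: "continuous_on UNIV (\<lambda>(a, b). f (?t a b) (?x a b) \<bullet> e)" if "Ck n f" for f :: "'v field" and n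
  proof -
    have "continuous_on UNIV (\<lambda>p. (?t (fst p) (snd p), ?x (fst p) (snd p)))"
      by (intro continuous_intros)
    from continuous_on_compose2[OF Ck_continuous[OF that] this]
    show ?thesis by (auto simp: case_prod_unfold intro!: continuous_intros)
  qed
  have "pd \<nu> (pd \<mu> U) (?t 0 0) (?x 0 0) \<bullet> e = pd \<mu> (pd \<nu> U) (?t 0 0) (?x 0 0) \<bullet> e"
    by (rule mixed_derivatives_real[where g = "\<lambda>a b. U (?t a b) (?x a b) \<bullet> e",
        OF D\<mu>[OF U2] D\<nu>[OF U2] D\<nu>[OF U\<mu>] D\<mu>[OF U\<nu>] cont[OF Ck_pd[OF U\<mu> \<nu>]] cont[OF Ck_pd[OF U\<nu> \<mu>]]])
  then show "pd \<nu> (pd \<mu> U) t x \<bullet> e = pd \<mu> (pd \<nu> U) t x \<bullet> e" by simp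
qed

section \<open>Cutoff and weight for the energy estimate\<close>

definition cutoff :: "real \<Rightarrow> real" where "cutoff z = (max 0 z)\<^sup>2"

text \<open>Squaring the positive part makes it continuously differentiable across 0, which is the
  smoothness the energy estimate asks for; the derivative is nonnegative, which decides the sign of
  the terms that the cutoff produces.\<close>

lemma cutoff_derivative: "(cutoff has_real_derivative 2 * max 0 z) (at z)"
proof (cases z "0::real" rule: linorder_cases)
  case less
  have "((\<lambda>z. 0) has_real_derivative 0) (at z)" by simp
  then have "(cutoff has_real_derivative 0) (at z)"
    by (rule has_field_derivative_transform_within_open[where S = "{..<0}"]) (use less in \<open>auto simp: cutoff_def\<close>)
  then show ?thesis using less by simp
next
  case greater
  have "((\<lambda>z. z\<^sup>2) has_real_derivative 2 * z) (at z)"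
    by (auto intro!: derivative_eq_intros)
  then have "(cutoff has_real_derivative 2 * z) (at z)"
    by (rule has_field_derivative_transform_within_open[where S = "{0<..}"]) (use greater in \<open>auto simp: cutoff_def\<close>)
  then show ?thesis using greater by simp
next
  case equal
  have "((\<lambda>y. max 0 y) \<longlongrightarrow> 0) (at (0::real))"
    by (auto intro!: tendsto_eq_intros)
  then have "((\<lambda>y. (cutoff y - cutoff 0) / (y - 0)) \<longlongrightarrow> 0) (at 0)"
    by (rule Lim_transform_eventually)
       (auto simp: eventually_at_filter cutoff_def max_def power2_eq_square)
  then show ?thesis using equal by (simp add: has_field_derivative_iff)
qed

lemma cutoff_nonneg: "0 \<le> cutoff z"
  by (simp add: cutoff_def)

lemma continuous_on_cutoff [continuous_intros]: "continuous_on S f \<Longrightarrow> continuous_on S (\<lambda>x. cutoff (f x))"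
  unfolding cutoff_def by (intro continuous_intros)

text \<open>Smooth substitute for \<open>norm x\<close>, which is not differentiable at the origin;
  its gradient \<open>x / japanese x\<close> has length less than 1.\<close>

definition japanese :: "real^3 \<Rightarrow> real" where "japanese x = sqrt (1 + x \<bullet> x)"

lemma japanese_pos: "0 < japanese x"
  by (simp add: japanese_def add_pos_nonneg)

lemma norm_le_japanese: "norm x \<le> japanese x"
  by (simp add: japanese_def norm_eq_sqrt_inner)

lemma japanese_derivative:
  assumes "j \<in> {1..3}"
  shows "((\<lambda>h. japanese (x + h *\<^sub>R axis (of_nat j) 1)) has_real_derivative coord j x / japanese x) (at 0)"
proof -
  let ?e = "axis (of_nat j) 1 :: real^3"
  have "1 + (x + h *\<^sub>R ?e) \<bullet> (x + h *\<^sub>R ?e) = 1 + x \<bullet> x + 2 * h * coord j x + h\<^sup>2" for h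
    by (simp add: inner_add_left inner_add_right inner_axis inner_axis' power2_eq_square algebra_simps)
  moreover have "((\<lambda>h. sqrt (1 + x \<bullet> x + 2 * h * coord j x + h\<^sup>2)) has_real_derivative coord j x / japanese x) (at 0)"
    using japanese_pos[of x] by (auto intro!: derivative_eq_intros simp: japanese_def field_simps)
  ultimately show ?thesis by (simp only: japanese_def)
qed

lemma continuous_on_japanese [continuous_intros]: "continuous_on S f \<Longrightarrow> continuous_on S (\<lambda>x. japanese (f x))"
  unfolding japanese_def by (intro continuous_intros)

lemma bounded_on_compact_cylinder:
  fixes g :: "real \<times> (real^3) \<Rightarrow> 'b::real_normed_vector"
  assumes "continuous_on UNIV g"
  obtains C where "C \<ge> 0" "\<And>t x. \<bar>t\<bar> \<le> T \<Longrightarrow> norm x \<le> \<rho> \<Longrightarrow> norm (g (t, x)) \<le> C"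
proof -
  have "compact (g ` ({-T..T} \<times> cball 0 \<rho>))"
    by (intro compact_continuous_image compact_Times compact_cball compact_Icc)
       (use assms continuous_on_subset in blast)
  then obtain C where C: "\<And>y. y \<in> g ` ({-T..T} \<times> cball 0 \<rho>) \<Longrightarrow> norm y \<le> C"
    using compact_imp_bounded bounded_iff by metis
  have "norm (g (t, x)) \<le> \<bar>C\<bar>" if "\<bar>t\<bar> \<le> T" "norm x \<le> \<rho>" for t x
    using C[of "g (t, x)"] that by (force simp: abs_le_iff)
  then show ?thesis using that[of "\<bar>C\<bar>"] by simp
qed

text \<open>Continuous functions supported in a fixed ball thereby meet the hypotheses of the lemmas
  stated for decay of order 4.\<close>

lemma compact_support_decay:
  fixes g :: "real \<times> (real^3) \<Rightarrow> 'b::real_normed_vector"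
  assumes "continuous_on UNIV g" and supp: "\<And>t x. \<bar>t\<bar> \<le> T \<Longrightarrow> norm x > \<rho> \<Longrightarrow> g (t, x) = 0"
  obtains C where "C \<ge> 0" "\<And>t x. \<bar>t\<bar> \<le> T \<Longrightarrow> norm (g (t, x)) \<le> C / (1 + norm x) ^ 4"
proof -
  obtain C where C: "C \<ge> 0" "\<And>t x. \<bar>t\<bar> \<le> T \<Longrightarrow> norm x \<le> \<rho> \<Longrightarrow> norm (g (t, x)) \<le> C"
    using bounded_on_compact_cylinder[OF assms(1)] by metis
  have "norm (g (t, x)) \<le> C * (1 + \<bar>\<rho>\<bar>) ^ 4 / (1 + norm x) ^ 4" if t: "\<bar>t\<bar> \<le> T" for t x
  proof (cases "norm x \<le> \<rho>")
    case True
    have pos: "0 < (1 + norm x) ^ 4" by (intro zero_less_power add_pos_nonneg) auto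
    have "norm (g (t, x)) * (1 + norm x) ^ 4 \<le> C * (1 + \<bar>\<rho>\<bar>) ^ 4"
      using C(1) C(2)[OF t True] True by (intro mult_mono power_mono) auto
    then show ?thesis using pos by (simp only: pos_le_divide_eq)
  next
    case False
    then have "norm (g (t, x)) = 0" using supp[OF t, of x] by simp
    also have "0 \<le> C * (1 + \<bar>\<rho>\<bar>) ^ 4 / (1 + norm x) ^ 4"
      using C(1) by (intro divide_nonneg_nonneg mult_nonneg_nonneg zero_le_power) auto
    finally show ?thesis .
  qed
  then show ?thesis using that[of "C * (1 + \<bar>\<rho>\<bar>) ^ 4"] C(1) by simp
qed

subsection \<open>Uniqueness for symmetric hyperbolic systems\<close>

text \<open>The set where \<open>f\<close> differs from 0 is open and null, and a nonempty open set
  is never null.\<close>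

lemma continuous_AE_zero:
  fixes f :: "'a::euclidean_space \<Rightarrow> real"
  assumes c: "continuous_on UNIV f" and ae: "AE x in lborel. f x = 0"
  shows "f x = 0"
proof -
  have m: "f \<in> borel_measurable borel" using c by (rule borel_measurable_continuous_onI)
  have "open {x. f x \<noteq> 0}"
    using c by (intro open_Collect_neq) auto
  moreover have "{x. f x \<noteq> 0} \<in> null_sets lborel"
    using AE_iff_null[of lborel "\<lambda>x. f x = 0"] ae m by simp
  then have "negligible {x. f x \<noteq> 0}"
    by (simp add: negligible_iff_null_sets null_sets_completionI)
  ultimately have "{x. f x \<noteq> 0} = {}"
    using open_not_negligible by blast
  then show ?thesis by blast
qed

text \<open>Energy method: for a cutoff \<open>\<chi>\<close> of \<open>R - K s - \<langle>x\<rangle>\<close> with \<open>K\<close> at least the propagation speed,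
  \<open>\<integral> \<chi> |w|\<^sup>2\<close> does not increase. The sign \<open>\<sigma>\<close> treats both time directions at once.\<close>

locale symmetric_hyperbolic =
  fixes \<epsilon> :: real and w :: "'v::euclidean_space field" and W :: "nat \<Rightarrow> 'v field" and L :: "nat \<Rightarrow> 'v \<Rightarrow> 'v"
  assumes eps: "\<epsilon> > 0"
    and w_cont: "continuous_on UNIV (\<lambda>(t, x). w t x)"
    and W_cont: "\<And>\<mu>. \<mu> \<in> {0..3} \<Longrightarrow> continuous_on UNIV (\<lambda>(t, x). W \<mu> t x)"
    and W_der: "\<And>\<mu> t x. \<mu> \<in> {0..3} \<Longrightarrow> (line \<mu> w t x has_vector_derivative W \<mu> t x) (at 0)"
    and L_linear: "\<And>j. j \<in> {1..3} \<Longrightarrow> bounded_linear (L j)"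
    and L_sym: "\<And>j u v. j \<in> {1..3} \<Longrightarrow> L j u \<bullet> v = u \<bullet> L j v"
    and L_norm: "\<And>j u. j \<in> {1..3} \<Longrightarrow> norm (L j u) \<le> norm u"
    and equation: "\<And>t x. \<epsilon> *\<^sub>R W 0 t x + (\<Sum>j=1..3. L j (W j t x)) = 0"
    and initial: "\<And>x. w 0 x = 0"
begin

context
  fixes \<sigma> R :: real
  assumes \<sigma>: "\<bar>\<sigma>\<bar> = 1"
begin

text \<open>\<open>s\<close> is the time elapsed from 0 in the direction \<open>\<sigma>\<close>.
  \<open>F\<close> is the localised energy density, \<open>h j\<close> its flux in direction
  \<open>j\<close>; \<open>F'\<close> and \<open>h' j\<close> are their derivatives, the symmetry of
  \<open>L j\<close> having merged two terms in the latter. In \<open>K\<close>, the 3 counts the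
  flux directions, each bounded by the squared norm of \<open>w\<close>, and
  \<open>1 / \<epsilon>\<close> comes from the coefficient of \<open>W 0\<close>.\<close>

definition "K = 3 / \<epsilon>"
definition "q s x = R - K * s - japanese x"
definition "F s x = cutoff (q s x) * (w (\<sigma> * s) x \<bullet> w (\<sigma> * s) x)"
definition "F' s x = 2 * max 0 (q s x) * (- K) * (w (\<sigma> * s) x \<bullet> w (\<sigma> * s) x) +
  cutoff (q s x) * (2 * (w (\<sigma> * s) x \<bullet> (\<sigma> *\<^sub>R W 0 (\<sigma> * s) x)))"
definition "h j s x = cutoff (q s x) * (w (\<sigma> * s) x \<bullet> L j (w (\<sigma> * s) x))"
definition "h' j s x = 2 * max 0 (q s x) * (- (coord j x / japanese x)) * (w (\<sigma> * s) x \<bullet> L j (w (\<sigma> * s) x)) +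
  cutoff (q s x) * (2 * (w (\<sigma> * s) x \<bullet> L j (W j (\<sigma> * s) x)))"

lemma K_pos: "K > 0" using eps by (simp add: K_def)

lemma F_derivative: "((\<lambda>s. F s x) has_vector_derivative F' s x) (at s)"
proof -
  have "((\<lambda>t. w t x) has_vector_derivative W 0 (\<sigma> * s) x) (at (\<sigma> * s))"
    using W_der[of 0 "\<sigma> * s" x] has_vector_derivative_shift_iff[of "\<lambda>t. w t x" "\<sigma> * s"]
    by (simp add: line_0)
  moreover have "((\<lambda>s. \<sigma> * s) has_vector_derivative \<sigma>) (at s)"
    by (auto intro!: derivative_eq_intros)
  ultimately have ws: "((\<lambda>s. w (\<sigma> * s) x) has_vector_derivative \<sigma> *\<^sub>R W 0 (\<sigma> * s) x) (at s)"
    using vector_diff_chain_at[of "\<lambda>s. \<sigma> * s" \<sigma> s "\<lambda>t. w t x"] by (simp add: o_def)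
  have ww: "((\<lambda>s. w (\<sigma> * s) x \<bullet> w (\<sigma> * s) x) has_real_derivative
      2 * (w (\<sigma> * s) x \<bullet> (\<sigma> *\<^sub>R W 0 (\<sigma> * s) x))) (at s)"
    using bounded_bilinear.has_vector_derivative[OF bounded_bilinear_inner ws ws]
    unfolding has_real_derivative_iff_has_vector_derivative by (simp add: inner_commute)
  have "((\<lambda>s. q s x) has_real_derivative - K) (at s)"
    unfolding q_def by (auto intro!: derivative_eq_intros)
  from DERIV_mult[OF DERIV_chain2[OF cutoff_derivative this] ww]
  show ?thesis
    unfolding has_real_derivative_iff_has_vector_derivative[symmetric] F_def F'_def
    by (simp add: mult_ac add.commute)
qed

lemma h_derivative:
  assumes j: "j \<in> {1..3}"
  shows "((\<lambda>r. h j s (x + r *\<^sub>R axis (of_nat j) 1)) has_vector_derivative h' j s x) (at 0)"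
proof -
  let ?e = "axis (of_nat j) 1 :: real^3"
  have ws: "((\<lambda>r. w (\<sigma> * s) (x + r *\<^sub>R ?e)) has_vector_derivative W j (\<sigma> * s) x) (at 0)"
    using W_der[of j "\<sigma> * s" x] j by (simp add: line_space)
  have sym: "W j (\<sigma> * s) x \<bullet> L j (w (\<sigma> * s) x) = w (\<sigma> * s) x \<bullet> L j (W j (\<sigma> * s) x)"
    by (simp only: L_sym[OF j, symmetric] inner_commute[of "L j (W j (\<sigma> * s) x)"])
  have ww: "((\<lambda>r. w (\<sigma> * s) (x + r *\<^sub>R ?e) \<bullet> L j (w (\<sigma> * s) (x + r *\<^sub>R ?e))) has_real_derivative
      2 * (w (\<sigma> * s) x \<bullet> L j (W j (\<sigma> * s) x))) (at 0)"
    using bounded_bilinear.has_vector_derivative[OF bounded_bilinear_inner ws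
        bounded_linear.has_vector_derivative[OF L_linear[OF j] ws]]
    unfolding has_real_derivative_iff_has_vector_derivative
    by (simp add: sym)
  have "((\<lambda>r. q s (x + r *\<^sub>R ?e)) has_real_derivative - (coord j x / japanese x)) (at 0)"
    unfolding q_def using DERIV_diff[OF DERIV_const japanese_derivative[OF j], of "R - K * s" x] by simp
  from DERIV_mult[OF DERIV_chain2[OF cutoff_derivative this] ww]
  show ?thesis
    unfolding has_real_derivative_iff_has_vector_derivative[symmetric] h_def h'_def
    by (simp add: mult_ac add.commute)
qed

lemma w_cont': "continuous_on UNIV (\<lambda>p. w (\<sigma> * fst p) (snd p))"
  using continuous_on_compose2[OF w_cont, of UNIV "\<lambda>p. (\<sigma> * fst p, snd p)"]
  by (simp add: continuous_intros)

lemma W_cont': "\<mu> \<in> {0..3} \<Longrightarrow> continuous_on UNIV (\<lambda>p. W \<mu> (\<sigma> * fst p) (snd p))"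
  using continuous_on_compose2[OF W_cont, of \<mu> UNIV "\<lambda>p. (\<sigma> * fst p, snd p)"]
  by (simp add: continuous_intros)

lemma q_cont: "continuous_on UNIV (\<lambda>p. q (fst p) (snd p))"
  unfolding q_def by (intro continuous_intros)

lemma F_cont: "continuous_on UNIV (\<lambda>p. F (fst p) (snd p))"
  unfolding F_def by (intro continuous_intros q_cont w_cont')

lemma F'_cont: "continuous_on UNIV (\<lambda>p. F' (fst p) (snd p))"
  unfolding F'_def by (intro continuous_intros q_cont w_cont' W_cont') auto

lemma h_cont: "j \<in> {1..3} \<Longrightarrow> continuous_on UNIV (\<lambda>p. h j (fst p) (snd p))"
  unfolding h_def by (intro continuous_intros q_cont w_cont' bounded_linear.continuous_on[OF L_linear])

lemma h'_cont:
  assumes "j \<in> {1..3}"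
  shows "continuous_on UNIV (\<lambda>p. h' j (fst p) (snd p))"
proof -
  have "japanese x \<noteq> 0" for x using japanese_pos[of x] by simp
  then show ?thesis unfolding h'_def using assms
    by (intro continuous_intros q_cont w_cont' W_cont' bounded_linear.continuous_on[OF L_linear]) auto
qed

lemma slice_measurable:
  fixes g :: "real \<Rightarrow> real^3 \<Rightarrow> real"
  assumes "continuous_on UNIV (\<lambda>p. g (fst p) (snd p))"
  shows "g s \<in> borel_measurable borel"
  using continuous_on_compose2[OF assms, of UNIV "\<lambda>x. (s, x)"]
  by (intro borel_measurable_continuous_onI) (simp add: continuous_intros)

lemma q_neg:
  assumes "\<bar>s\<bar> \<le> T" "norm x > R + K * T"
  shows "q s x < 0"
proof -
  have "- K * s \<le> K * T"
    using assms(1) K_pos mult_left_mono[of "- s" T K] by simp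
  then show ?thesis using norm_le_japanese[of x] assms(2) by (simp add: q_def)
qed

lemma decay_bound:
  fixes g :: "real \<Rightarrow> real^3 \<Rightarrow> real"
  assumes "continuous_on UNIV (\<lambda>p. g (fst p) (snd p))" and "\<And>s x. q s x < 0 \<Longrightarrow> g s x = 0"
  obtains C where "C \<ge> 0" "\<And>s x. \<bar>s\<bar> \<le> T \<Longrightarrow> norm (g s x) \<le> C / (1 + norm x) ^ 4"
proof (rule compact_support_decay[OF assms(1), of T "R + K * T"])
  show "g (fst (s, x)) (snd (s, x)) = 0" if "\<bar>s\<bar> \<le> T" "R + K * T < norm x" for s x
    using assms(2) q_neg[OF that] by simp
qed (use that in simp)

lemma F_zero: "q s x < 0 \<Longrightarrow> F s x = 0" by (simp add: F_def cutoff_def)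
lemma F'_zero: "q s x < 0 \<Longrightarrow> F' s x = 0" by (simp add: F'_def cutoff_def)
lemma h_zero: "q s x < 0 \<Longrightarrow> h j s x = 0" by (simp add: h_def cutoff_def)
lemma h'_zero: "q s x < 0 \<Longrightarrow> h' j s x = 0" by (simp add: h'_def cutoff_def)

lemma slice_integrable:
  fixes g :: "real \<Rightarrow> real^3 \<Rightarrow> real"
  assumes "continuous_on UNIV (\<lambda>p. g (fst p) (snd p))" and "\<And>s x. q s x < 0 \<Longrightarrow> g s x = 0"
  shows "integrable lborel (g s)"
proof -
  obtain C where "\<And>r x. \<bar>r\<bar> \<le> \<bar>s\<bar> \<Longrightarrow> norm (g r x) \<le> C / (1 + norm x) ^ 4"
    using decay_bound[OF assms] by metis
  then show ?thesis by (intro integrable_decay[of "g s" C] slice_measurable[OF assms(1)]) simp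
qed

lemma energy_derivative: "((\<lambda>s. LINT x|lborel. F s x) has_real_derivative (LINT x|lborel. F' s x)) (at s)"
proof -
  obtain C where C: "\<And>r x. \<bar>r\<bar> \<le> \<bar>s\<bar> + 1 \<Longrightarrow> norm (F' r x) \<le> C / (1 + norm x) ^ 4"
    using decay_bound[OF F'_cont F'_zero] by metis
  show ?thesis
    unfolding has_real_derivative_iff_has_vector_derivative
  proof (rule has_vector_derivative_integral[where e = 1 and w = "\<lambda>x. C * (1 / (1 + norm x) ^ 4)"])
    show "integrable lborel (F r)" for r by (rule slice_integrable[OF F_cont F_zero])
    show "((\<lambda>s. F s x) has_vector_derivative F' r x) (at r)" for r x by (rule F_derivative)
    show "integrable lborel (\<lambda>x::real^3. C * (1 / (1 + norm x) ^ 4))"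
      by (intro integrable_mult_right integrable_inverse_power4)
    show "AE x in lborel. \<forall>r. \<bar>r - s\<bar> < 1 \<longrightarrow> norm (F' r x) \<le> C * (1 / (1 + norm x) ^ 4)"
    proof (intro AE_I2 allI impI)
      fix x r assume "\<bar>r - s\<bar> < 1"
      then show "norm (F' r x) \<le> C * (1 / (1 + norm x) ^ 4)" using C[of r x] by simp
    qed
  qed simp
qed

lemma integral_h'_zero:
  assumes j: "j \<in> {1..3}"
  shows "(LINT x|lborel. h' j s x) = 0"
proof -
  obtain C where C: "\<And>r x. \<bar>r\<bar> \<le> \<bar>s\<bar> \<Longrightarrow> norm (h j r x) \<le> C / (1 + norm x) ^ 4"
    using decay_bound[OF h_cont[OF j] h_zero] by metis
  obtain C' where C': "\<And>r x. \<bar>r\<bar> \<le> \<bar>s\<bar> \<Longrightarrow> norm (h' j r x) \<le> C' / (1 + norm x) ^ 4"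
    using decay_bound[OF h'_cont[OF j] h'_zero] by metis
  show ?thesis
    by (rule integral_directional_derivative_zero[where h = "h j s", OF h_derivative[OF j] slice_measurable[OF h_cont[OF j]] C C'])
       (simp_all add: norm_axis_1)
qed

text \<open>Paired with \<open>w\<close>, the equation cancels every term containing a derivative of
  \<open>w\<close>. Up to a nonnegative factor, the derivative of the cutoff leaves
  \<open>- 3 |w|^2\<close> from time against three flux terms, each at most \<open>|w|^2\<close>,
  because \<open>L j\<close> does not increase norms and \<open>coord j x / japanese x\<close> is at
  most 1 in size.\<close>

lemma energy_density_nonpos: "F' s x + \<sigma> / \<epsilon> * (\<Sum>j=1..3. h' j s x) \<le> 0"
proof -
  let ?w = "w (\<sigma> * s) x"
  define n where "n = ?w \<bullet> ?w"
  define y where "y j = coord j x / japanese x * (?w \<bullet> L j ?w)" for j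
  have y: "\<bar>y j\<bar> \<le> n" if "j \<in> {1..3}" for j
  proof -
    have "\<bar>coord j x / japanese x\<bar> \<le> 1"
      using order_trans[OF coord_le_norm[of x j] norm_le_japanese] japanese_pos[of x] by simp
    moreover have "\<bar>?w \<bullet> L j ?w\<bar> \<le> norm ?w * norm ?w"
      by (rule order_trans[OF Cauchy_Schwarz_ineq2]) (intro mult_left_mono L_norm that norm_ge_zero)
    ultimately have "\<bar>y j\<bar> \<le> 1 * (norm ?w * norm ?w)"
      unfolding y_def abs_mult by (intro mult_mono) auto
    then show ?thesis by (simp add: n_def dot_square_norm power2_eq_square)
  qed
  have "?w \<bullet> (\<epsilon> *\<^sub>R W 0 (\<sigma> * s) x + (\<Sum>j=1..3. L j (W j (\<sigma> * s) x))) = 0"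
    by (simp only: equation inner_zero_right)
  then have eq: "\<epsilon> * (?w \<bullet> W 0 (\<sigma> * s) x) = - (?w \<bullet> L 1 (W 1 (\<sigma> * s) x) + ?w \<bullet> L 2 (W 2 (\<sigma> * s) x) + ?w \<bullet> L 3 (W 3 (\<sigma> * s) x))"
    by (simp only: sum_1_3 inner_add_right inner_scaleR_right)
  have "\<epsilon> * (F' s x + \<sigma> / \<epsilon> * (\<Sum>j=1..3. h' j s x)) = \<epsilon> * F' s x + \<sigma> * (\<Sum>j=1..3. h' j s x)"
    using eps by (simp add: distrib_left)
  also have "\<dots> = 2 * max 0 (q s x) * (- 3 * n - \<sigma> * (y 1 + y 2 + y 3)) +
      2 * cutoff (q s x) * \<sigma> * (\<epsilon> * (?w \<bullet> W 0 (\<sigma> * s) x) + (?w \<bullet> L 1 (W 1 (\<sigma> * s) x) + ?w \<bullet> L 2 (W 2 (\<sigma> * s) x) + ?w \<bullet> L 3 (W 3 (\<sigma> * s) x)))"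
    unfolding sum_1_3 F'_def h'_def n_def y_def K_def inner_scaleR_right
    using eps by (simp add: algebra_simps)
  also have "\<dots> = 2 * max 0 (q s x) * (- 3 * n - \<sigma> * (y 1 + y 2 + y 3))"
    unfolding eq by simp
  also have "\<dots> \<le> 0"
  proof (rule mult_nonneg_nonpos)
    have "\<sigma> = 1 \<or> \<sigma> = -1" using \<sigma> by linarith
    then show "- 3 * n - \<sigma> * (y 1 + y 2 + y 3) \<le> 0"
      using y[of 1] y[of 2] y[of 3] by (elim disjE) (simp_all add: abs_le_iff)
  qed simp
  finally show ?thesis using eps by (simp add: mult_le_0_iff)
qed

text \<open>The flux terms integrate to zero, so adding them leaves the integral unchanged and makes
  the integrand nonpositive pointwise.\<close>

lemma energy_derivative_nonpos: "(LINT x|lborel. F' s x) \<le> 0"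
proof -
  have iF: "integrable lborel (F' s)" by (rule slice_integrable[OF F'_cont F'_zero])
  have ih: "integrable lborel (h' j s)" if "j \<in> {1..3}" for j
    by (rule slice_integrable[OF h'_cont[OF that] h'_zero])
  have iS: "integrable lborel (\<lambda>x. F' s x + \<sigma> / \<epsilon> * (\<Sum>j=1..3. h' j s x))"
    unfolding sum_1_3 using iF ih[of 1] ih[of 2] ih[of 3] by simp
  have "(LINT x|lborel. F' s x) = (LINT x|lborel. F' s x + \<sigma> / \<epsilon> * (\<Sum>j=1..3. h' j s x))"
    unfolding sum_1_3
    using iF ih[of 1] ih[of 2] ih[of 3] integral_h'_zero[of 1 s] integral_h'_zero[of 2 s] integral_h'_zero[of 3 s]
    by simp
  also have "\<dots> \<le> (LINT x::real^3|lborel. 0)"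
    by (intro integral_mono iS energy_density_nonpos) auto
  finally show ?thesis by simp
qed

text \<open>The energy is nonnegative, starts at 0 by \<open>initial\<close> and does not increase,
  so its continuous nonnegative density vanishes.\<close>

lemma vanish_in_cone:
  assumes s: "s \<ge> 0"
  shows "F s x = 0"
proof -
  have nonneg: "F r y \<ge> 0" for r y
    by (simp add: F_def cutoff_nonneg)
  have "(LINT x|lborel. F s x) \<le> (LINT x|lborel. F 0 x)"
    using energy_derivative energy_derivative_nonpos
    by (intro DERIV_nonpos_imp_nonincreasing[OF s]) blast
  also have "\<dots> = 0" by (simp add: F_def initial)
  finally have "(LINT x|lborel. F s x) = 0"
    using Bochner_Integration.integral_nonneg[of lborel "F s"] nonneg by (simp add: antisym)
  then have "AE x in lborel. F s x = 0"
    by (subst (asm) integral_nonneg_eq_0_iff_AE[OF slice_integrable[OF F_cont F_zero]]) (auto simp: nonneg)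
  moreover have "continuous_on UNIV (F s)"
    using continuous_on_compose2[OF F_cont, of UNIV "\<lambda>x. (s, x)"] by (simp add: continuous_intros)
  ultimately show ?thesis by (rule continuous_AE_zero[rotated])
qed

end

theorem solution_zero: "w t x = 0"
proof -
  define \<sigma> :: real where "\<sigma> = (if t \<ge> 0 then 1 else -1)"
  have \<sigma>: "\<bar>\<sigma>\<bar> = 1" "\<sigma> * \<bar>t\<bar> = t" by (auto simp: \<sigma>_def)
  \<comment> \<open>With this \<open>R\<close> the argument of the cutoff at elapsed time
    \<open>\<bar>t\<bar>\<close> and point \<open>x\<close> is exactly 1, so \<open>F\<close> there
    is the squared norm of \<open>w t x\<close>.\<close>
  have "F \<sigma> (3 / \<epsilon> * \<bar>t\<bar> + japanese x + 1) \<bar>t\<bar> x = 0"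
    by (rule vanish_in_cone[OF \<sigma>(1)]) simp
  then show ?thesis
    by (simp add: F_def[OF \<sigma>(1)] q_def[OF \<sigma>(1)] K_def[OF \<sigma>(1)] cutoff_def \<sigma>(2))
qed

end

subsection \<open>Dirac matrices\<close>

lemma vector_4:
  "(vector [p, q, r, s] :: 'a::zero^4) $ 1 = p"
  "(vector [p, q, r, s] :: 'a::zero^4) $ 2 = q"
  "(vector [p, q, r, s] :: 'a::zero^4) $ 3 = r"
  "(vector [p, q, r, s] :: 'a::zero^4) $ 4 = s"
  unfolding vector_def by simp_all

text \<open>Each matrix permutes the components up to unit factors; with these formulas every matrix
  identity below splits into four scalar ones.\<close>

lemma alpha_mult:
  "alpha 1 *v v = vector [v $ 4, v $ 3, v $ 2, v $ 1]"
  "alpha 2 *v v = vector [- \<i> * v $ 4, \<i> * v $ 3, - \<i> * v $ 2, \<i> * v $ 1]"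
  "alpha 3 *v v = vector [v $ 3, - v $ 4, v $ 1, - v $ 2]"
  by (simp_all add: vec_eq_iff forall_4 alpha_def block_def pauli_def matrix_vector_mult_def sum_4 vector_4)

lemma spin_mult:
  "spin 1 *v v = vector [v $ 2, v $ 1, v $ 4, v $ 3]"
  "spin 2 *v v = vector [- \<i> * v $ 2, \<i> * v $ 1, - \<i> * v $ 4, \<i> * v $ 3]"
  "spin 3 *v v = vector [v $ 1, - v $ 2, v $ 3, - v $ 4]"
  by (simp_all add: vec_eq_iff forall_4 spin_def block_def pauli_def matrix_vector_mult_def sum_4 vector_4)

lemma spatial_index_cases: "j \<in> {1..3} \<Longrightarrow> j = 1 \<or> j = 2 \<or> j = (3::nat)"
  by auto

lemma bounded_linear_matrix_vector: "bounded_linear (\<lambda>v::complex^'n. M *v v)"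
  by (simp add: linear_conv_bounded_linear[symmetric] linear_iff matrix_vector_right_distrib
      vec_eq_iff matrix_vector_mult_def scaleR_sum_right distrib_left sum.distrib)

lemma bounded_linear_vector_smult: "bounded_linear (\<lambda>v::complex^'n. c *s v)"
  by (simp add: linear_conv_bounded_linear[symmetric] linear_iff vec_eq_iff distrib_left)

lemma alpha_symmetric: "j \<in> {1..3} \<Longrightarrow> (alpha j *v u) \<bullet> v = u \<bullet> (alpha j *v v)"
  by (drule spatial_index_cases)
     (auto simp: inner_vec_def sum_4 alpha_mult vector_4 inner_complex_def simp del: One_nat_def)

lemma alpha_involution: "j \<in> {1..3} \<Longrightarrow> alpha j *v (alpha j *v u) = u"
  by (drule spatial_index_cases)
     (auto simp: vec_eq_iff forall_4 alpha_mult vector_4 simp del: One_nat_def)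

lemma alpha_norm: "j \<in> {1..3} \<Longrightarrow> norm (alpha j *v u) = norm u"
  by (simp add: norm_eq alpha_symmetric alpha_involution del: atLeastAtMost_iff)

text \<open>\<open>P \<mu> \<nu>\<close> stands for the second derivatives of \<open>U\<close>.
  Their symmetry cancels the terms mixing time and space, and reduces the spatial ones to
  anticommutators of the \<open>alpha\<close> matrices, which are twice the Kronecker delta.\<close>

lemma dirac_squared:
  fixes P :: "nat \<Rightarrow> nat \<Rightarrow> complex^4"
  assumes "\<And>\<mu> \<nu>. \<mu> \<in> {0..3} \<Longrightarrow> \<nu> \<in> {0..3} \<Longrightarrow> P \<mu> \<nu> = P \<nu> \<mu>"
  shows "\<epsilon> *\<^sub>R (\<epsilon> *\<^sub>R P 0 0 - (\<Sum>j=1..3. alpha j *v P 0 j)) +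
      (\<Sum>k=1..3. alpha k *v (\<epsilon> *\<^sub>R P k 0 - (\<Sum>j=1..3. alpha j *v P k j))) =
    \<epsilon>\<^sup>2 *\<^sub>R P 0 0 - (\<Sum>j=1..3. P j j)"
proof -
  have sym: "P 1 0 = P 0 1" "P 2 0 = P 0 2" "P 3 0 = P 0 3" "P 2 1 = P 1 2" "P 3 1 = P 1 3" "P 3 2 = P 2 3"
    by (rule assms; simp)+
  show ?thesis
    unfolding sum_1_3 sym
    by (simp add: vec_eq_iff forall_4 alpha_mult vector_4 power2_eq_square
        scaleR_conv_of_real[where 'a = complex] algebra_simps
        del: One_nat_def)
qed

text \<open>\<open>a \<mu> k\<close> stands for the derivative of \<open>A k\<close> along
  \<open>\<mu>\<close>, \<open>D\<close> and \<open>V j\<close> for those of \<open>U\<close>, all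
  at one point and with \<open>\<epsilon>\<close> included in the time derivatives. The terms with
  \<open>a 0\<close> and \<open>V\<close> match by the anticommutator of the \<open>alpha\<close>
  matrices, those with spatial \<open>a\<close> and \<open>D\<close> by
  \<open>alpha j alpha k = delta + i epsilon S\<close>, whose trace part vanishes by
  \<open>div\<close>. The proof compares components.\<close>

lemma spinor_identity:
  fixes a :: "nat \<Rightarrow> nat \<Rightarrow> complex" and D :: "complex^4" and V :: "nat \<Rightarrow> complex^4"
  assumes div: "a 1 1 + a 2 2 + a 3 3 = 0"
  defines "p \<equiv> \<i> *s (D - (\<Sum>j=1..3. alpha j *v V j))"
  shows "(\<Sum>j=1..3. (\<i> * (- a 0 j)) *s (alpha j *v p)) -
      (\<Sum>j=1..3. (\<Sum>k=1..3. \<Sum>l=1..3. levi_civita j k l * a k l) *s (spin j *v p)) =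
    - 2 *s (\<Sum>k=1..3. a 0 k *s V k) -
    (\<Sum>l=1..3. - 2 *s (\<Sum>k=1..3. a l k *s (alpha l *v V k))) +
    (\<Sum>j=1..3. a 0 j *s (alpha j *v D) - (\<Sum>k=1..3. a k j *s (alpha j *v V k))) +
    (\<Sum>j=1..3. \<Sum>k=1..3. a 0 k *s (alpha j *v (alpha k *v V j)) - a j k *s (alpha j *v (alpha k *v D))) -
    (\<i> / 2) *s (\<Sum>j=1..3. \<Sum>k=1..3. \<Sum>m=1..3.
      a j m *s (\<Sum>l=1..3. levi_civita j k l *s (spin l *v (alpha m *v V k))) -
      a k m *s (\<Sum>l=1..3. levi_civita j k l *s (spin l *v (alpha m *v V j))))"
proof -
  \<comment> \<open>\<open>div\<close> is the only relation among the entries; with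
    \<open>a 3 3\<close> eliminated, a polynomial identity in free variables remains.\<close>
  have a33: "a 3 3 = - a 1 1 - a 2 2"
    using div by (simp add: eq_neg_iff_add_eq_0 algebra_simps)
  have levi: "levi_civita 1 2 3 = (1::complex)" "levi_civita 2 3 1 = (1::complex)" "levi_civita 3 1 2 = (1::complex)"
    "levi_civita 3 2 1 = (- 1::complex)" "levi_civita 2 1 3 = (- 1::complex)" "levi_civita 1 3 2 = (- 1::complex)"
    "levi_civita j j k = (0::complex)" "levi_civita j k j = (0::complex)" "levi_civita k j j = (0::complex)" for j k
    by (auto simp: levi_civita_def)
  show ?thesis
    unfolding p_def sum_1_3 levi a33
    by (simp add: vec_eq_iff forall_4 alpha_mult spin_mult vector_4 algebra_simps del: One_nat_def)
qed

section \<open>Recovering the spinor from \<open>U\<close> and assembling the identities\<close>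

lemma pd_linear:
  assumes "bounded_linear f" "Ck (Suc n) U" "\<mu> \<in> {0..3}"
  shows "pd \<mu> (\<lambda>t x. f (U t x)) t x = f (pd \<mu> U t x)"
proof -
  have "line \<mu> (\<lambda>t x. f (U t x)) t x = (\<lambda>h. f (line \<mu> U t x h))"
    by (auto simp: line_def)
  then show ?thesis
    using vector_derivative_at[OF bounded_linear.has_vector_derivative[OF assms(1) Ck_line_derivative[OF assms(2,3)]]]
    by (simp add: pd_def[of _ "\<lambda>t x. f (U t x)"])
qed

lemma dd_linear:
  assumes "bounded_linear f" "Ck (Suc n) U" "\<mu> \<in> {0..3}"
  shows "dd \<epsilon> \<mu> (\<lambda>t x. f (U t x)) t x = f (dd \<epsilon> \<mu> U t x)"
  using assms by (simp add: dd_def pd_linear[OF assms(1,2)] linear_simps(5))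

lemma Dirac_reconstruction:
  assumes eps: "\<epsilon> > 0" and \<psi>: "Ck 1 \<psi>" and U: "Ck 2 U" and aux: "aux_spinor \<epsilon> \<psi> U"
  shows "\<psi> t x = \<i> *s (\<epsilon> *\<^sub>R pd 0 U t x - (\<Sum>j=1..3. alpha j *v pd j U t x))"
proof -
  have \<psi>1: "Ck (Suc 0) \<psi>" using \<psi> by simp
  have U2: "Ck (Suc (Suc 0)) U" using U by (simp add: numeral_2_eq_2)
  have U1: "Ck (Suc 0) (pd \<mu> U)" if "\<mu> \<in> {0..3}" for \<mu> by (rule Ck_pd[OF U2 that])
  define w where "w t x = \<psi> t x - \<i> *s (\<epsilon> *\<^sub>R pd 0 U t x - (\<Sum>j=1..3. alpha j *v pd j U t x))" for t x
  define W where "W \<mu> t x = pd \<mu> \<psi> t x - \<i> *s (\<epsilon> *\<^sub>R pd \<mu> (pd 0 U) t x - (\<Sum>j=1..3. alpha j *v pd \<mu> (pd j U) t x))" for \<mu> t x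
  note bl = bounded_linear.continuous_on[OF bounded_linear_vector_smult]
    bounded_linear.continuous_on[OF bounded_linear_matrix_vector]
  interpret symmetric_hyperbolic \<epsilon> w W "\<lambda>j v. alpha j *v v"
  proof (rule symmetric_hyperbolic.intro)
    show "continuous_on UNIV (\<lambda>(t, x). w t x)"
      using Ck_continuous[OF \<psi>1] Ck_continuous[OF U1]
      unfolding w_def case_prod_unfold sum_1_3 by (intro continuous_intros bl) auto
    show "continuous_on UNIV (\<lambda>(t, x). W \<mu> t x)" if "\<mu> \<in> {0..3}" for \<mu>
      using Ck_continuous[OF Ck_pd[OF \<psi>1 that]] Ck_continuous[OF Ck_pd[OF U1 that]]
      unfolding W_def case_prod_unfold sum_1_3 by (intro continuous_intros bl) auto
    show "(line \<mu> w t x has_vector_derivative W \<mu> t x) (at 0)" if \<mu>: "\<mu> \<in> {0..3}" for \<mu> t x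
    proof -
      have "line \<mu> w t x = (\<lambda>h. line \<mu> \<psi> t x h - \<i> *s (\<epsilon> *\<^sub>R line \<mu> (pd 0 U) t x h - (\<Sum>j=1..3. alpha j *v line \<mu> (pd j U) t x h)))"
        by (auto simp: line_def w_def)
      then show ?thesis unfolding W_def
        by (auto intro!: has_vector_derivative_diff has_vector_derivative_sum
            bounded_linear.has_vector_derivative[OF bounded_linear_vector_smult]
            bounded_linear.has_vector_derivative[OF bounded_linear_matrix_vector]
            bounded_linear.has_vector_derivative[OF bounded_linear_scaleR_right]
            Ck_line_derivative[OF \<psi>1 \<mu>] Ck_line_derivative[OF U1 \<mu>])
    qed
    show "\<epsilon> *\<^sub>R W 0 t x + (\<Sum>j=1..3. alpha j *v W j t x) = 0" for t x
    proof -
      \<comment> \<open>\<open>?G\<close> is the Dirac operator applied to \<open>\<psi>\<close>,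
        \<open>?H\<close> the product of the two first-order operators applied to \<open>U\<close>.
        The wave equation gives \<open>?H = (- \<i>) *s ?G\<close>, and
        \<open>\<i> * (- \<i>) = 1\<close> makes \<open>?G - \<i> *s ?H\<close> vanish.\<close>
      let ?P = "\<lambda>\<mu> \<nu>. pd \<mu> (pd \<nu> U) t x"
      let ?G = "\<epsilon> *\<^sub>R pd 0 \<psi> t x + (\<Sum>j=1..3. alpha j *v pd j \<psi> t x)"
      let ?H = "\<epsilon> *\<^sub>R (\<epsilon> *\<^sub>R ?P 0 0 - (\<Sum>j=1..3. alpha j *v ?P 0 j)) +
        (\<Sum>k=1..3. alpha k *v (\<epsilon> *\<^sub>R ?P k 0 - (\<Sum>j=1..3. alpha j *v ?P k j)))"
      have sm: "alpha k *v (c *s v) = c *s (alpha k *v v)" for k c v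
        by (simp add: vector_scalar_commute)
      have sr: "\<epsilon> *\<^sub>R (c *s v) = c *s (\<epsilon> *\<^sub>R v)" for c and v :: spinor
        by (simp add: vec_eq_iff)
      have "\<epsilon> *\<^sub>R W 0 t x + (\<Sum>j=1..3. alpha j *v W j t x) = ?G - \<i> *s ?H"
        unfolding W_def scaleR_diff_right[of \<epsilon> "pd 0 \<psi> t x"] matrix_vector_mult_diff_distrib[of _ "pd _ \<psi> t x"] sm sr sum_subtractf
        by (simp only: vector_add_ldistrib sum_cmul[symmetric]) simp
      also have "?H = \<epsilon>\<^sup>2 *\<^sub>R ?P 0 0 - (\<Sum>j=1..3. ?P j j)"
        by (rule dirac_squared) (rule pd_commute[OF U])
      also have "\<dots> = (- \<i>) *s ?G"
        using aux by (simp add: aux_spinor_def)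
      finally show ?thesis by (simp add: vec_eq_iff)
    qed
    show "w 0 x = 0" for x
    proof -
      have U0: "U 0 y = 0" for y using aux by (simp add: aux_spinor_def)
      \<comment> \<open>\<open>U\<close> vanishes on the whole initial slice, hence so do its
        spatial derivatives; the remaining time derivative matches \<open>\<psi>\<close> by the
        other initial condition.\<close>
      have "pd j U 0 x = 0" if "j \<in> {1..3}" for j
        using that by (simp add: pd_def line_space U0)
      then show ?thesis
        using aux by (simp add: w_def aux_spinor_def)
    qed
    show "bounded_linear ((*v) (alpha j))" for j
      by (rule bounded_linear_matrix_vector)
    show "(alpha j *v u) \<bullet> v = u \<bullet> (alpha j *v v)" if "j \<in> {1..3}" for j u v
      by (rule alpha_symmetric[OF that])
    show "norm (alpha j *v u) \<le> norm u" if "j \<in> {1..3}" for j u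
      using alpha_norm[OF that, of u] by simp
  qed (rule eps)
  show ?thesis using solution_zero[of t x] by (simp add: w_def)
qed

lemma sum_rotate: "(\<Sum>j\<in>A. \<Sum>k\<in>B. \<Sum>l\<in>C. f j k l) = (\<Sum>l\<in>C. \<Sum>j\<in>A. \<Sum>k\<in>B. f j k l)"
proof -
  have "(\<Sum>j\<in>A. \<Sum>k\<in>B. \<Sum>l\<in>C. f j k l) = (\<Sum>j\<in>A. \<Sum>l\<in>C. \<Sum>k\<in>B. f j k l)"
    by (intro sum.cong refl sum.swap)
  also have "\<dots> = (\<Sum>l\<in>C. \<Sum>j\<in>A. \<Sum>k\<in>B. f j k l)"
    by (rule sum.swap)
  finally show ?thesis .
qed

theorem lemma2p2:
  fixes \<epsilon> :: real and A :: "nat \<Rightarrow> real field" and \<psi> :: "spinor field"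
  assumes eps: "\<epsilon> > 0"
    and A0_regular: "Ck 1 (A 0)"
    and A_regular: "\<And>j. j \<in> {1..3} \<Longrightarrow> Ck 6 (A j) \<and> decays 4 6 (A j)"
    and div_free: "coulomb A"
    and psi_regular: "Ck 1 \<psi>"
  shows "(\<forall>t x.
      2 *s (\<Sum>j=1..3. complex_of_real (A j t x) *s pd j \<psi> t x)
        = - (\<Sum>j=1..3. \<Sum>k=1..3. Q \<epsilon> j k (nabla_pow (-1) (apot A j k)) \<psi> t x)) \<and>
    (\<forall>U. Ck 2 U \<and> aux_spinor \<epsilon> \<psi> U \<longrightarrow> (\<forall>t x.
      (\<Sum>j=1..3. (\<i> * complex_of_real (Efield \<epsilon> A j t x - pd j (A 0) t x)) *s (alpha j *v \<psi> t x))
        - (\<Sum>j=1..3. complex_of_real (Bfield A j t x) *s (spin j *v \<psi> t x))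
      = (\<Sum>j=1..3. \<Sum>k=1..3. Q \<epsilon> j k (nabla_pow (-1) (dd \<epsilon> 0 (apot A j k))) U t x)
        - (\<Sum>j=1..3. \<Sum>k=1..3. \<Sum>l=1..3.
             Q \<epsilon> j k (nabla_pow (-1) (pd l (apot A j k))) (\<lambda>t x. alpha l *v U t x) t x)
        + (\<Sum>j=1..3. Q0 \<epsilon> (cfield (A j)) (\<lambda>t x. alpha j *v U t x) t x)
        + (\<Sum>j=1..3. \<Sum>k=1..3.
             Q \<epsilon> 0 j (cfield (A k)) (\<lambda>t x. (alpha j ** alpha k) *v U t x) t x)
        - (\<i> / 2) *s (\<Sum>j=1..3. \<Sum>k=1..3. \<Sum>m=1..3. Q \<epsilon> j k (cfield (A m))
             (\<lambda>t x. \<Sum>l=1..3. levi_civita j k l *s ((spin l ** alpha m) *v U t x)) t x)))"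
proof (intro conjI allI impI)
  fix t x
  show "2 *s (\<Sum>j=1..3. complex_of_real (A j t x) *s pd j \<psi> t x)
        = - (\<Sum>j=1..3. \<Sum>k=1..3. Q \<epsilon> j k (nabla_pow (-1) (apot A j k)) \<psi> t x)"
    by (subst apot_null_forms[OF A_regular div_free], assumption) (simp add: cfield_def vec_eq_iff)
next
  fix U t x
  assume "Ck 2 U \<and> aux_spinor \<epsilon> \<psi> U"
  then have U: "Ck 2 U" and aux: "aux_spinor \<epsilon> \<psi> U" by auto
  have U2: "Ck (Suc 1) U" using U by (simp add: numeral_2_eq_2)
  \<comment> \<open>The claim only involves first derivatives at the point \<open>(t, x)\<close>
    once \<open>\<psi>\<close> and the null forms have been rewritten; they are named as in
    \<open>spinor_identity\<close>.\<close>
  define D where "D = \<epsilon> *\<^sub>R pd 0 U t x"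
  define V where "V j = pd j U t x" for j
  define a where "a \<mu> k = dd \<epsilon> \<mu> (cfield (A k)) t x" for \<mu> k
  have psi: "\<psi> t x = \<i> *s (D - (\<Sum>j=1..3. alpha j *v V j))"
    unfolding D_def V_def by (rule Dirac_reconstruction[OF eps psi_regular U aux])
  have a0: "a 0 k = complex_of_real \<epsilon> * cfield (pd 0 (A k)) t x" if "k \<in> {1..3}" for k
    using cfield_pd(1)[OF A_Ck[OF A_regular div_free that], of 0] by (simp add: a_def dd_def scaleR_conv_of_real)
  have a: "a j k = cfield (pd j (A k)) t x" if "j \<in> {1..3}" "k \<in> {1..3}" for j k
    using cfield_pd(1)[OF A_Ck[OF A_regular div_free that(2)], of j] that(1) by (simp add: a_def dd_def)
  have ddU: "dd \<epsilon> 0 U t x = D" "dd \<epsilon> j U t x = V j" if "j \<in> {1..3}" for j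
    using that by (simp_all add: dd_def D_def V_def)
  have div: "a 1 1 + a 2 2 + a 3 3 = 0"
  proof -
    have "a 1 1 + a 2 2 + a 3 3 = complex_of_real (\<Sum>j=1..3. pd j (A j) t x)"
      using a by (simp add: sum_1_3_simps cfield_def)
    then show ?thesis using div_free by (simp only: coulomb_def of_real_0)
  qed
  have linear: "dd \<epsilon> \<mu> (\<lambda>t x. f (U t x)) t x = f (dd \<epsilon> \<mu> U t x)" if "bounded_linear f" "\<mu> \<in> {0..3}" for f :: "spinor \<Rightarrow> spinor" and \<mu>
    by (rule dd_linear[OF that(1) U2 that(2)])
  \<comment> \<open>The gradient of \<open>A 0\<close> cancels against the one inside
    \<open>Efield\<close>, leaving \<open>- \<epsilon>\<close> times the time derivative of
    \<open>A j\<close>.\<close>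
  have E: "(\<Sum>j=1..3. (\<i> * complex_of_real (Efield \<epsilon> A j t x - pd j (A 0) t x)) *s (alpha j *v \<psi> t x)) =
      (\<Sum>j=1..3. (\<i> * (- a 0 j)) *s (alpha j *v \<psi> t x))"
    by (intro sum.cong refl) (simp add: Efield_def a0 cfield_def)
  have levi_of_real: "complex_of_real (levi_civita j k l) = levi_civita j k l" for j k l
    by (simp add: levi_civita_def)
  have B: "complex_of_real (Bfield A j t x) = (\<Sum>k=1..3. \<Sum>l=1..3. levi_civita j k l * a k l)" for j
    unfolding Bfield_def of_real_sum of_real_mult levi_of_real
    by (intro sum.cong refl) (simp add: a cfield_def)
  have T1: "(\<Sum>j=1..3. \<Sum>k=1..3. Q \<epsilon> j k (nabla_pow (-1) (dd \<epsilon> 0 (apot A j k))) U t x) =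
      - 2 *s (\<Sum>k=1..3. a 0 k *s V k)"
    unfolding V_def
    by (subst dd0_apot_null_forms[OF A_regular div_free], assumption)
       (intro arg_cong[where f = "(*s) (- 2)"] sum.cong refl, simp add: a0)
  have T2: "(\<Sum>j=1..3. \<Sum>k=1..3. \<Sum>l=1..3.
        Q \<epsilon> j k (nabla_pow (-1) (pd l (apot A j k))) (\<lambda>t x. alpha l *v U t x) t x) =
      (\<Sum>l=1..3. - 2 *s (\<Sum>k=1..3. a l k *s (alpha l *v V k)))"
  \<comment> \<open>The formula for the null forms of \<open>pd l a\<close> needs \<open>l\<close>
    fixed, because the second argument \<open>alpha l *v U\<close> depends on it; hence the
    \<open>l\<close> sum is moved outside.\<close>
  proof (rule trans[OF sum_rotate], intro sum.cong refl)
    fix l :: nat assume l: "l \<in> {1..3}"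
    have pdU: "pd k (\<lambda>t x. alpha l *v U t x) t x = alpha l *v V k" if "k \<in> {1..3}" for k
      using linear[OF bounded_linear_matrix_vector, of k "alpha l"] that by (simp add: dd_def V_def)
    show "(\<Sum>j=1..3. \<Sum>k=1..3. Q \<epsilon> j k (nabla_pow (-1) (pd l (apot A j k))) (\<lambda>t x. alpha l *v U t x) t x) =
        - 2 *s (\<Sum>k=1..3. a l k *s (alpha l *v V k))"
      by (subst pd_apot_null_forms[OF A_regular div_free l], assumption)
         (intro arg_cong[where f = "(*s) (- 2)"] sum.cong refl, simp add: a[OF l] pdU)
  qed
  have T3: "(\<Sum>j=1..3. Q0 \<epsilon> (cfield (A j)) (\<lambda>t x. alpha j *v U t x) t x) =
      (\<Sum>j=1..3. a 0 j *s (alpha j *v D) - (\<Sum>k=1..3. a k j *s (alpha j *v V k)))"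
  proof (intro sum.cong refl)
    fix j :: nat
    have "pd k (cfield (A j)) t x *s pd k (\<lambda>t x. alpha j *v U t x) t x = a k j *s (alpha j *v V k)" if "k \<in> {1..3}" for k
      using linear[OF bounded_linear_matrix_vector, of k "alpha j"] that by (simp add: dd_def V_def a_def)
    then show "Q0 \<epsilon> (cfield (A j)) (\<lambda>t x. alpha j *v U t x) t x =
        a 0 j *s (alpha j *v D) - (\<Sum>k=1..3. a k j *s (alpha j *v V k))"
      unfolding Q0_def using linear[OF bounded_linear_matrix_vector, of 0 "alpha j"]
      by (simp add: a_def[symmetric] ddU(1)[of 1])
  qed
  have T4: "(\<Sum>j=1..3. \<Sum>k=1..3. Q \<epsilon> 0 j (cfield (A k)) (\<lambda>t x. (alpha j ** alpha k) *v U t x) t x) =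
      (\<Sum>j=1..3. \<Sum>k=1..3. a 0 k *s (alpha j *v (alpha k *v V j)) - a j k *s (alpha j *v (alpha k *v D)))"
  proof (intro sum.cong refl)
    fix j k :: nat assume j: "j \<in> {1..3}"
    then show "Q \<epsilon> 0 j (cfield (A k)) (\<lambda>t x. (alpha j ** alpha k) *v U t x) t x =
        a 0 k *s (alpha j *v (alpha k *v V j)) - a j k *s (alpha j *v (alpha k *v D))"
      unfolding Q_def
      using linear[OF bounded_linear_matrix_vector, of 0 "alpha j ** alpha k"]
        linear[OF bounded_linear_matrix_vector, of j "alpha j ** alpha k"] ddU[OF j]
      by (simp add: a_def[symmetric] matrix_vector_mul_assoc)
  qed
  have T5: "(\<Sum>j=1..3. \<Sum>k=1..3. \<Sum>m=1..3. Q \<epsilon> j k (cfield (A m))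
        (\<lambda>t x. \<Sum>l=1..3. levi_civita j k l *s ((spin l ** alpha m) *v U t x)) t x) =
      (\<Sum>j=1..3. \<Sum>k=1..3. \<Sum>m=1..3.
        a j m *s (\<Sum>l=1..3. levi_civita j k l *s (spin l *v (alpha m *v V k))) -
        a k m *s (\<Sum>l=1..3. levi_civita j k l *s (spin l *v (alpha m *v V j))))"
  proof (intro sum.cong refl)
    fix j k m :: nat assume j: "j \<in> {1..3}" and k: "k \<in> {1..3}"
    have "bounded_linear (\<lambda>v::spinor. \<Sum>l=1..3. levi_civita j k l *s ((spin l ** alpha m) *v v))"
      by (intro bounded_linear_sum bounded_linear_compose[OF bounded_linear_vector_smult] bounded_linear_matrix_vector)
    from linear[OF this, of j] linear[OF this, of k] j k
    show "Q \<epsilon> j k (cfield (A m)) (\<lambda>t x. \<Sum>l=1..3. levi_civita j k l *s ((spin l ** alpha m) *v U t x)) t x =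
        a j m *s (\<Sum>l=1..3. levi_civita j k l *s (spin l *v (alpha m *v V k))) -
        a k m *s (\<Sum>l=1..3. levi_civita j k l *s (spin l *v (alpha m *v V j)))"
      unfolding Q_def by (simp add: a_def[symmetric] ddU matrix_vector_mul_assoc)
  qed
  show "(\<Sum>j=1..3. (\<i> * complex_of_real (Efield \<epsilon> A j t x - pd j (A 0) t x)) *s (alpha j *v \<psi> t x))
        - (\<Sum>j=1..3. complex_of_real (Bfield A j t x) *s (spin j *v \<psi> t x))
      = (\<Sum>j=1..3. \<Sum>k=1..3. Q \<epsilon> j k (nabla_pow (-1) (dd \<epsilon> 0 (apot A j k))) U t x)
        - (\<Sum>j=1..3. \<Sum>k=1..3. \<Sum>l=1..3.
             Q \<epsilon> j k (nabla_pow (-1) (pd l (apot A j k))) (\<lambda>t x. alpha l *v U t x) t x)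
        + (\<Sum>j=1..3. Q0 \<epsilon> (cfield (A j)) (\<lambda>t x. alpha j *v U t x) t x)
        + (\<Sum>j=1..3. \<Sum>k=1..3.
             Q \<epsilon> 0 j (cfield (A k)) (\<lambda>t x. (alpha j ** alpha k) *v U t x) t x)
        - (\<i> / 2) *s (\<Sum>j=1..3. \<Sum>k=1..3. \<Sum>m=1..3. Q \<epsilon> j k (cfield (A m))
             (\<lambda>t x. \<Sum>l=1..3. levi_civita j k l *s ((spin l ** alpha m) *v U t x)) t x)"
    unfolding E B T1 T2 T3 T4 T5 unfolding psi by (rule spinor_identity[where a = a, OF div])
qed

end
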